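(* Let $r\ge1$, let $X$ be the set of permutations of $\{1,\dots,r\}$ and let $\rho\colon X\to X$ be the rotation map, i.e. the action on permutations (by conjugation) of the long cycle $i\mapsto(i\bmod r)+1$. Let $$P(q)=\mathrm{fd}\,\mathrm{ch}\,S_r=\mathrm{fd}\sum_{\lambda\vdash r}p_\lambda,$$ where $S_r$ is the species of permutations of sets of cardinality $r$ and $p_\lambda$ are the power sum symmetric functions. Then the triple $(X,\rho,P(q))$ exhibits the cyclic sieving phenomenon (for the cyclic group of order $r$).
   Context: $S_r$, as a representation of $\mathfrak S_r$, is the permutation representation on $\mathfrak S_r$ by conjugation; $\mathrm{ch}$ denotes the Frobenius character $\frac1{r!}\sum_{\sigma\in\mathfrak S_r}\mathrm{tr}(\sigma)\,p_{\mathrm{cycle\ type}(\sigma)}$. Fake degree: $\mathrm{fd}$ is the linear map on homogeneous symmetric functions with $\mathrm{fd}(s_\lambda)=\sum_Tq^{\mathrm{maj}(T)}$, the sum over standard Young tableaux $T$ of shape $\lambda$, where $\mathrm{maj}(T)$ is the sum of those $i$ such that $i+1$ is in a strictly lower row (English notation) than $i$. Cyclic sieving: for a finite set $X$, a bijection $c$ of $X$ with $c^N=\mathrm{id}$ and $P\in\mathbb Z[q]$, the triple $(X,c,P)$ exhibits the cyclic sieving phenomenon if $P(\omega^j)=\#\{x\in X:c^j(x)=x\}$ for $0\le j\le N-1$, $\omega=\exp(2\pi i/N)$. Here $N=r$. *)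

theory Defs
  imports
    Complex_Main
    "HOL-Library.Multiset"
    "HOL-Computational_Algebra.Polynomial"
    "HOL-Combinatorics.Permutations"
    "HOL-Combinatorics.Orbits"
begin

text \<open>
  A formal power series with rational coefficients in the variables \<open>x\<^sub>0, x\<^sub>1, x\<^sub>2, \<dots>\<close> is given by
  its coefficient function. A monomial is encoded as the multiset of the indices of its variables,
  so that \<open>{#0, 0, 3#}\<close> is \<open>x\<^sub>0 x\<^sub>0 x\<^sub>3\<close> and the product of monomials is the sum of multisets.
\<close>

type_synonym series = "nat multiset \<Rightarrow> rat"

definition series_one :: series where
  "series_one m = (if m = {#} then 1 else 0)"

definition series_mult :: "series \<Rightarrow> series \<Rightarrow> series" where
  "series_mult f g m = (\<Sum>a | a \<subseteq># m. f a * g (m - a))"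

definition partitions :: "nat \<Rightarrow> nat list set" where
  "partitions r = {\<mu>. sorted_wrt (\<ge>) \<mu> \<and> (\<forall>k\<in>set \<mu>. 0 < k) \<and> sum_list \<mu> = r}"

text \<open>\<open>p\<^sub>k = \<Sum>\<^sub>i x\<^sub>i\<^sup>k\<close> for \<open>k \<ge> 1\<close>, and \<open>p\<^sub>\<mu>\<close> is the product of the \<open>p\<^sub>k\<close> over the parts \<open>k\<close> of \<open>\<mu>\<close>.\<close>

definition power_sum1 :: "nat \<Rightarrow> series" where
  "power_sum1 k m = (if \<exists>i. m = replicate_mset k i then 1 else 0)"

definition power_sum :: "nat list \<Rightarrow> series" where
  "power_sum \<mu> = foldr (\<lambda>k. series_mult (power_sum1 k)) \<mu> series_one"

text \<open>
  A tableau in English notation is the list of its rows from top to bottom; its shape is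
  \<open>map length T\<close>.
\<close>

definition ssyt :: "nat list \<Rightarrow> nat list list set" where
  "ssyt \<mu> = {T. map length T = \<mu> \<and> (\<forall>row\<in>set T. sorted row) \<and>
     (\<forall>i j. Suc i < length T \<longrightarrow> j < length (T ! Suc i) \<longrightarrow> T ! i ! j < T ! Suc i ! j)}"

definition schur :: "nat list \<Rightarrow> series" where
  "schur \<mu> m = of_nat (card {T \<in> ssyt \<mu>. mset (concat T) = m})"

definition syt :: "nat list \<Rightarrow> nat list list set" where
  "syt \<mu> = {T. map length T = \<mu> \<and> (\<forall>row\<in>set T. sorted_wrt (<) row) \<and>
     (\<forall>i j. Suc i < length T \<longrightarrow> j < length (T ! Suc i) \<longrightarrow> T ! i ! j < T ! Suc i ! j) \<and>
     mset (concat T) = mset_set {1..sum_list \<mu>}}"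

definition maj :: "nat list list \<Rightarrow> nat" where
  "maj T = \<Sum>{i. \<exists>a b. a < b \<and> b < length T \<and> i \<in> set (T ! a) \<and> Suc i \<in> set (T ! b)}"

text \<open>
  The Schur functions \<open>s\<^sub>\<mu>\<close> with \<open>\<mu>\<close> a partition of \<open>r\<close> form a basis of the space of homogeneous
  symmetric functions of degree \<open>r\<close>. Hence, for \<open>f\<close> in this space, the coordinates chosen below
  exist and are unique on \<open>partitions r\<close>, and \<open>fake_degree r\<close> is the linear extension of
  \<open>s\<^sub>\<mu> \<mapsto> \<Sum>\<^sub>T q\<^bsup>maj(T)\<^esup>\<close>. The values on other series are irrelevant.
\<close>

definition schur_coeff :: "nat \<Rightarrow> series \<Rightarrow> nat list \<Rightarrow> rat" where
  "schur_coeff r f = (SOME c. \<forall>m. f m = (\<Sum>\<mu>\<in>partitions r. c \<mu> * schur \<mu> m))"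

definition fake_degree :: "nat \<Rightarrow> series \<Rightarrow> rat poly" where
  "fake_degree r f =
     (\<Sum>\<mu>\<in>partitions r. smult (schur_coeff r f \<mu>) (\<Sum>T\<in>syt \<mu>. monom 1 (maj T)))"

definition perms :: "nat \<Rightarrow> (nat \<Rightarrow> nat) set" where
  "perms r = {\<sigma>. \<sigma> permutes {1..r}}"

definition cycle_type :: "nat \<Rightarrow> (nat \<Rightarrow> nat) \<Rightarrow> nat list" where
  "cycle_type r \<sigma> = rev (sorted_list_of_multiset (image_mset card (mset_set (orbit \<sigma> ` {1..r}))))"

text \<open>
  A representation on the space with basis \<open>X\<close> is given by its matrices: \<open>M \<sigma> y x\<close> is the
  coefficient of \<open>y\<close> in the image of \<open>x\<close> under \<open>\<sigma>\<close>.
\<close>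

definition perm_rep :: "('g \<Rightarrow> 'x \<Rightarrow> 'x) \<Rightarrow> 'g \<Rightarrow> 'x \<Rightarrow> 'x \<Rightarrow> rat" where
  "perm_rep act \<sigma> y x = (if y = act \<sigma> x then 1 else 0)"

definition trace_on :: "'x set \<Rightarrow> ('x \<Rightarrow> 'x \<Rightarrow> rat) \<Rightarrow> rat" where
  "trace_on X A = (\<Sum>x\<in>X. A x x)"

definition frobenius_ch :: "nat \<Rightarrow> 'x set \<Rightarrow> ((nat \<Rightarrow> nat) \<Rightarrow> 'x \<Rightarrow> 'x \<Rightarrow> rat) \<Rightarrow> series" where
  "frobenius_ch r X M m =
     (1 / fact r) * (\<Sum>\<sigma>\<in>perms r. trace_on X (M \<sigma>) * power_sum (cycle_type r \<sigma>) m)"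

definition conj_act :: "(nat \<Rightarrow> nat) \<Rightarrow> (nat \<Rightarrow> nat) \<Rightarrow> nat \<Rightarrow> nat" where
  "conj_act \<sigma> \<tau> = \<sigma> \<circ> \<tau> \<circ> inv \<sigma>"

definition ch_S :: "nat \<Rightarrow> series" where
  "ch_S r = frobenius_ch r (perms r) (perm_rep conj_act)"

definition long_cycle :: "nat \<Rightarrow> nat \<Rightarrow> nat" where
  "long_cycle r i = (if i \<in> {1..r} then i mod r + 1 else i)"

definition rotation :: "nat \<Rightarrow> (nat \<Rightarrow> nat) \<Rightarrow> nat \<Rightarrow> nat" where
  "rotation r = conj_act (long_cycle r)"

definition cyclic_sieving :: "nat \<Rightarrow> 'x set \<Rightarrow> ('x \<Rightarrow> 'x) \<Rightarrow> int poly \<Rightarrow> bool" where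
  "cyclic_sieving N X c P \<longleftrightarrow>
     finite X \<and> bij_betw c X X \<and> (\<forall>x\<in>X. (c ^^ N) x = x) \<and>
     (\<forall>j<N. poly (map_poly of_int P) (exp (2 * of_real pi * \<i> / of_nat N) ^ j) =
        (of_nat (card {x \<in> X. (c ^^ j) x = x}) :: complex))"

end

theory Submission
  imports
    Defs
    "HOL-Combinatorics.Cycles"
    "HOL-Computational_Algebra.Polynomial_FPS"
    "HOL-Library.FuncSet"
    "HOL-Library.Product_Lexorder"
begin

text \<open>
  The fake degree of a homogeneous symmetric function \<open>f\<close> of degree \<open>r\<close> is, up to replacing \<open>maj\<close> by
  \<open>comaj\<close>, its stable principal specialisation times \<open>(1 - q) \<dots> (1 - q\<^sup>r)\<close>: standardisation writes a
  Schur function as a sum of fundamental quasisymmetric functions indexed by standard tableaux.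
  Since \<open>maj + comaj\<close> is a multiple of \<open>r\<close>, the two versions are complex conjugates of each other at
  \<open>r\<close>-th roots of unity. For \<open>p\<^sub>\<mu>\<close> the specialisation is \<open>\<Prod>\<^sub>k 1 / (1 - q\<^sup>k)\<close> over the parts \<open>k\<close> of \<open>\<mu>\<close>, so
  at a root of unity of order \<open>d\<close>, where \<open>r = d n\<close>, the fake degree of \<open>p\<^sub>\<mu>\<close> vanishes unless all parts
  of \<open>\<mu>\<close> equal \<open>d\<close>, and then it is \<open>d\<^sup>n n!\<close>. This is also the order of the centraliser of a power of the
  long cycle having order \<open>d\<close>. Finally \<open>ch S\<^sub>r = \<Sum> p\<^sub>\<lambda>\<close> because every conjugacy class of size \<open>c\<close>
  contributes \<open>c\<close> centralisers of order \<open>r! / c\<close>.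

  That power sums have Schur expansions at all rests on the symmetry of the tableau generating
  functions and on the unitriangularity of the Kostka numbers, which also makes the coefficients
  integral.
\<close>

section \<open>Symmetry of Schur functions\<close>

text \<open>The Schur coefficients in \<open>fake_degree\<close> come from \<open>SOME\<close> and
  are never computed. They are seen only through the specialisation sending \<open>x_i\<close> to
  \<open>q^i\<close>, under which every Schur function of degree \<open>r\<close> acquires the same
  factor \<open>weighted_fps r\<close>; multiplying it away leaves the polynomial in question. The
  specialised power sums have poles at exactly the roots of unity that matter. Hence all equations
  are kept in multiplied-out form, moved from power series to polynomials, and freed of the common
  zeros \<open>1 - q^d\<close> before anything is evaluated. Integrality of the coefficients matters
  because the sieving polynomial lives over the integers while the fake degree is a rational
  polynomial. Complex conjugation is harmless in the end because all values are natural
  numbers.\<close>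

lemma ssyt_iff:
  "T \<in> ssyt \<mu> \<longleftrightarrow> length T = length \<mu> \<and> (\<forall>i<length \<mu>. length (T ! i) = \<mu> ! i \<and> sorted (T ! i)) \<and>
     (\<forall>i j. Suc i < length \<mu> \<longrightarrow> j < \<mu> ! Suc i \<longrightarrow> T ! i ! j < T ! Suc i ! j)"
  by (auto simp: ssyt_def list_eq_iff_nth_eq all_set_conv_all_nth)

lemma size_mset_concat: "map length T = \<mu> \<Longrightarrow> size (mset (concat T)) = sum_list \<mu>"
  by (auto simp: length_concat)

text \<open>Once the shape is fixed, a tableau is determined by its reading word
  \<open>concat T\<close>, and a multiset has only finitely many arrangements.\<close>

lemma finite_tableaux_mset: "finite {T :: 'a list list. map length T = \<mu> \<and> mset (concat T) = m}"
proof -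
  obtain xs where "mset xs = m" using ex_mset by blast
  have "finite (concat ` {T. map length T = \<mu> \<and> mset (concat T) = m})"
    using \<open>mset xs = m\<close> by (auto intro: finite_subset[OF _ mset_eq_finite[of xs]])
  moreover have "inj_on concat {T :: 'a list list. map length T = \<mu> \<and> mset (concat T) = m}"
    by (intro inj_onI, rule concat_injective) (auto simp: in_set_zip list_eq_iff_nth_eq)
  ultimately show ?thesis
    using finite_imageD by blast
qed

lemma finite_ssyt_mset: "finite {T \<in> ssyt \<mu>. mset (concat T) = m}"
  by (rule finite_subset[OF _ finite_tableaux_mset[of \<mu> m]]) (auto simp: ssyt_def)

section \<open>Horizontal strips and Kostka numbers\<close>

definition hstrips :: "nat list \<Rightarrow> nat list set" where
  "hstrips \<mu> = {\<nu>. length \<nu> = length \<mu> \<and> (\<forall>i<length \<mu>. \<nu> ! i \<le> \<mu> ! i) \<and>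
     (\<forall>i. Suc i < length \<mu> \<longrightarrow> \<mu> ! Suc i \<le> \<nu> ! i)}"

text \<open>The Kostka number for the values below \<open>n\<close>, computed by peeling off the
  cells of the largest value, which form a horizontal strip. Inner shapes are padded with zeros to
  the length of \<open>\<mu>\<close>, so the row indices stay the same throughout the recursion. The
  content is a function so that exchanging two values is composition with a transposition.\<close>

fun kostka :: "nat \<Rightarrow> nat list \<Rightarrow> (nat \<Rightarrow> nat) \<Rightarrow> nat" where
  "kostka 0 \<mu> \<alpha> = (if sum_list \<mu> = 0 then 1 else 0)"
| "kostka (Suc n) \<mu> \<alpha> = (\<Sum>\<nu>\<in>{\<nu> \<in> hstrips \<mu>. sum_list \<mu> = sum_list \<nu> + \<alpha> n}. kostka n \<nu> \<alpha>)"

lemma kostka_cong: "(\<And>i. i < n \<Longrightarrow> \<alpha> i = \<beta> i) \<Longrightarrow> kostka n \<mu> \<alpha> = kostka n \<mu> \<beta>"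
  by (induction n arbitrary: \<mu>) simp_all

lemma finite_hstrips: "finite (hstrips \<mu>)"
proof (rule finite_subset[OF _ finite_lists_length_eq[of "{..sum_list \<mu>}" "length \<mu>"]])
  show "hstrips \<mu> \<subseteq> {xs. set xs \<subseteq> {..sum_list \<mu>} \<and> length xs = length \<mu>}"
    using elem_le_sum_list[of _ \<mu>] by (fastforce simp: hstrips_def in_set_conv_nth intro: order.trans)
qed auto

text \<open>The chain \<open>\<nu> ! Suc i \<le> \<mu> ! Suc i \<le> \<nu> ! i\<close> keeps the
  recursion of \<open>kostka\<close> among weakly decreasing shapes.\<close>

lemma hstrips_antimono:
  assumes "\<nu> \<in> hstrips \<mu>"
  shows "sorted_wrt (\<ge>) \<nu>"
  unfolding sorted_wrt_iff_nth_Suc_transp[OF transp_on_ge]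
  using assms unfolding hstrips_def by (auto intro: order.trans Suc_lessD)

lemma sorted_split_max:
  assumes "sorted xs" "\<forall>x\<in>set xs. x \<le> (n::nat)"
  shows "xs = filter (\<lambda>x. x < n) xs @ replicate (length xs - length (filter (\<lambda>x. x < n) xs)) n"
  using assms
proof (induction xs)
  case (Cons x xs)
  show ?case
  proof (cases "x < n")
    case True
    then show ?thesis using Cons by simp
  next
    case False
    then have "\<forall>y\<in>set (x # xs). y = n" using Cons.prems by force
    then show ?thesis
      by (metis (no_types, lifting) append_Nil diff_zero filter_False less_irrefl list.size(3)
          replicate_length_same)
  qed
qed simp

lemma mset_split_max:
  assumes "set_mset M \<subseteq> {..<Suc n}"
  shows "M = filter_mset (\<lambda>x. x < n) M + replicate_mset (count M n) n"
proof (rule multiset_eqI)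
  fix x
  show "count M x = count (filter_mset (\<lambda>x. x < n) M + replicate_mset (count M n) n) x"
    using assms by (cases "x < n"; cases "x = n") (auto simp: not_in_iff)
qed

text \<open>Cells with the largest value \<open>n\<close> sit at the ends of their rows, and no two
  of them share a column. Erasing them (\<open>f\<close>) and filling the rows up again with
  \<open>n\<close> (\<open>g\<close>) are inverse to each other.\<close>

lemma card_ssyt_kostka:
  assumes "sorted_wrt (\<ge>) \<mu>" "set_mset m \<subseteq> {..<n}"
  shows "card {T \<in> ssyt \<mu>. mset (concat T) = m} = kostka n \<mu> (count m)"
  using assms
proof (induction n arbitrary: \<mu> m)
  case 0
  then have [simp]: "m = {#}" by auto
  show ?case
  proof (cases "sum_list \<mu> = 0")
    case True
    then have \<mu>: "\<mu> = replicate (length \<mu>) 0" by (auto intro: replicate_eqI)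
    have 0: "\<mu> ! i = 0" if "i < length \<mu>" for i using that by (subst \<mu>) simp
    have "T = replicate (length \<mu>) []" if "T \<in> ssyt \<mu>" for T
      using that 0 by (intro nth_equalityI) (auto simp: ssyt_iff)
    moreover have "replicate (length \<mu>) [] \<in> ssyt \<mu>" using 0 by (auto simp: ssyt_iff)
    moreover have "mset (concat (replicate (length \<mu>) [])) = m" by simp
    ultimately have "{T \<in> ssyt \<mu>. mset (concat T) = m} = {replicate (length \<mu>) []}"
      by blast
    then show ?thesis using True by simp
  next
    case False
    then have "{T \<in> ssyt \<mu>. mset (concat T) = m} = {}"
      using size_mset_concat[of _ \<mu>] by (metis (mono_tags, lifting) \<open>m = {#}\<close> empty_Collect_eq
          mem_Collect_eq size_empty ssyt_def)
    then show ?thesis using False by (simp only: card.empty kostka.simps if_False)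
  qed
next
  case (Suc n)
  define m0 where "m0 = filter_mset (\<lambda>x. x < n) m"
  have m: "m = m0 + replicate_mset (count m n) n"
    unfolding m0_def by (rule mset_split_max[OF Suc.prems(2)])
  define S where "S = {\<nu> \<in> hstrips \<mu>. sum_list \<mu> = sum_list \<nu> + count m n}"
  define B where "B \<nu> = {T \<in> ssyt \<nu>. mset (concat T) = m0}" for \<nu>
  define f where "f = map (filter (\<lambda>x. x < n))"
  define g where "g = (\<lambda>T :: nat list list. map (\<lambda>i. T ! i @ replicate (\<mu> ! i - length (T ! i)) n) [0..<length \<mu>])"
  let ?A = "{T \<in> ssyt \<mu>. mset (concat T) = m}"
  have \<mu>mono: "\<mu> ! j \<le> \<mu> ! i" if "i \<le> j" "j < length \<mu>" for i j
    using Suc.prems(1) that by (metis le_eq_less_or_eq sorted_wrt_nth_less)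
  have mset_f: "mset (concat (f T)) = filter_mset (\<lambda>x. x < n) (mset (concat T))" for T
    unfolding f_def by (simp add: filter_concat[symmetric])
  have A_row: "T ! i = f T ! i @ replicate (\<mu> ! i - length (f T ! i)) n"
    if "T \<in> ?A" "i < length \<mu>" for T i
  proof -
    have "set (T ! i) \<subseteq> set_mset m" using that nth_mem[of i T] by (auto simp: ssyt_iff simp del: nth_mem)
    then have "\<forall>x\<in>set (T ! i). x \<le> n" using Suc.prems(2) by fastforce
    then show ?thesis
      using sorted_split_max[of "T ! i" n] that by (simp add: ssyt_iff f_def)
  qed
  have f_nth: "T ! i ! j = (if j < length (f T ! i) then f T ! i ! j else n)"
    if "T \<in> ?A" "i < length \<mu>" "j < \<mu> ! i" for T i j
    by (subst A_row[OF that(1,2)], subst nth_append) (use that in auto)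
  have f_less: "f T ! i ! j < n" if "length T = length \<mu>" "i < length \<mu>" "j < length (f T ! i)" for T i j
    using that nth_mem[of j "filter (\<lambda>x. x < n) (T ! i)"] by (auto simp: f_def)
  have f_mem: "f T \<in> (\<Union>\<nu>\<in>S. B \<nu>)" if T: "T \<in> ?A" for T
  proof -
    define \<nu> where "\<nu> = map length (f T)"
    have [simp]: "length T = length \<mu>" using T by (simp add: ssyt_iff)
    have len: "length (f T) = length \<mu>" by (simp add: f_def)
    have \<nu>: "length \<nu> = length \<mu>" "\<And>i. i < length \<mu> \<Longrightarrow> \<nu> ! i = length (f T ! i)"
      by (simp_all add: \<nu>_def len)
    have \<nu>\<mu>: "\<nu> ! i \<le> \<mu> ! i" if "i < length \<mu>" for i
      using that T by (simp add: \<nu>) (auto simp: f_def ssyt_iff intro: order.trans[OF length_filter_le])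
    \<comment> \<open>Otherwise some cell of row \<open>Suc i\<close> lies below a cell containing
      \<open>n\<close> and would have to exceed \<open>n\<close>.\<close>
    have str: "\<mu> ! Suc i \<le> \<nu> ! i" if i: "Suc i < length \<mu>" for i
    proof (rule ccontr)
      assume "\<not> ?thesis"
      then have j: "\<nu> ! i < \<mu> ! Suc i" by simp
      have "\<nu> ! i < \<mu> ! i" using j \<mu>mono[of i "Suc i"] i by simp
      then have "T ! i ! (\<nu> ! i) = n"
        using f_nth[OF T, of i "\<nu> ! i"] i \<nu> by simp
      moreover have "T ! i ! (\<nu> ! i) < T ! Suc i ! (\<nu> ! i)"
        using T i j by (simp add: ssyt_iff)
      moreover have "T ! Suc i ! (\<nu> ! i) \<le> n"
        using f_nth[OF T i j] f_less[of T "Suc i" "\<nu> ! i"] i by (auto split: if_splits)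
      ultimately show False by simp
    qed
    have hs: "\<nu> \<in> hstrips \<mu>" unfolding hstrips_def using \<nu> \<nu>\<mu> str by blast
    have mf: "mset (concat (f T)) = m0" using T by (simp add: mset_f m0_def)
    have "f T \<in> ssyt \<nu>"
      unfolding ssyt_iff
    proof (intro conjI allI impI)
      show "length (f T) = length \<nu>" by (simp add: \<nu>_def)
      show "length (f T ! i) = \<nu> ! i" "sorted (f T ! i)" if "i < length \<nu>" for i
        using that \<nu> T by (simp_all add: f_def ssyt_iff sorted_wrt_filter)
      show "f T ! i ! j < f T ! Suc i ! j" if ij: "Suc i < length \<nu>" "j < \<nu> ! Suc i" for i j
      proof -
        have 1: "j < \<mu> ! Suc i" using ij \<nu>\<mu>[of "Suc i"] \<nu>(1) by simp
        have 2: "j < \<nu> ! i" using 1 str[of i] ij \<nu> by simp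
        have 3: "j < \<mu> ! i" using 2 \<nu>\<mu>[of i] ij \<nu>(1) by simp
        have "T ! i ! j < T ! Suc i ! j" using T 1 ij \<nu>(1) by (simp add: ssyt_iff)
        then show ?thesis
          using f_nth[OF T _ 1] f_nth[OF T _ 3] ij 2 \<nu> by simp
      qed
    qed
    moreover have "sum_list \<mu> = sum_list \<nu> + count m n"
    proof -
      have "sum_list \<mu> = size m" using T size_mset_concat[of T \<mu>] by (auto simp: ssyt_def)
      moreover have "sum_list \<nu> = size m0" using mf size_mset_concat[of "f T" \<nu>] \<nu>_def by auto
      ultimately show ?thesis by (subst (asm) m) simp
    qed
    ultimately show ?thesis using hs mf by (auto simp: S_def B_def)
  qed
  have gf: "g (f T) = T" if T: "T \<in> ?A" for T
  proof (rule nth_equalityI)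
    show "length (g (f T)) = length T" using T by (simp add: g_def ssyt_iff)
    fix i assume "i < length (g (f T))"
    then have i: "i < length \<mu>" by (simp add: g_def)
    show "g (f T) ! i = T ! i" unfolding A_row[OF T i] using i by (simp add: g_def)
  qed
  have BD: "length \<nu> = length \<mu>" "T \<in> ssyt \<nu>" "length T = length \<mu>" "mset (concat T) = m0"
     "\<nu> \<in> hstrips \<mu>" "sum_list \<mu> = sum_list \<nu> + count m n"
    "\<And>i. i < length \<mu> \<Longrightarrow> length (T ! i) = \<nu> ! i"
    "\<And>i. i < length \<mu> \<Longrightarrow> \<nu> ! i \<le> \<mu> ! i"
    "\<And>i x. i < length \<mu> \<Longrightarrow> x \<in> set (T ! i) \<Longrightarrow> x < n"
    if "\<nu> \<in> S" "T \<in> B \<nu>" for \<nu> T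
  proof -
    show "length \<nu> = length \<mu>" "T \<in> ssyt \<nu>" "length T = length \<mu>" and m0: "mset (concat T) = m0"
     and "\<nu> \<in> hstrips \<mu>" "sum_list \<mu> = sum_list \<nu> + count m n"
    "\<And>i. i < length \<mu> \<Longrightarrow> length (T ! i) = \<nu> ! i"
    "\<And>i. i < length \<mu> \<Longrightarrow> \<nu> ! i \<le> \<mu> ! i"
      using that by (auto simp: S_def B_def hstrips_def ssyt_iff)
    show "x < n" if "i < length \<mu>" "x \<in> set (T ! i)" for i x
    proof -
      have "x \<in># mset (concat T)" using that \<open>length T = length \<mu>\<close> by auto
      then show ?thesis unfolding m0 m0_def by simp
    qed
  qed
  have fg: "f (g T) = T" if "\<nu> \<in> S" "T \<in> B \<nu>" for T \<nu>
  proof (rule nth_equalityI)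
    show "length (f (g T)) = length T" using BD(3)[OF that] by (simp add: f_def g_def)
    fix i assume "i < length (f (g T))"
    then have i: "i < length \<mu>" by (simp add: f_def g_def)
    have "filter (\<lambda>x. x < n) (T ! i) = T ! i"
      using BD(9)[OF that i] by (simp add: filter_id_conv)
    then show "f (g T) ! i = T ! i" using i by (simp add: f_def g_def)
  qed
  have g_mem: "g T \<in> ?A" if "\<nu> \<in> S" "T \<in> B \<nu>" for T \<nu>
  proof -
    note D = BD[OF that]
    have gT: "g T \<in> ssyt \<mu>"
      unfolding ssyt_iff
    proof (intro conjI allI impI)
      show "length (g T) = length \<mu>" by (simp add: g_def)
      show "length (g T ! i) = \<mu> ! i" "sorted (g T ! i)" if "i < length \<mu>" for i
        using that D(1) D(7-9)[OF that] D(2)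
        by (auto simp: g_def sorted_append ssyt_iff intro: less_imp_le)
      show "g T ! i ! j < g T ! Suc i ! j" if ij: "Suc i < length \<mu>" "j < \<mu> ! Suc i" for i j
      proof -
        have 1: "\<mu> ! Suc i \<le> \<nu> ! i" using D(5) ij by (simp add: hstrips_def)
        then have "g T ! i ! j = T ! i ! j" "T ! i ! j < n"
          using ij D(7)[of i] D(9)[of i "T ! i ! j"] by (auto simp: g_def nth_append)
        moreover have "g T ! Suc i ! j = (if j < \<nu> ! Suc i then T ! Suc i ! j else n)"
          using ij D(7)[of "Suc i"] by (auto simp: g_def nth_append)
        ultimately show ?thesis using D(2) ij D(1) by (auto simp: ssyt_iff)
      qed
    qed
    define M where "M = mset (concat (g T))"
    have M0: "filter_mset (\<lambda>x. x < n) M = m0"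
      unfolding M_def mset_f[symmetric] fg[OF that] by (rule D(4))
    have "set_mset M \<subseteq> {..<Suc n}"
    proof
      fix x assume "x \<in># M"
      then obtain i where "i < length \<mu>" "x \<in> set (g T ! i)"
        by (auto simp: M_def in_set_conv_nth[of _ "g T"] g_def)
      then show "x \<in> {..<Suc n}" using D(9)[of i x] by (auto simp: g_def)
    qed
    then have M: "M = m0 + replicate_mset (count M n) n"
      using mset_split_max[of M n] M0 by simp
    \<comment> \<open>The entries below \<open>n\<close> are already known to be \<open>m0\<close>,
      so comparing sizes fixes the number of copies of \<open>n\<close>.\<close>
    have "size M = sum_list \<mu>" using gT size_mset_concat[of "g T" \<mu>] by (auto simp: ssyt_def M_def)
    moreover have "size m0 = sum_list \<nu>"
      using D(2,4) size_mset_concat[of T \<nu>] by (auto simp: ssyt_def)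
    ultimately have "count M n = count m n" using D(6) by (subst (asm) M) simp
    then have "M = m" using M m by metis
    then show ?thesis using gT by (simp add: M_def)
  qed
  have "bij_betw f ?A (\<Union>\<nu>\<in>S. B \<nu>)"
  proof (rule bij_betw_byWitness[where f' = g])
    show "\<forall>T\<in>?A. g (f T) = T" using gf by blast
    show "\<forall>T\<in>\<Union>\<nu>\<in>S. B \<nu>. f (g T) = T" using fg by blast
    show "f ` ?A \<subseteq> (\<Union>\<nu>\<in>S. B \<nu>)" using f_mem by blast
    show "g ` (\<Union>\<nu>\<in>S. B \<nu>) \<subseteq> ?A" using g_mem by blast
  qed
  then have "card ?A = card (\<Union>\<nu>\<in>S. B \<nu>)" by (rule bij_betw_same_card)
  also have "\<dots> = (\<Sum>\<nu>\<in>S. card (B \<nu>))"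
  proof (rule card_UN_disjoint)
    show "finite S" by (simp add: S_def finite_hstrips)
    show "\<forall>\<nu>\<in>S. finite (B \<nu>)" by (simp add: B_def finite_ssyt_mset)
    show "\<forall>\<nu>\<in>S. \<forall>\<nu>'\<in>S. \<nu> \<noteq> \<nu>' \<longrightarrow> B \<nu> \<inter> B \<nu>' = {}" by (auto simp: B_def ssyt_def)
  qed
  also have "\<dots> = (\<Sum>\<nu>\<in>S. kostka n \<nu> (count m0))"
    unfolding B_def
    by (intro sum.cong refl Suc.IH) (auto simp: S_def m0_def intro: hstrips_antimono)
  also have "\<dots> = (\<Sum>\<nu>\<in>S. kostka n \<nu> (count m))"
    by (intro sum.cong refl kostka_cong) (simp add: m0_def)
  finally show ?case by (simp add: S_def)
qed

section \<open>Interlacing shapes and the exchange of two adjacent values\<close>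

definition interlacing :: "nat list \<Rightarrow> nat list \<Rightarrow> nat list set" where
  "interlacing \<mu> \<kappa> = {\<nu> \<in> hstrips \<mu>. \<kappa> \<in> hstrips \<nu>}"

text \<open>With \<open>\<mu>\<close> and \<open>\<kappa>\<close> fixed, the interlacing conditions
  bound each part of \<open>\<nu>\<close> independently of the others. These are the ends of the
  resulting intervals; the case distinctions account for the last row, which has no row below, and
  the first one, which has none above.\<close>

definition lower_end :: "nat list \<Rightarrow> nat list \<Rightarrow> nat \<Rightarrow> nat" where
  "lower_end \<mu> \<kappa> i = (if Suc i < length \<mu> then max (\<kappa> ! i) (\<mu> ! Suc i) else \<kappa> ! i)"

definition upper_end :: "nat list \<Rightarrow> nat list \<Rightarrow> nat \<Rightarrow> nat" where
  "upper_end \<mu> \<kappa> i = (case i of 0 \<Rightarrow> \<mu> ! 0 | Suc j \<Rightarrow> min (\<mu> ! Suc j) (\<kappa> ! j))"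

lemma interlacing_iff:
  assumes "length \<kappa> = length \<mu>"
  shows "\<nu> \<in> interlacing \<mu> \<kappa> \<longleftrightarrow> length \<nu> = length \<mu> \<and>
    (\<forall>i<length \<mu>. lower_end \<mu> \<kappa> i \<le> \<nu> ! i \<and> \<nu> ! i \<le> upper_end \<mu> \<kappa> i)"
proof (intro iffI conjI allI impI)
  assume \<nu>: "\<nu> \<in> interlacing \<mu> \<kappa>"
  then show "length \<nu> = length \<mu>" by (simp add: interlacing_def hstrips_def)
  fix i assume i: "i < length \<mu>"
  show "lower_end \<mu> \<kappa> i \<le> \<nu> ! i"
    using \<nu> i by (simp add: interlacing_def hstrips_def lower_end_def)
  show "\<nu> ! i \<le> upper_end \<mu> \<kappa> i"
    using \<nu> i by (cases i) (simp_all add: interlacing_def hstrips_def upper_end_def)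
next
  assume \<nu>: "length \<nu> = length \<mu> \<and>
    (\<forall>i<length \<mu>. lower_end \<mu> \<kappa> i \<le> \<nu> ! i \<and> \<nu> ! i \<le> upper_end \<mu> \<kappa> i)"
  have "\<kappa> ! i \<le> \<nu> ! i" "\<nu> ! i \<le> \<mu> ! i" if "i < length \<mu>" for i
  proof -
    have "lower_end \<mu> \<kappa> i \<le> \<nu> ! i" "\<nu> ! i \<le> upper_end \<mu> \<kappa> i"
      using \<nu> that by auto
    then show "\<kappa> ! i \<le> \<nu> ! i" "\<nu> ! i \<le> \<mu> ! i"
      by (auto simp: lower_end_def upper_end_def split: if_splits nat.splits)
  qed
  moreover have "\<mu> ! Suc i \<le> \<nu> ! i" "\<nu> ! Suc i \<le> \<kappa> ! i" if "Suc i < length \<mu>" for i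
  proof -
    have "lower_end \<mu> \<kappa> i \<le> \<nu> ! i" "\<nu> ! Suc i \<le> upper_end \<mu> \<kappa> (Suc i)"
      using \<nu> that by auto
    then show "\<mu> ! Suc i \<le> \<nu> ! i" "\<nu> ! Suc i \<le> \<kappa> ! i"
      using that by (simp_all add: lower_end_def upper_end_def)
  qed
  ultimately show "\<nu> \<in> interlacing \<mu> \<kappa>"
    using \<nu> assms by (simp add: interlacing_def hstrips_def)
qed

text \<open>The lower end in row \<open>i\<close> and the upper end in row \<open>Suc i\<close> are
  the maximum and the minimum of the same two numbers \<open>\<kappa> ! i\<close> and
  \<open>\<mu> ! Suc i\<close>, so together they contribute both. The unpaired ends are the first
  part of \<open>\<mu>\<close> and the last part of \<open>\<kappa>\<close>.\<close>

lemma sum_interval_ends: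
  assumes "length \<kappa> = length \<mu>"
  shows "(\<Sum>i<length \<mu>. lower_end \<mu> \<kappa> i + upper_end \<mu> \<kappa> i) = sum_list \<mu> + sum_list \<kappa>"
proof (cases "length \<mu>")
  case (Suc L)
  have "(\<Sum>i<Suc L. lower_end \<mu> \<kappa> i) = (\<Sum>i<L. max (\<kappa> ! i) (\<mu> ! Suc i)) + \<kappa> ! L"
    by (simp add: lower_end_def Suc)
  moreover have "(\<Sum>i<Suc L. upper_end \<mu> \<kappa> i) = \<mu> ! 0 + (\<Sum>i<L. min (\<mu> ! Suc i) (\<kappa> ! i))"
    by (subst sum.lessThan_Suc_shift) (simp add: upper_end_def)
  moreover have "(\<Sum>i<L. max (\<kappa> ! i) (\<mu> ! Suc i)) + (\<Sum>i<L. min (\<mu> ! Suc i) (\<kappa> ! i))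
      = (\<Sum>i<L. \<kappa> ! i) + (\<Sum>i<L. \<mu> ! Suc i)"
    unfolding sum.distrib[symmetric] by (intro sum.cong refl) (simp add: max_def min_def)
  moreover have "sum_list \<kappa> = (\<Sum>i<L. \<kappa> ! i) + \<kappa> ! L"
    by (simp add: sum_list_sum_nth assms Suc atLeast0LessThan)
  moreover have "sum_list \<mu> = \<mu> ! 0 + (\<Sum>i<L. \<mu> ! Suc i)"
    unfolding sum_list_sum_nth Suc atLeast0LessThan by (rule sum.lessThan_Suc_shift)
  ultimately show ?thesis by (simp add: Suc sum.distrib)
qed (use assms in simp)

text \<open>
  The Bender--Knuth involution: the partitions interlacing with two given ones form a product of
  intervals, and reflecting every interval exchanges the two sizes.
\<close>

lemma card_interlacing_swap:
  assumes len: "length \<kappa> = length \<mu>"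
  shows "card {\<nu> \<in> interlacing \<mu> \<kappa>. sum_list \<mu> = sum_list \<nu> + b \<and> sum_list \<nu> = sum_list \<kappa> + a} =
    card {\<nu> \<in> interlacing \<mu> \<kappa>. sum_list \<mu> = sum_list \<nu> + a \<and> sum_list \<nu> = sum_list \<kappa> + b}"
proof -
  define \<rho> where "\<rho> \<nu> = map (\<lambda>i. lower_end \<mu> \<kappa> i + upper_end \<mu> \<kappa> i - \<nu> ! i) [0..<length \<mu>]"
    for \<nu> :: "nat list"
  have mem: "\<rho> \<nu> \<in> interlacing \<mu> \<kappa>" if "\<nu> \<in> interlacing \<mu> \<kappa>" for \<nu>
    using that unfolding interlacing_iff[OF len] \<rho>_def by (auto simp: le_diff_conv2 trans_le_add1)
  have inv: "\<rho> (\<rho> \<nu>) = \<nu>" if "\<nu> \<in> interlacing \<mu> \<kappa>" for \<nu>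
    using that unfolding interlacing_iff[OF len] \<rho>_def
    by (intro nth_equalityI) (auto simp: trans_le_add1)
  have size: "sum_list (\<rho> \<nu>) + sum_list \<nu> = sum_list \<mu> + sum_list \<kappa>" if "\<nu> \<in> interlacing \<mu> \<kappa>" for \<nu>
  proof -
    have "sum_list (\<rho> \<nu>) + sum_list \<nu> = (\<Sum>i<length \<mu>. (lower_end \<mu> \<kappa> i + upper_end \<mu> \<kappa> i - \<nu> ! i) + \<nu> ! i)"
      using that unfolding interlacing_iff[OF len] sum.distrib
      by (simp add: sum_list_sum_nth \<rho>_def atLeast0LessThan)
    also have "\<dots> = (\<Sum>i<length \<mu>. lower_end \<mu> \<kappa> i + upper_end \<mu> \<kappa> i)"
      using that unfolding interlacing_iff[OF len] by (intro sum.cong refl) (simp add: trans_le_add2)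
    finally show ?thesis by (simp add: sum_interval_ends[OF len])
  qed
  have "bij_betw \<rho> {\<nu> \<in> interlacing \<mu> \<kappa>. sum_list \<mu> = sum_list \<nu> + b \<and> sum_list \<nu> = sum_list \<kappa> + a}
    {\<nu> \<in> interlacing \<mu> \<kappa>. sum_list \<mu> = sum_list \<nu> + a \<and> sum_list \<nu> = sum_list \<kappa> + b}"
    by (rule bij_betw_byWitness[where f' = \<rho>]) (use mem inv size in \<open>force+\<close>)
  then show ?thesis by (rule bij_betw_same_card)
qed

text \<open>Grouping two successive removals by the innermost shape \<open>\<kappa>\<close> isolates
  the dependence on \<open>\<alpha> n\<close> and \<open>\<alpha> (Suc n)\<close> in a cardinality
  that is symmetric in the two numbers.\<close>

lemma kostka_two_steps:
  "kostka (Suc (Suc n)) \<mu> \<alpha> = (\<Sum>\<kappa>\<in>\<Union>(hstrips ` hstrips \<mu>).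
     card {\<nu> \<in> interlacing \<mu> \<kappa>. sum_list \<mu> = sum_list \<nu> + \<alpha> (Suc n) \<and> sum_list \<nu> = sum_list \<kappa> + \<alpha> n}
       * kostka n \<kappa> \<alpha>)"
proof -
  let ?X = "\<Union>(hstrips ` hstrips \<mu>)" and ?Y = "{\<nu> \<in> hstrips \<mu>. sum_list \<mu> = sum_list \<nu> + \<alpha> (Suc n)}"
  have "kostka (Suc (Suc n)) \<mu> \<alpha> =
     (\<Sum>\<nu>\<in>?Y. \<Sum>\<kappa>\<in>{\<kappa> \<in> ?X. \<kappa> \<in> hstrips \<nu> \<and> sum_list \<nu> = sum_list \<kappa> + \<alpha> n}. kostka n \<kappa> \<alpha>)"
    unfolding kostka.simps by (intro sum.cong refl) auto
  also have "\<dots> = (\<Sum>\<kappa>\<in>?X. \<Sum>\<nu>\<in>{\<nu> \<in> ?Y. \<kappa> \<in> hstrips \<nu> \<and> sum_list \<nu> = sum_list \<kappa> + \<alpha> n}. kostka n \<kappa> \<alpha>)"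
    by (rule sum.swap_restrict) (auto simp: finite_hstrips)
  also have "\<dots> = (\<Sum>\<kappa>\<in>?X. card {\<nu> \<in> interlacing \<mu> \<kappa>. sum_list \<mu> = sum_list \<nu> + \<alpha> (Suc n) \<and>
      sum_list \<nu> = sum_list \<kappa> + \<alpha> n} * kostka n \<kappa> \<alpha>)"
    unfolding sum_constant of_nat_id interlacing_def
    by (intro sum.cong refl arg_cong2[where f = "(*)"] arg_cong[where f = card]) auto
  finally show ?thesis .
qed

lemma kostka_swap:
  assumes "Suc i < n"
  shows "kostka n \<mu> (\<alpha> \<circ> transpose i (Suc i)) = kostka n \<mu> \<alpha>"
  using assms
proof (induction n arbitrary: \<mu>)
  case (Suc n)
  show ?case
  proof (cases "Suc i < n")
    case True
    then show ?thesis by (simp add: Suc.IH[unfolded comp_def] comp_def)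
  next
    case False
    \<comment> \<open>Now \<open>i\<close> and \<open>Suc i\<close> are the two largest values, and
      the transposition fixes all values below them.\<close>
    then have n: "n = Suc i" using Suc.prems by simp
    have "kostka i \<kappa> (\<alpha> \<circ> transpose i (Suc i)) = kostka i \<kappa> \<alpha>" for \<kappa>
      by (rule kostka_cong) simp
    then show ?thesis
      unfolding n kostka_two_steps
      by (intro sum.cong refl arg_cong2[where f = "(*)"])
        (simp_all add: card_interlacing_swap hstrips_def)
  qed
qed simp

lemma count_image_transpose: "count (image_mset (transpose i j) m) x = count m (transpose i j x)"
proof -
  have "{y. y \<in># m \<and> x = transpose i j y} = (if transpose i j x \<in># m then {transpose i j x} else {})"
    by auto
  then show ?thesis by (auto simp: count_image_mset' not_in_iff)
qed

lemma schur_swap: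
  assumes "sorted_wrt (\<ge>) \<mu>"
  shows "schur \<mu> (image_mset (transpose i (Suc i)) m) = schur \<mu> m"
proof -
  let ?t = "transpose i (Suc i)"
  \<comment> \<open>Large enough to exceed every index in \<open>m\<close> as well as the two
    exchanged indices.\<close>
  define n where "n = Suc (Suc (i + Max (insert 0 (set_mset m))))"
  have m: "x < n" if "x \<in># m" for x
    using that Max_ge[of "insert 0 (set_mset m)" x] unfolding n_def by (auto simp del: Max_ge)
  have "set_mset (image_mset ?t m) \<subseteq> {..<n}"
    using m by (auto simp: transpose_def n_def)
  then have "card {T \<in> ssyt \<mu>. mset (concat T) = image_mset ?t m} = kostka n \<mu> (count (image_mset ?t m))"
    using assms card_ssyt_kostka by blast
  also have "count (image_mset ?t m) = count m \<circ> ?t"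
    by (simp add: fun_eq_iff count_image_transpose)
  also have "kostka n \<mu> (count m \<circ> ?t) = kostka n \<mu> (count m)"
    by (rule kostka_swap) (simp add: n_def)
  also have "\<dots> = card {T \<in> ssyt \<mu>. mset (concat T) = m}"
    using m assms by (intro card_ssyt_kostka[symmetric]) auto
  finally show ?thesis by (simp add: schur_def)
qed

section \<open>Triangularity and the Schur expansion\<close>

text \<open>Substitution in order of increasing rank: the element inserted last has maximal rank, so
  its unknown is absent from all earlier equations and is determined by its own equation, where its
  coefficient is 1.\<close>

lemma triangular_system_solvable:
  fixes K :: "'a \<Rightarrow> 'a \<Rightarrow> 'b::comm_ring_1" and rk :: "'a \<Rightarrow> nat"
  assumes "finite A" "\<And>x. x \<in> A \<Longrightarrow> K x x = 1"
    and "\<And>x y. x \<in> A \<Longrightarrow> y \<in> A \<Longrightarrow> K y x \<noteq> 0 \<Longrightarrow> y = x \<or> rk y < rk x"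
  shows "\<exists>c. \<forall>x\<in>A. (\<Sum>y\<in>A. c y * K y x) = f x"
  using assms
proof (induction A rule: finite_ranking_induct[where f = rk])
  case (insert x A)
  show ?case
  proof (cases "x \<in> A")
    case True
    then show ?thesis using insert by (simp add: insert_absorb)
  next
    case False
    obtain c where c: "\<And>z. z \<in> A \<Longrightarrow> (\<Sum>y\<in>A. c y * K y z) = f z"
      using insert by (metis insertCI)
    define c' where "c' = c(x := f x - (\<Sum>y\<in>A. c y * K y x))"
    have c': "(\<Sum>y\<in>A. c' y * K y z) = (\<Sum>y\<in>A. c y * K y z)" for z
      using False by (intro sum.cong) (auto simp: c'_def)
    have 0: "K x z = 0" if "z \<in> A" for z
      using insert.prems(2)[of z x] insert.hyps(2)[OF that] that False by fastforce
    have "(\<Sum>y\<in>insert x A. c' y * K y z) = f z" if "z \<in> insert x A" for z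
      using that False c 0 insert.hyps(1) insert.prems(1)
      by (auto simp: c') (simp add: c'_def)
    then show ?thesis by blast
  qed
qed simp

text \<open>In the equation belonging to \<open>x\<close>, the unknown \<open>c x\<close> has
  coefficient 1 and all other unknowns that occur have smaller rank, so strong induction on the rank
  applies.\<close>

lemma triangular_system_integral:
  fixes K :: "'a \<Rightarrow> 'a \<Rightarrow> 'b::comm_ring_1" and rk :: "'a \<Rightarrow> nat"
  assumes "finite A" "\<And>x. x \<in> A \<Longrightarrow> K x x = 1"
    and "\<And>x y. x \<in> A \<Longrightarrow> y \<in> A \<Longrightarrow> K y x \<noteq> 0 \<Longrightarrow> y = x \<or> rk y < rk x"
    and "\<And>x y. x \<in> A \<Longrightarrow> y \<in> A \<Longrightarrow> K y x \<in> \<int>"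
    and "\<And>x. x \<in> A \<Longrightarrow> (\<Sum>y\<in>A. c y * K y x) \<in> \<int>"
    and "x \<in> A"
  shows "c x \<in> \<int>"
  using assms(6)
proof (induction "rk x" arbitrary: x rule: less_induct)
  case less
  have "c y * K y x \<in> \<int>" if "y \<in> A - {x}" for y
    using that less assms(3,4)[of x y] by (cases "K y x = 0") auto
  then have "(\<Sum>y\<in>A - {x}. c y * K y x) \<in> \<int>" by (rule Ints_sum)
  moreover have "(\<Sum>y\<in>A. c y * K y x) = c x + (\<Sum>y\<in>A - {x}. c y * K y x)"
    using less.prems assms(1,2) by (simp add: sum.remove)
  ultimately show ?case
    using assms(5)[OF less.prems] Ints_diff[of "\<Sum>y\<in>A. c y * K y x" "\<Sum>y\<in>A - {x}. c y * K y x"] by simp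
qed

section \<open>Partition monomials and tableaux of least weight\<close>

lemma partitionsD:
  assumes "\<mu> \<in> partitions r"
  shows "sorted_wrt (\<ge>) \<mu>" "sum_list \<mu> = r" "\<And>k. k \<in> set \<mu> \<Longrightarrow> 0 < k"
  using assms by (auto simp: partitions_def)

lemma finite_partitions: "finite (partitions r)"
proof (rule finite_subset)
  show "partitions r \<subseteq> {xs. set xs \<subseteq> {..r} \<and> length xs \<le> r}"
  proof
    fix \<mu> assume "\<mu> \<in> partitions r"
    note p = partitionsD[OF this]
    have "length \<mu> \<le> sum_list \<mu>"
      using p(3) by (induction \<mu>) force+
    then show "\<mu> \<in> {xs. set xs \<subseteq> {..r} \<and> length xs \<le> r}"
      using p(2) member_le_sum_list by auto
  qed
  show "finite {xs. set xs \<subseteq> {..r} \<and> length xs \<le> r}" by (rule finite_lists_length_le) simp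
qed

text \<open>The monomial with exponent vector \<open>\<mu>\<close>. For \<open>\<mu>\<close> in
  \<open>partitions r\<close> these represent the orbits of degree \<open>r\<close> monomials under
  permutations of the variables.\<close>

definition partition_mset :: "nat list \<Rightarrow> nat multiset" where
  "partition_mset \<mu> = (\<Sum>i<length \<mu>. replicate_mset (\<mu> ! i) i)"

definition superstandard :: "nat list \<Rightarrow> nat list list" where
  "superstandard \<mu> = map (\<lambda>i. replicate (\<mu> ! i) i) [0..<length \<mu>]"

text \<open>The statistic usually written n(\<mu>), with rows counted from 0. It replaces the
  dominance order, since the triangular systems ask for a rank in the natural numbers.\<close>

definition row_weight :: "nat list \<Rightarrow> nat" where
  "row_weight \<mu> = (\<Sum>i<length \<mu>. i * \<mu> ! i)"

lemma mset_concat_eq_sum: "mset (concat T) = (\<Sum>i<length T. mset (T ! i))"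
proof -
  have "mset (concat T) = sum_list (map mset T)" by (simp add: mset_concat)
  also have "\<dots> = (\<Sum>i<length T. mset (T ! i))" by (simp add: sum_list_sum_nth atLeast0LessThan)
  finally show ?thesis .
qed

lemma mset_superstandard: "mset (concat (superstandard \<mu>)) = partition_mset \<mu>"
  by (simp add: mset_concat_eq_sum superstandard_def partition_mset_def)

lemma superstandard_ssyt:
  assumes "sorted_wrt (\<ge>) \<mu>"
  shows "superstandard \<mu> \<in> ssyt \<mu>"
proof -
  have "\<mu> ! Suc i \<le> \<mu> ! i" if "Suc i < length \<mu>" for i
    using assms that by (simp add: sorted_wrt_iff_nth_less)
  then show ?thesis by (fastforce simp: ssyt_iff superstandard_def)
qed

lemma sum_mset_concat: "sum_mset (mset (concat T)) = (\<Sum>i<length T. \<Sum>j<length (T ! i). T ! i ! j)"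
proof -
  have "sum_mset (mset (concat T)) = (\<Sum>xs\<leftarrow>T. sum_list xs)"
    unfolding sum_mset_sum_list by (induction T) simp_all
  then show ?thesis by (simp add: sum_list_sum_nth atLeast0LessThan)
qed

lemma count_partition_mset: "count (partition_mset \<mu>) i = (if i < length \<mu> then \<mu> ! i else 0)"
  by (simp add: partition_mset_def count_sum)

lemma sum_partition_mset: "sum_mset (partition_mset \<mu>) = row_weight \<mu>"
proof -
  have "sum_mset (\<Sum>i<n. replicate_mset (\<mu> ! i) i) = (\<Sum>i<n. i * \<mu> ! i)" for n
    by (induction n) (simp_all add: sum_mset_replicate_mset mult.commute)
  then show ?thesis by (simp add: partition_mset_def row_weight_def)
qed

lemma ssyt_entry_ge_row:
  assumes "T \<in> ssyt \<mu>" "sorted_wrt (\<ge>) \<mu>" "i < length \<mu>" "j < \<mu> ! i"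
  shows "i \<le> T ! i ! j"
  using assms(3,4)
proof (induction i)
  case (Suc i)
  have "\<mu> ! Suc i \<le> \<mu> ! i" using assms(2) Suc.prems by (simp add: sorted_wrt_iff_nth_less)
  then have "i \<le> T ! i ! j" using Suc by simp
  moreover have "T ! i ! j < T ! Suc i ! j" using assms(1) Suc.prems by (simp add: ssyt_iff)
  ultimately show ?case by simp
qed simp

text \<open>Columns increase strictly from a value at least 0, so an entry is at least its row
  index. Summing over the cells gives the bound, and equality of the sums forces equality in every
  cell.\<close>

lemma ssyt_weight:
  assumes "T \<in> ssyt \<mu>" "sorted_wrt (\<ge>) \<mu>"
  shows "row_weight \<mu> \<le> sum_mset (mset (concat T))"
    and "row_weight \<mu> = sum_mset (mset (concat T)) \<Longrightarrow> T = superstandard \<mu>"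
proof -
  have len: "length T = length \<mu>" "\<And>i. i < length \<mu> \<Longrightarrow> length (T ! i) = \<mu> ! i"
    using assms by (auto simp: ssyt_iff)
  have w: "row_weight \<mu> = (\<Sum>i<length \<mu>. \<Sum>j<\<mu> ! i. i)"
    by (simp add: row_weight_def mult.commute)
  have s: "sum_mset (mset (concat T)) = (\<Sum>i<length \<mu>. \<Sum>j<\<mu> ! i. T ! i ! j)"
    by (simp add: sum_mset_concat len)
  show "row_weight \<mu> \<le> sum_mset (mset (concat T))"
    unfolding w s using ssyt_entry_ge_row[OF assms] by (intro sum_mono) auto
  assume eq: "row_weight \<mu> = sum_mset (mset (concat T))"
  have T: "T ! i ! j = i" if "i < length \<mu>" "j < \<mu> ! i" for i j
  proof (rule ccontr)
    assume "T ! i ! j \<noteq> i"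
    then have "i < T ! i ! j" using ssyt_entry_ge_row[OF assms that] by simp
    then have "(\<Sum>j<\<mu> ! i. i) < (\<Sum>j<\<mu> ! i. T ! i ! j)"
      using that ssyt_entry_ge_row[OF assms that(1)] by (intro sum_strict_mono_ex1) auto
    then have "row_weight \<mu> < sum_mset (mset (concat T))"
      unfolding w s using that ssyt_entry_ge_row[OF assms]
      by (intro sum_strict_mono_ex1) (auto simp del: sum_constant intro!: sum_mono)
    then show False using eq by simp
  qed
  show "T = superstandard \<mu>"
    by (intro nth_equalityI) (simp_all add: superstandard_def len T)
qed

lemma partition_mset_inj:
  assumes "\<mu> \<in> partitions r" "\<nu> \<in> partitions s" "partition_mset \<mu> = partition_mset \<nu>"
  shows "\<mu> = \<nu>"
proof -
  have set: "set_mset (partition_mset \<mu>) = {..<length \<mu>}" if "\<mu> \<in> partitions r" for \<mu> r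
    using partitionsD(3)[OF that] nth_mem[of _ \<mu>]
    by (force simp: set_mset_def count_partition_mset simp del: nth_mem)
  have "length \<mu> = length \<nu>" using set[OF assms(1)] set[OF assms(2)] assms(3) by (metis card_lessThan)
  then show ?thesis
    using count_partition_mset[of \<mu>] count_partition_mset[of \<nu>] assms(3)
    by (intro nth_equalityI) metis+
qed

lemma schur_partition_mset_self:
  assumes "\<mu> \<in> partitions r"
  shows "schur \<mu> (partition_mset \<mu>) = 1"
proof -
  note s = partitionsD(1)[OF assms]
  have "{T \<in> ssyt \<mu>. mset (concat T) = partition_mset \<mu>} = {superstandard \<mu>}"
  proof (intro equalityI subsetI)
    fix T assume "T \<in> {T \<in> ssyt \<mu>. mset (concat T) = partition_mset \<mu>}"
    then show "T \<in> {superstandard \<mu>}"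
      using ssyt_weight(2)[OF _ s, of T] by (simp add: sum_partition_mset)
  qed (use superstandard_ssyt[OF s] in \<open>simp add: mset_superstandard\<close>)
  then show ?thesis by (simp add: schur_def)
qed

text \<open>A tableau of shape \<open>\<mu>\<close> and content \<open>\<nu>\<close> has entry sum
  \<open>row_weight \<nu>\<close>, which \<open>ssyt_weight\<close> compares with
  \<open>row_weight \<mu>\<close>. If the two weights agree, the tableau is superstandard, so its
  content is also that of \<open>\<mu>\<close>.\<close>

lemma schur_partition_mset_triangular:
  assumes "\<mu> \<in> partitions r" "\<nu> \<in> partitions s" "schur \<mu> (partition_mset \<nu>) \<noteq> 0"
  shows "\<mu> = \<nu> \<or> row_weight \<mu> < row_weight \<nu>"
proof -
  have "{T \<in> ssyt \<mu>. mset (concat T) = partition_mset \<nu>} \<noteq> {}"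
    using assms(3) unfolding schur_def by (metis card.empty of_nat_0)
  then obtain T where T: "T \<in> ssyt \<mu>" "mset (concat T) = partition_mset \<nu>" by auto
  note w = ssyt_weight[OF T(1) partitionsD(1)[OF assms(1)], unfolded T(2) sum_partition_mset]
  show ?thesis
  proof (cases "row_weight \<mu> = row_weight \<nu>")
    case True
    then have "partition_mset \<mu> = partition_mset \<nu>"
      using w(2) mset_superstandard T(2) by metis
    then show ?thesis using partition_mset_inj[OF assms(1,2)] by simp
  qed (use w(1) in simp)
qed

section \<open>Symmetric series and their expansion in Schur functions\<close>

definition symmetric_series :: "nat \<Rightarrow> series \<Rightarrow> bool" where
  "symmetric_series r f \<longleftrightarrow> (\<forall>m i. f (image_mset (transpose i (Suc i)) m) = f m) \<and>
     (\<forall>m. f m \<noteq> 0 \<longrightarrow> size m = r)"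

text \<open>Symmetry is imposed for adjacent transpositions only. This is the termination measure
  for sorting the exponents of a monomial by such swaps.\<close>

lemma sum_image_mset_swap_less:
  assumes "count m i < count m (Suc i)"
  shows "sum_mset (image_mset (transpose i (Suc i)) m) < sum_mset m"
proof -
  define m' where "m' = filter_mset (\<lambda>x. x \<noteq> i \<and> x \<noteq> Suc i) m"
  have m: "m = m' + replicate_mset (count m i) i + replicate_mset (count m (Suc i)) (Suc i)"
    by (rule multiset_eqI) (simp add: m'_def)
  have "image_mset (transpose i (Suc i)) m' = m'"
    by (rule multiset.map_ident_strong) (auto simp: m'_def)
  then have "image_mset (transpose i (Suc i)) m =
      m' + replicate_mset (count m i) (Suc i) + replicate_mset (count m (Suc i)) i"
    by (subst m) simp
  moreover have "sum_mset m = sum_mset m' + count m i * i + count m (Suc i) * Suc i"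
    by (subst m) (simp add: sum_mset_replicate_mset)
  ultimately show ?thesis using assms by (simp add: sum_mset_replicate_mset)
qed

lemma partition_mset_surj:
  assumes "\<And>i. count m (Suc i) \<le> count m i"
  obtains \<mu> where "\<mu> \<in> partitions (size m)" "m = partition_mset \<mu>"
proof -
  have "\<exists>n. count m n = 0"
    using infinite_UNIV_nat finite_set_mset[of m] by (metis UNIV_eq_I not_in_iff)
  \<comment> \<open>The future number of parts: the counts decrease weakly, so they vanish from the
    first zero on.\<close>
  define n where "n = (LEAST n. count m n = 0)"
  have n: "count m n = 0" unfolding n_def by (rule LeastI_ex) fact
  have pos: "count m i > 0" if "i < n" for i
    using not_less_Least[of i "\<lambda>n. count m n = 0"] that unfolding n_def by simp
  have anti: "count m j \<le> count m i" if "i \<le> j" for i j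
    using that assms by (rule lift_Suc_antimono_le[rotated])
  define \<mu> where "\<mu> = map (count m) [0..<n]"
  have m: "m = partition_mset \<mu>"
    by (rule multiset_eqI) (use anti[of n] n in \<open>auto simp: count_partition_mset \<mu>_def not_less\<close>)
  have "size (\<Sum>i<k. replicate_mset (\<mu> ! i) i) = (\<Sum>i<k. \<mu> ! i)" for k
    by (induction k) simp_all
  then have "sum_list \<mu> = size m"
    by (subst m) (simp add: partition_mset_def sum_list_sum_nth atLeast0LessThan)
  then have "\<mu> \<in> partitions (size m)"
    using pos anti by (auto simp: partitions_def \<mu>_def sorted_wrt_iff_nth_less)
  then show ?thesis using m that by blast
qed

text \<open>Swapping two adjacent variables whose exponents are in the wrong order lowers the sum of
  the indices, so every monomial is eventually reduced to a partition monomial.\<close>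

lemma symmetric_series_eqI:
  assumes "symmetric_series r f" "symmetric_series r g"
    and "\<And>\<mu>. \<mu> \<in> partitions r \<Longrightarrow> f (partition_mset \<mu>) = g (partition_mset \<mu>)"
  shows "f m = g m"
proof (induction "sum_mset m" arbitrary: m rule: less_induct)
  case less
  show ?case
  proof (cases "\<exists>i. count m i < count m (Suc i)")
    case True
    then obtain i where "count m i < count m (Suc i)" by blast
    from less[OF sum_image_mset_swap_less[OF this]] show ?thesis
      using assms(1,2) by (simp add: symmetric_series_def)
  next
    case False
    then obtain \<mu> where \<mu>: "\<mu> \<in> partitions (size m)" "m = partition_mset \<mu>"
      using partition_mset_surj[of m] by (metis not_less)
    show ?thesis
    proof (cases "size m = r")
      case True
      then show ?thesis using \<mu> assms(3)[of \<mu>] by simp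
    next
      case False
      then show ?thesis using assms(1,2) unfolding symmetric_series_def by metis
    qed
  qed
qed

lemma symmetric_series_sum:
  assumes "\<And>x. x \<in> A \<Longrightarrow> symmetric_series r (f x)"
  shows "symmetric_series r (\<lambda>m. \<Sum>x\<in>A. c x * f x m)"
  unfolding symmetric_series_def
proof (intro conjI allI impI)
  show "(\<Sum>x\<in>A. c x * f x (image_mset (transpose i (Suc i)) m)) = (\<Sum>x\<in>A. c x * f x m)" for m i
    using assms by (intro sum.cong) (auto simp: symmetric_series_def)
  show "size m = r" if nz: "(\<Sum>x\<in>A. c x * f x m) \<noteq> 0" for m
  proof -
    obtain x where "x \<in> A" "c x * f x m \<noteq> 0"
      using sum.not_neutral_contains_not_neutral[OF nz] by blast
    then show ?thesis using assms by (auto simp: symmetric_series_def)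
  qed
qed

lemma symmetric_schur:
  assumes "\<mu> \<in> partitions r"
  shows "symmetric_series r (schur \<mu>)"
proof -
  have "size m = r" if "schur \<mu> m \<noteq> 0" for m
  proof -
    have "{T \<in> ssyt \<mu>. mset (concat T) = m} \<noteq> {}"
      using that unfolding schur_def by (metis card.empty of_nat_0)
    then obtain T where "map length T = \<mu>" "mset (concat T) = m" by (auto simp: ssyt_def)
    then show ?thesis using size_mset_concat partitionsD(2)[OF assms] by blast
  qed
  then show ?thesis
    using schur_swap[OF partitionsD(1)[OF assms]] by (simp add: symmetric_series_def)
qed

text \<open>The unitriangular system is solved on partition monomials only; symmetry of both sides
  carries the equation to all monomials. The solution is a witness for the choice made in
  \<open>schur_coeff\<close>.\<close>

lemma schur_coeff_expansion:
  assumes "symmetric_series r f"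
  shows "f m = (\<Sum>\<mu>\<in>partitions r. schur_coeff r f \<mu> * schur \<mu> m)"
proof -
  obtain c where c: "\<And>\<nu>. \<nu> \<in> partitions r \<Longrightarrow>
      (\<Sum>\<mu>\<in>partitions r. c \<mu> * schur \<mu> (partition_mset \<nu>)) = f (partition_mset \<nu>)"
    using triangular_system_solvable[of "partitions r" "\<lambda>\<mu> \<nu>. schur \<mu> (partition_mset \<nu>)" row_weight
        "\<lambda>\<nu>. f (partition_mset \<nu>)"]
      finite_partitions schur_partition_mset_self schur_partition_mset_triangular by blast
  have "\<forall>m. f m = (\<Sum>\<mu>\<in>partitions r. c \<mu> * schur \<mu> m)"
    using symmetric_series_eqI[OF assms symmetric_series_sum[of "partitions r" r schur c]]
      symmetric_schur c by metis
  then have "\<exists>c. \<forall>m. f m = (\<Sum>\<mu>\<in>partitions r. c \<mu> * schur \<mu> m)" by blast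
  from someI_ex[OF this] show ?thesis unfolding schur_coeff_def by blast
qed

lemma schur_coeff_integral:
  assumes "symmetric_series r f" "\<And>m. f m \<in> \<int>" "\<mu> \<in> partitions r"
  shows "schur_coeff r f \<mu> \<in> \<int>"
proof (rule triangular_system_integral[of "partitions r" "\<lambda>\<mu> \<nu>. schur \<mu> (partition_mset \<nu>)" row_weight])
  show "(\<Sum>\<mu>\<in>partitions r. schur_coeff r f \<mu> * schur \<mu> (partition_mset \<nu>)) \<in> \<int>" for \<nu>
    using assms(2)[of "partition_mset \<nu>"] schur_coeff_expansion[OF assms(1)] by simp
qed (use finite_partitions schur_partition_mset_self schur_partition_mset_triangular assms(3)
  in \<open>auto simp: schur_def\<close>)

section \<open>Principal specialisation\<close>

text \<open>The monomials of degree \<open>r\<close> that become \<open>q^N\<close> when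
  \<open>x_i\<close> is replaced by \<open>q^i\<close>; equivalently, the partitions of
  \<open>N\<close> into at most \<open>r\<close> parts, padded with zeros.\<close>

definition weighted_msets :: "nat \<Rightarrow> nat \<Rightarrow> nat multiset set" where
  "weighted_msets r N = {m. size m = r \<and> sum_mset m = N}"

lemma finite_weighted_msets: "finite (weighted_msets r N)"
proof (rule finite_subset)
  show "weighted_msets r N \<subseteq> mset ` {xs. set xs \<subseteq> {..N} \<and> length xs = r}"
  proof
    fix m assume m: "m \<in> weighted_msets r N"
    obtain xs where xs: "m = mset xs" using ex_mset by metis
    show "m \<in> mset ` {xs. set xs \<subseteq> {..N} \<and> length xs = r}"
      using m unfolding xs weighted_msets_def
      by (auto simp: sum_mset_sum_list intro: member_le_sum_list)
  qed
  show "finite (mset ` {xs. set xs \<subseteq> {..N} \<and> length xs = r})"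
    by (simp add: finite_lists_length_eq)
qed

lemma card_weighted_msets_Suc:
  "card (weighted_msets (Suc r) N) = card (weighted_msets r N) +
     (if Suc r \<le> N then card (weighted_msets (Suc r) (N - Suc r)) else 0)"
proof -
  let ?A = "{m \<in> weighted_msets (Suc r) N. 0 \<in># m}" and ?B = "{m \<in> weighted_msets (Suc r) N. 0 \<notin># m}"
  have "bij_betw (add_mset 0) (weighted_msets r N) ?A"
    by (rule bij_betw_byWitness[where f' = "\<lambda>m. m - {#0#}"])
      (auto simp: weighted_msets_def size_Diff_singleton dest!: multi_member_split)
  then have A: "card ?A = card (weighted_msets r N)" by (simp add: bij_betw_same_card)
  have sum: "sum_mset (image_mset Suc m) = sum_mset m + size m" for m
    by (induction m) simp_all
  have Suc_pred: "image_mset Suc (image_mset (\<lambda>x. x - 1) m) = m" if "0 \<notin># m" for m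
  proof -
    have "image_mset Suc (image_mset (\<lambda>x. x - 1) m) = image_mset (\<lambda>x. Suc (x - 1)) m"
      by (simp add: image_mset.compositionality comp_def)
    also have "\<dots> = m" using that
      by (intro multiset.map_ident_strong) (metis Suc_pred' bot_nat_0.not_eq_extremum diff_Suc_1')
    finally show ?thesis .
  qed
  have B: "card ?B = (if Suc r \<le> N then card (weighted_msets (Suc r) (N - Suc r)) else 0)"
  proof (cases "Suc r \<le> N")
    case True
    have "bij_betw (image_mset Suc) (weighted_msets (Suc r) (N - Suc r)) ?B"
    proof (rule bij_betw_byWitness[where f' = "image_mset (\<lambda>x. x - 1)"])
      show "image_mset Suc ` weighted_msets (Suc r) (N - Suc r) \<subseteq> ?B"
        using True by (auto simp: weighted_msets_def sum)
      show "image_mset (\<lambda>x. x - 1) ` ?B \<subseteq> weighted_msets (Suc r) (N - Suc r)"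
      proof
        fix y assume "y \<in> image_mset (\<lambda>x. x - 1) ` ?B"
        then obtain m where m: "m \<in> ?B" "y = image_mset (\<lambda>x. x - 1) m" by blast
        then have "sum_mset m = sum_mset y + size y"
          using sum[of y] Suc_pred[of m] by simp
        then show "y \<in> weighted_msets (Suc r) (N - Suc r)"
          using m by (auto simp: weighted_msets_def)
      qed
    qed (use Suc_pred in \<open>auto simp: image_mset.compositionality comp_def\<close>)
    then show ?thesis using True by (simp add: bij_betw_same_card)
  next
    case False
    have "sum_mset m \<ge> size m" if "0 \<notin># m" for m :: "nat multiset"
      using that by (induction m) (auto simp: Suc_le_eq)
    then have B: "?B = {}" using False by (fastforce simp: weighted_msets_def)
    show ?thesis unfolding B using False by simp
  qed
  have "card (weighted_msets (Suc r) N) = card (?A \<union> ?B)" by (rule arg_cong[where f = card]) auto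
  also have "\<dots> = card ?A + card ?B"
    by (rule card_Un_disjoint) (auto simp: finite_weighted_msets)
  finally show ?thesis by (simp add: A B)
qed

definition weighted_fps :: "nat \<Rightarrow> complex fps" where
  "weighted_fps r = Abs_fps (\<lambda>N. of_nat (card (weighted_msets r N)))"

text \<open>The recurrence for the cardinalities says that multiplication by
  \<open>1 - fps_X ^ Suc r\<close> turns the series for \<open>Suc r\<close> into the one for
  \<open>r\<close>.\<close>

lemma weighted_fps_times_prod: "weighted_fps r * (\<Prod>i=1..r. 1 - fps_X ^ i) = 1"
proof (induction r)
  case 0
  have "weighted_msets 0 N = (if N = 0 then {{#}} else {})" for N
    by (auto simp: weighted_msets_def)
  then show ?case by (simp add: weighted_fps_def fps_eq_iff)
next
  case (Suc r)
  have "weighted_fps (Suc r) * (1 - fps_X ^ Suc r) = weighted_fps r"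
    unfolding right_diff_distrib
    by (rule fps_ext) (simp add: weighted_fps_def fps_X_power_mult_right_nth card_weighted_msets_Suc[of r] del: power_Suc)
  moreover have "(\<Prod>i=1..Suc r. 1 - fps_X ^ i :: complex fps) = (1 - fps_X ^ Suc r) * (\<Prod>i=1..r. 1 - fps_X ^ i)"
    by (subst prod.cl_ivl_Suc) (simp_all add: mult.commute del: power_Suc)
  ultimately show ?case using Suc.IH by (metis mult.assoc)
qed

section \<open>The stable principal specialisation of power sums\<close>

lemma finite_submsets: "finite {a. a \<subseteq># (m :: 'a multiset)}"
proof (rule finite_subset)
  show "{a. a \<subseteq># m} \<subseteq> mset ` {xs. set xs \<subseteq> set_mset m \<and> length xs \<le> size m}"
  proof
    fix a assume a: "a \<in> {a. a \<subseteq># m}"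
    obtain xs where "a = mset xs" using ex_mset by metis
    then show "a \<in> mset ` {xs. set xs \<subseteq> set_mset m \<and> length xs \<le> size m}"
      using a set_mset_mono[of a m] size_mset_mono[of a m] by auto
  qed
  show "finite (mset ` {xs. set xs \<subseteq> set_mset m \<and> length xs \<le> size m})"
    by (simp add: finite_lists_length_le)
qed

text \<open>The substitution of \<open>q^i\<close> for \<open>x_i\<close>. The degree is fixed in
  advance because \<open>x_0\<close> becomes 1: infinitely many monomials have the same weight, but
  only finitely many of them have degree \<open>r\<close>.\<close>

definition stable_spec :: "nat \<Rightarrow> series \<Rightarrow> complex fps" where
  "stable_spec r f = Abs_fps (\<lambda>N. \<Sum>m\<in>weighted_msets r N. of_rat (f m))"

lemma stable_spec_sum:
  "stable_spec r (\<lambda>m. \<Sum>x\<in>A. c x * f x m) = (\<Sum>x\<in>A. fps_const (of_rat (c x)) * stable_spec r (f x))"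
proof (rule fps_ext)
  fix N
  have "fps_nth (stable_spec r (\<lambda>m. \<Sum>x\<in>A. c x * f x m)) N
      = (\<Sum>m\<in>weighted_msets r N. \<Sum>x\<in>A. of_rat (c x) * of_rat (f x m))"
    by (simp add: stable_spec_def of_rat_sum of_rat_mult)
  also have "\<dots> = (\<Sum>x\<in>A. \<Sum>m\<in>weighted_msets r N. of_rat (c x) * of_rat (f x m))"
    by (rule sum.swap)
  finally show "fps_nth (stable_spec r (\<lambda>m. \<Sum>x\<in>A. c x * f x m)) N
      = fps_nth (\<Sum>x\<in>A. fps_const (of_rat (c x)) * stable_spec r (f x)) N"
    by (simp add: stable_spec_def fps_sum_nth sum_distrib_left)
qed

text \<open>Since \<open>f\<close> is homogeneous, only divisors \<open>a\<close> of degree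
  \<open>r\<close> contribute, and their cofactors have degree \<open>s\<close>. A monomial with
  such a divisor is the same as a pair of factors, and weights add.\<close>

lemma stable_spec_mult:
  assumes f: "\<And>m. f m \<noteq> 0 \<Longrightarrow> size m = r"
  shows "stable_spec (r + s) (series_mult f g) = stable_spec r f * stable_spec s g"
proof (rule fps_ext)
  fix N
  define sub where "sub = (\<lambda>m :: nat multiset. {a. a \<subseteq># m \<and> size a = r})"
  have fin: "finite (sub m)" for m
    by (rule finite_subset[OF _ finite_submsets[of m]]) (auto simp: sub_def)
  have sum_le: "sum_mset a \<le> sum_mset b" if "a \<subseteq># b" for a b :: "nat multiset"
    using that by (metis le_add1 subset_mset.add_diff_inverse sum_mset.union)
  have mult: "series_mult f g m = (\<Sum>a\<in>sub m. f a * g (m - a))" for m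
    unfolding series_mult_def
    by (rule sum.mono_neutral_right) (use f finite_submsets in \<open>auto simp: sub_def\<close>)
  have "fps_nth (stable_spec (r + s) (series_mult f g)) N =
      (\<Sum>m\<in>weighted_msets (r + s) N. \<Sum>a\<in>sub m. of_rat (f a) * of_rat (g (m - a)))"
    by (simp add: stable_spec_def mult of_rat_sum of_rat_mult)
  also have "\<dots> = (\<Sum>(m, a)\<in>Sigma (weighted_msets (r + s) N) sub. of_rat (f a) * of_rat (g (m - a)))"
    by (rule sum.Sigma) (auto simp: finite_weighted_msets fin)
  also have "\<dots> = (\<Sum>(k, a, b)\<in>(SIGMA k:{0..N}. weighted_msets r k \<times> weighted_msets s (N - k)).
      of_rat (f a) * of_rat (g b))"
    by (rule sum.reindex_bij_witness[where i = "\<lambda>(k, a, b). (a + b, a)"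
          and j = "\<lambda>(m, a). (sum_mset a, a, m - a)"])
      (auto simp: weighted_msets_def sub_def size_Diff_submset sum_mset_diff sum_le)
  also have "\<dots> = (\<Sum>k=0..N. \<Sum>(a, b)\<in>weighted_msets r k \<times> weighted_msets s (N - k).
      of_rat (f a) * of_rat (g b))"
    by (rule sum.Sigma[symmetric]) (auto simp: finite_weighted_msets)
  also have "\<dots> = fps_nth (stable_spec r f * stable_spec s g) N"
    by (simp add: fps_mult_nth stable_spec_def sum_product sum.cartesian_product)
  finally show "fps_nth (stable_spec (r + s) (series_mult f g)) N = fps_nth (stable_spec r f * stable_spec s g) N" .
qed

lemma stable_spec_one: "stable_spec 0 series_one = 1"
proof -
  have "weighted_msets 0 N = (if N = 0 then {{#}} else {})" for N
    by (auto simp: weighted_msets_def)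
  then show ?thesis by (simp add: stable_spec_def fps_eq_iff series_one_def)
qed

text \<open>Each multiple of \<open>k\<close> is the weight of exactly one \<open>k\<close>-th power
  of a variable, so the specialisation is the geometric series in \<open>q^k\<close>.\<close>

lemma stable_spec_power_sum1:
  assumes "0 < k"
  shows "stable_spec k (power_sum1 k) * (1 - fps_X ^ k) = 1"
proof -
  have nth: "fps_nth (stable_spec k (power_sum1 k)) N = (if k dvd N then 1 else 0)" for N
  proof -
    have rep: "m = replicate_mset k (N div k) \<and> k dvd N"
      if "m \<in> weighted_msets k N" "m = replicate_mset k i" for m i
      using that assms by (auto simp: weighted_msets_def sum_mset_replicate_mset)
    have mem: "replicate_mset k (N div k) \<in> weighted_msets k N" if "k dvd N"
      using that by (simp add: weighted_msets_def sum_mset_replicate_mset)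
    have eq: "{m \<in> weighted_msets k N. \<exists>i. m = replicate_mset k i} =
        (if k dvd N then {replicate_mset k (N div k)} else {})"
    proof (cases "k dvd N")
      case True
      show ?thesis unfolding if_P[OF True] using rep mem[OF True] by blast
    next
      case False
      show ?thesis unfolding if_not_P[OF False] using rep False by blast
    qed
    have "fps_nth (stable_spec k (power_sum1 k)) N =
        (\<Sum>m\<in>weighted_msets k N. if \<exists>i. m = replicate_mset k i then 1 else 0)"
      unfolding stable_spec_def power_sum1_def fps_nth_Abs_fps by (intro sum.cong) auto
    also have "\<dots> = (\<Sum>m\<in>{m \<in> weighted_msets k N. \<exists>i. m = replicate_mset k i}. 1)"
      by (rule sum.inter_filter[symmetric]) (rule finite_weighted_msets)
    finally have "fps_nth (stable_spec k (power_sum1 k)) N = of_nat (card (if k dvd N then {replicate_mset k (N div k)} else {}))"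
      unfolding eq by simp
    then show ?thesis by simp
  qed
  have "k dvd N - k \<longleftrightarrow> k dvd N" if "k \<le> N" for N
    using that by (metis dvd_minus_self not_le)
  moreover have "N = 0" if "N < k" "k dvd N" for N
    using that by (metis dvd_imp_le gr0I not_le)
  ultimately show ?thesis
    using assms
    by (intro fps_ext) (auto simp: right_diff_distrib fps_X_power_mult_right_nth nth not_less)
qed

lemma size_power_sum: "power_sum \<mu> m \<noteq> 0 \<Longrightarrow> size m = sum_list \<mu>"
proof (induction \<mu> arbitrary: m)
  case (Cons k \<mu>)
  from Cons.prems have "(\<Sum>a | a \<subseteq># m. power_sum1 k a * power_sum \<mu> (m - a)) \<noteq> 0"
    by (simp add: power_sum_def series_mult_def)
  then obtain a where a: "a \<subseteq># m" "power_sum1 k a * power_sum \<mu> (m - a) \<noteq> 0"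
    by (metis (mono_tags, lifting) mem_Collect_eq sum.neutral)
  then have "size a = k" "size (m - a) = sum_list \<mu>"
    using Cons.IH by (auto simp: power_sum1_def split: if_splits)
  then show ?case using size_Diff_submset[OF a(1)] size_mset_mono[OF a(1)] by simp
qed (simp add: power_sum_def series_one_def split: if_splits)

lemma stable_spec_power_sum:
  assumes "\<forall>k\<in>set \<mu>. 0 < k"
  shows "stable_spec (sum_list \<mu>) (power_sum \<mu>) * (\<Prod>k\<leftarrow>\<mu>. 1 - fps_X ^ k) = 1"
  using assms
proof (induction \<mu>)
  case (Cons k \<mu>)
  have "stable_spec (sum_list (k # \<mu>)) (power_sum (k # \<mu>)) = stable_spec k (power_sum1 k) * stable_spec (sum_list \<mu>) (power_sum \<mu>)"
    using stable_spec_mult[of "power_sum1 k" k "sum_list \<mu>" "power_sum \<mu>"]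
    by (auto simp: power_sum_def power_sum1_def split: if_splits)
  then have "stable_spec (sum_list (k # \<mu>)) (power_sum (k # \<mu>)) * (\<Prod>k\<leftarrow>k # \<mu>. 1 - fps_X ^ k) =
     (stable_spec k (power_sum1 k) * (1 - fps_X ^ k)) *
     (stable_spec (sum_list \<mu>) (power_sum \<mu>) * (\<Prod>k\<leftarrow>\<mu>. 1 - fps_X ^ k))"
    by (simp only: list.map prod_list.Cons mult.assoc mult.left_commute)
  then show ?case using Cons stable_spec_power_sum1[of k] by simp
qed (simp add: power_sum_def stable_spec_one)

section \<open>Symmetry and integrality of power sums\<close>

lemma series_mult_image_mset:
  assumes t: "\<And>x. t (t x) = x" and "\<And>m. f (image_mset t m) = f m" "\<And>m. g (image_mset t m) = g m"
  shows "series_mult f g (image_mset t m) = series_mult f g m"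
proof -
  have tt: "image_mset t (image_mset t a) = a" for a
    by (simp add: image_mset.compositionality comp_def t)
  show ?thesis
    unfolding series_mult_def
  proof (rule sum.reindex_bij_witness[where i = "image_mset t" and j = "image_mset t"])
    fix a assume a: "a \<in> {a. a \<subseteq># image_mset t m}"
    then show "image_mset t a \<in> {a. a \<subseteq># m}"
      using image_mset_subseteq_mono[of a "image_mset t m" t] by (simp add: tt)
    have "image_mset t (image_mset t m - a) = m - image_mset t a"
      using a image_mset_Diff[of a "image_mset t m" t] by (simp add: tt)
    then show "f (image_mset t a) * g (m - image_mset t a) = f a * g (image_mset t m - a)"
      using assms(2)[of a] assms(3)[of "image_mset t m - a"] by simp
  qed (auto simp: tt image_mset_subseteq_mono)
qed

lemma symmetric_power_sum: "symmetric_series (sum_list \<mu>) (power_sum \<mu>)"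
proof -
  have "power_sum \<mu> (image_mset (transpose i (Suc i)) m) = power_sum \<mu> m" for i m
  proof (induction \<mu> arbitrary: m)
    case (Cons k \<mu>)
    let ?t = "transpose i (Suc i)"
    have "power_sum1 k (image_mset ?t m) = power_sum1 k m" for m
    proof -
      have "(\<exists>i. image_mset ?t m = replicate_mset k i) \<longleftrightarrow> (\<exists>i. m = replicate_mset k i)"
        by (metis (no_types, lifting) image_replicate_mset image_mset.compositionality
            image_mset.identity transpose_comp_involutory id_apply multiset.map_id)
      then show ?thesis by (simp add: power_sum1_def)
    qed
    then show ?case
      using series_mult_image_mset[of ?t "power_sum1 k" "power_sum \<mu>" m] Cons.IH
      by (simp add: power_sum_def)
  qed (simp add: power_sum_def series_one_def)
  then show ?thesis using size_power_sum by (auto simp: symmetric_series_def)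
qed

lemma power_sum_integral: "power_sum \<mu> m \<in> \<int>"
proof (induction \<mu> arbitrary: m)
  case (Cons k \<mu>)
  then show ?case by (auto simp: power_sum_def series_mult_def power_sum1_def intro!: Ints_sum Ints_mult)
qed (simp add: power_sum_def series_one_def)

section \<open>Standardisation of semistandard tableaux\<close>

definition cells :: "nat list \<Rightarrow> (nat \<times> nat) set" where
  "cells \<mu> = (SIGMA i:{..<length \<mu>}. {..<\<mu> ! i})"

definition entry :: "'a list list \<Rightarrow> nat \<times> nat \<Rightarrow> 'a" where
  "entry T c = T ! fst c ! snd c"

lemma mem_cells [simp]: "(i, j) \<in> cells \<mu> \<longleftrightarrow> i < length \<mu> \<and> j < \<mu> ! i"
  by (simp add: cells_def)

lemma finite_cells [simp]: "finite (cells \<mu>)"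
  by (simp add: cells_def)

lemma card_cells: "card (cells \<mu>) = sum_list \<mu>"
  by (simp add: cells_def sum_list_sum_nth atLeast0LessThan)

lemma mset_concat_cells:
  assumes "map length T = \<mu>"
  shows "mset (concat T) = image_mset (entry T) (mset_set (cells \<mu>))"
proof -
  have len: "length \<mu> = length T" "\<And>i. i < length T \<Longrightarrow> \<mu> ! i = length (T ! i)"
    using assms by auto
  have row: "mset xs = (\<Sum>j<length xs. {#xs ! j#})" for xs :: "'a list"
    using mset_concat_eq_sum[of "map (\<lambda>x. [x]) xs"] by (simp add: concat_map_singleton)
  have "image_mset (entry T) (mset_set (cells \<mu>)) = (\<Sum>c\<in>cells \<mu>. {#entry T c#})"
    by (simp add: sum_unfold_sum_mset image_mset.compositionality comp_def)
  also have "\<dots> = (\<Sum>i<length T. \<Sum>j<length (T ! i). {#T ! i ! j#})"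
    by (simp add: sum.Sigma cells_def len(1) entry_def split_def)
      (intro sum.cong Sigma_cong refl, simp add: len(2))
  also have "\<dots> = mset (concat T)"
    unfolding mset_concat_eq_sum by (intro sum.cong refl row[symmetric])
  finally show ?thesis by simp
qed

text \<open>Numbering by counting smaller or equal keys is strictly monotone in the key, hence
  injective, and its values lie in an interval with as many elements as \<open>C\<close>.\<close>

lemma rank_bij:
  fixes key :: "'a \<Rightarrow> 'b::linorder"
  assumes "finite C" "inj_on key C"
  defines "rank \<equiv> \<lambda>c. card {c' \<in> C. key c' \<le> key c}"
  shows "bij_betw rank C {1..card C}"
    and "c \<in> C \<Longrightarrow> c' \<in> C \<Longrightarrow> rank c < rank c' \<longleftrightarrow> key c < key c'"
proof -
  have mono: "rank c < rank c'" if "c \<in> C" "c' \<in> C" "key c < key c'" for c c'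
    unfolding rank_def
  proof (rule psubset_card_mono)
    have "c' \<notin> {d \<in> C. key d \<le> key c}" "c' \<in> {d \<in> C. key d \<le> key c'}" using that by auto
    then show "{d \<in> C. key d \<le> key c} \<subset> {d \<in> C. key d \<le> key c'}"
      using that by fastforce
  qed (use assms(1) in simp)
  have less: "rank c < rank c' \<longleftrightarrow> key c < key c'" if "c \<in> C" "c' \<in> C" for c c'
    using that mono[of c c'] mono[of c' c] assms(2)
    by (metis inj_on_contraD not_less_iff_gr_or_eq)
  then show "c \<in> C \<Longrightarrow> c' \<in> C \<Longrightarrow> rank c < rank c' \<longleftrightarrow> key c < key c'" by blast
  have inj: "inj_on rank C"
    using less assms(2) by (metis inj_onD inj_onI not_less_iff_gr_or_eq)
  have "rank c \<in> {1..card C}" if "c \<in> C" for c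
  proof -
    have "c \<in> {d \<in> C. key d \<le> key c}" using that by simp
    then have "0 < rank c" unfolding rank_def using assms(1) by (subst card_gt_0_iff) auto
    moreover have "rank c \<le> card C" unfolding rank_def by (intro card_mono assms(1)) auto
    ultimately show ?thesis by simp
  qed
  then have "rank ` C = {1..card C}"
    by (intro card_subset_eq) (use inj in \<open>auto simp: card_image\<close>)
  then show "bij_betw rank C {1..card C}" using inj by (simp add: bij_betw_def)
qed

definition descents :: "nat list list \<Rightarrow> nat set" where
  "descents T = {i. \<exists>a b. a < b \<and> b < length T \<and> i \<in> set (T ! a) \<and> Suc i \<in> set (T ! b)}"

text \<open>The least possible sum of a weakly increasing list of \<open>r\<close> natural numbers
  that rises strictly at every descent: a descent \<open>i\<close> pushes up the
  \<open>r - i\<close> entries after it by one.\<close>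

definition comaj :: "nat \<Rightarrow> nat list list \<Rightarrow> nat" where
  "comaj r T = (\<Sum>i\<in>descents T. r - i)"

text \<open>The content condition makes the entries exhaust the interval, and injectivity follows
  because there are equally many cells.\<close>

lemma syt_bij:
  assumes "Q \<in> syt \<mu>"
  shows "bij_betw (entry Q) (cells \<mu>) {1..sum_list \<mu>}"
proof -
  have *: "image_mset (entry Q) (mset_set (cells \<mu>)) = mset_set {1..sum_list \<mu>}"
    using assms mset_concat_cells[of Q \<mu>] by (auto simp: syt_def)
  from arg_cong[where f = set_mset, OF *] have "entry Q ` cells \<mu> = {1..sum_list \<mu>}" by simp
  moreover from this have "inj_on (entry Q) (cells \<mu>)"
    by (intro eq_card_imp_inj_on) (simp_all add: card_cells)
  ultimately show ?thesis by (simp add: bij_betw_def)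
qed

lemma descents_iff:
  assumes "map length Q = \<mu>"
  shows "i \<in> descents Q \<longleftrightarrow>
    (\<exists>c\<in>cells \<mu>. \<exists>c'\<in>cells \<mu>. fst c < fst c' \<and> entry Q c = i \<and> entry Q c' = Suc i)"
proof
  assume "i \<in> descents Q"
  then obtain a b j k where "a < b" "b < length Q" "j < length (Q ! a)" "Q ! a ! j = i"
    "k < length (Q ! b)" "Q ! b ! k = Suc i"
    by (auto simp: descents_def in_set_conv_nth)
  then show "\<exists>c\<in>cells \<mu>. \<exists>c'\<in>cells \<mu>. fst c < fst c' \<and> entry Q c = i \<and> entry Q c' = Suc i"
    using assms by (intro bexI[of _ "(a, j)"] bexI[of _ "(b, k)"]) (auto simp: entry_def)
next
  assume "\<exists>c\<in>cells \<mu>. \<exists>c'\<in>cells \<mu>. fst c < fst c' \<and> entry Q c = i \<and> entry Q c' = Suc i"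
  then obtain a j b k where *: "(a, j) \<in> cells \<mu>" "(b, k) \<in> cells \<mu>" "a < b"
    "Q ! a ! j = i" "Q ! b ! k = Suc i"
    by (auto simp: entry_def)
  then have "j < length (Q ! a)" "k < length (Q ! b)" "b < length Q" using assms by auto
  then have "i \<in> set (Q ! a)" "Suc i \<in> set (Q ! b)"
    using * by (metis nth_mem)+
  then show "i \<in> descents Q" unfolding descents_def using \<open>a < b\<close> \<open>b < length Q\<close> by blast
qed

lemma descents_subset:
  assumes "Q \<in> syt \<mu>"
  shows "descents Q \<subseteq> {1..<sum_list \<mu>}"
proof
  have len: "map length Q = \<mu>" using assms by (simp add: syt_def)
  fix i assume "i \<in> descents Q"
  then obtain c c' where "c \<in> cells \<mu>" "c' \<in> cells \<mu>" "entry Q c = i" "entry Q c' = Suc i"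
    using descents_iff[OF len] by blast
  then have "i \<in> {1..sum_list \<mu>}" "Suc i \<in> {1..sum_list \<mu>}"
    using bij_betwE[OF syt_bij[OF assms]] by auto
  then show "i \<in> {1..<sum_list \<mu>}" by simp
qed

text \<open>
  The list \<open>as\<close> records the values \<open>a\<^sub>1 \<le> \<dots> \<le> a\<^sub>r\<close> of a \<open>P\<close>-partition; \<open>a\<^sub>i\<close> is \<open>as ! (i - 1)\<close>.
\<close>

definition compatible :: "nat \<Rightarrow> nat set \<Rightarrow> nat list set" where
  "compatible r D = {as. length as = r \<and> sorted as \<and> (\<forall>i\<in>D. as ! (i - 1) < as ! i)}"

text \<open>Subtracting from each position the number of forced rises up to that position leaves an
  arbitrary weakly increasing list, that is, a multiset. The subtracted amounts add up to the sum
  over \<open>D\<close> in the statement.\<close>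

lemma card_compatible:
  assumes D: "D \<subseteq> {1..<r}"
  shows "card {as \<in> compatible r D. sum_list as = N} =
    (if (\<Sum>i\<in>D. r - i) \<le> N then card (weighted_msets r (N - (\<Sum>i\<in>D. r - i))) else 0)"
proof -
  have finD: "finite D" using D finite_subset by blast
  \<comment> \<open>A rise \<open>i\<close> separates the 0-based positions \<open>i - 1\<close> and
    \<open>i\<close>, so it affects the positions \<open>j\<close> with
    \<open>i \<le> j\<close>.\<close>
  define e where "e j = card {i \<in> D. i \<le> j}" for j
  have e_Suc: "e (Suc j) = e j + (if Suc j \<in> D then 1 else 0)" for j
  proof -
    have "{i \<in> D. i \<le> Suc j} = (if Suc j \<in> D then insert (Suc j) {i \<in> D. i \<le> j} else {i \<in> D. i \<le> j})"
      by (auto simp: le_Suc_eq)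
    then show ?thesis unfolding e_def using finD by simp
  qed
  have e0: "e 0 = 0" using D by (auto simp: e_def)
  have e_sum: "(\<Sum>j<r. e j) = (\<Sum>i\<in>D. r - i)"
  proof -
    have "(\<Sum>j<r. e j) = (\<Sum>j<r. \<Sum>i\<in>{i \<in> D. i \<le> j}. 1)" by (simp add: e_def)
    also have "\<dots> = (\<Sum>i\<in>D. \<Sum>j\<in>{j \<in> {..<r}. i \<le> j}. 1)"
      by (rule sum.swap_restrict) (auto simp: finD)
    also have "\<dots> = (\<Sum>i\<in>D. card {i..<r})"
    proof (intro sum.cong refl)
      fix i
      have "{j \<in> {..<r}. i \<le> j} = {i..<r}" by auto
      then show "(\<Sum>j\<in>{j \<in> {..<r}. i \<le> j}. 1) = card {i..<r}" by simp
    qed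
    finally show ?thesis by simp
  qed
  define up where "up m = map (\<lambda>j. sorted_list_of_multiset m ! j + e j) [0..<r]" for m
  define down where "down as = mset (map (\<lambda>j. as ! j - e j) [0..<r])" for as
  \<comment> \<open>The two claims are proved together: the bound on \<open>e j\<close> makes the
    truncated subtraction a true one, and the monotonicity of the differences carries the bound to
    the next position.\<close>
  have compat_ge: "e j \<le> as ! j \<and> (Suc j < r \<longrightarrow> as ! j - e j \<le> as ! Suc j - e (Suc j))"
    if as: "as \<in> compatible r D" and "j < r" for as j
    using \<open>j < r\<close>
  proof (induction j)
    case 0
    have "Suc 0 < r \<Longrightarrow> as ! 0 \<le> as ! Suc 0" "Suc 0 \<in> D \<Longrightarrow> as ! 0 < as ! Suc 0"
      using as by (auto simp: compatible_def sorted_iff_nth_Suc)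
    then show ?case by (auto simp: e0 e_Suc)
  next
    case (Suc j)
    have step: "as ! j \<le> as ! Suc j" "Suc j < r \<Longrightarrow> Suc (Suc j) < r \<Longrightarrow> as ! Suc j \<le> as ! Suc (Suc j)"
      "Suc j \<in> D \<Longrightarrow> as ! j < as ! Suc j" "Suc (Suc j) \<in> D \<Longrightarrow> as ! Suc j < as ! Suc (Suc j)"
      using as Suc.prems by (auto simp: compatible_def sorted_iff_nth_Suc)
    then show ?case using Suc by (auto simp: e_Suc)
  qed
  have down_sorted: "sorted_list_of_multiset (down as) = map (\<lambda>j. as ! j - e j) [0..<r]"
    if "as \<in> compatible r D" for as
    unfolding down_def sorted_list_of_multiset_mset
    by (rule sort_key_id_if_sorted) (use compat_ge[OF that] in \<open>auto simp: sorted_iff_nth_Suc\<close>)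
  have up_down: "up (down as) = as" if "as \<in> compatible r D" for as
    using that compat_ge[OF that] unfolding up_def down_sorted[OF that]
    by (intro nth_equalityI) (auto simp: compatible_def)
  have down_up: "down (up m) = m" if "size m = r" for m
  proof -
    have "map (\<lambda>j. up m ! j - e j) [0..<r] = map (\<lambda>j. sorted_list_of_multiset m ! j) [0..<r]"
      by (simp add: up_def)
    also have "\<dots> = sorted_list_of_multiset m"
      using map_nth[of "sorted_list_of_multiset m"] that by (metis mset_sorted_list_of_multiset size_mset)
    finally show ?thesis by (simp add: down_def)
  qed
  have up_mem: "up m \<in> compatible r D" if "size m = r" for m
  proof -
    define bs where "bs = sorted_list_of_multiset m"
    have bs: "length bs = r" "sorted bs"
      using that by (auto simp: bs_def) (metis mset_sorted_list_of_multiset size_mset)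
    have up: "up m ! j = bs ! j + e j" if "j < r" for j using that by (simp add: up_def bs_def)
    have step: "up m ! j + (if Suc j \<in> D then 1 else 0) \<le> up m ! Suc j" if "Suc j < r" for j
      using that bs by (simp add: up e_Suc sorted_iff_nth_Suc)
    have "sorted (up m)"
      unfolding sorted_iff_nth_Suc using step by (fastforce simp: up_def)
    moreover have "up m ! (i - 1) < up m ! i" if "i \<in> D" for i
      using step[of "i - 1"] that D by (auto simp: Suc_diff_le subset_iff)
    ultimately show ?thesis by (simp add: compatible_def up_def)
  qed
  have sum: "sum_list as = sum_mset (down as) + (\<Sum>i\<in>D. r - i)" if "as \<in> compatible r D" for as
  proof -
    have "sum_list as = (\<Sum>j<r. (as ! j - e j) + e j)"
      using that compat_ge[OF that] by (auto simp: sum_list_sum_nth compatible_def atLeast0LessThan intro!: sum.cong)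
    then show ?thesis
      by (simp add: sum.distrib e_sum down_def sum_mset_sum_list sum_list_sum_nth atLeast0LessThan
          del: mset_map)
  qed
  have size_down: "size (down as) = r" for as by (simp add: down_def)
  show ?thesis
  proof (cases "(\<Sum>i\<in>D. r - i) \<le> N")
    case True
    have "bij_betw up (weighted_msets r (N - (\<Sum>i\<in>D. r - i))) {as \<in> compatible r D. sum_list as = N}"
    proof (rule bij_betw_byWitness[where f' = down])
      show "\<forall>m\<in>weighted_msets r (N - (\<Sum>i\<in>D. r - i)). down (up m) = m"
        using down_up by (simp add: weighted_msets_def)
      show "\<forall>as\<in>{as \<in> compatible r D. sum_list as = N}. up (down as) = as"
        using up_down by simp
      show "up ` weighted_msets r (N - (\<Sum>i\<in>D. r - i)) \<subseteq> {as \<in> compatible r D. sum_list as = N}"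
        using up_mem sum down_up True by (auto simp: weighted_msets_def)
      show "down ` {as \<in> compatible r D. sum_list as = N} \<subseteq> weighted_msets r (N - (\<Sum>i\<in>D. r - i))"
        using sum size_down by (auto simp: weighted_msets_def)
    qed
    then show ?thesis using True by (simp add: bij_betw_same_card)
  next
    case False
    then have "{as \<in> compatible r D. sum_list as = N} = {}" using sum by fastforce
    then show ?thesis unfolding if_not_P[OF False] by (simp only: card.empty)
  qed
qed

text \<open>Cells with equal entries are numbered from the bottom row upwards, and from left to right within a row.\<close>

definition cell_key :: "nat list list \<Rightarrow> nat \<times> nat \<Rightarrow> nat \<times> nat \<times> nat" where
  "cell_key T c = (entry T c, length T - fst c, snd c)"

definition cell_rank :: "nat list list \<Rightarrow> nat \<times> nat \<Rightarrow> nat" where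
  "cell_rank T c = card {c' \<in> cells (map length T). cell_key T c' \<le> cell_key T c}"

definition standardization :: "nat list list \<Rightarrow> nat list list" where
  "standardization T = map (\<lambda>i. map (\<lambda>j. cell_rank T (i, j)) [0..<length (T ! i)]) [0..<length T]"

text \<open>Puts the \<open>x\<close>-th value of a \<open>P\<close>-partition in place of the entry
  \<open>x\<close>; standard tableaux count from 1 and list positions from 0.\<close>

definition substitute :: "nat list list \<Rightarrow> nat list \<Rightarrow> nat list list" where
  "substitute Q as = map (map (\<lambda>x. as ! (x - 1))) Q"

lemma inj_cell_key: "inj_on (cell_key T) (cells (map length T))"
  by (auto simp: inj_on_def cell_key_def)

lemma entry_substitute:
  assumes "map length Q = \<mu>" "c \<in> cells \<mu>"
  shows "entry (substitute Q as) c = as ! (entry Q c - 1)"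
  using assms by (cases c) (auto simp: entry_def substitute_def)

lemma entry_standardization:
  assumes "map length T = \<mu>" "c \<in> cells \<mu>"
  shows "entry (standardization T) c = cell_rank T c"
  using assms by (cases c) (auto simp: entry_def standardization_def)

lemma map_length_standardization: "map length (standardization T) = map length T"
  by (rule nth_equalityI) (simp_all add: standardization_def)

lemma tableau_eqI:
  assumes "map length S = \<mu>" "map length T = \<mu>" "\<And>c. c \<in> cells \<mu> \<Longrightarrow> entry S c = entry T c"
  shows "S = T"
proof (rule nth_equalityI)
  show len: "length S = length T" using assms(1,2) by (metis length_map)
  fix i assume i: "i < length S"
  then have "length (S ! i) = \<mu> ! i" "length (T ! i) = \<mu> ! i" "i < length \<mu>"
    using assms(1,2) len by (metis nth_map, metis nth_map, metis length_map)
  then show "S ! i = T ! i"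
    using assms(3)[of "(i, _)"] by (intro nth_equalityI) (auto simp: entry_def)
qed

text \<open>A run of equal values in \<open>as\<close> contains no descent of \<open>Q\<close>, so
  along it the row index decreases weakly; within one row, the columns increase with the entries of
  \<open>Q\<close>. Hence ties between values are broken by \<open>cell_key\<close> in the order
  given by \<open>Q\<close>.\<close>

lemma substitute_key_less:
  assumes Q: "Q \<in> syt \<mu>" and as: "as \<in> compatible (sum_list \<mu>) (descents Q)"
    and c: "c \<in> cells \<mu>" "c' \<in> cells \<mu>" and less: "entry Q c < entry Q c'"
  shows "cell_key (substitute Q as) c < cell_key (substitute Q as) c'"
proof -
  let ?r = "sum_list \<mu>"
  have len: "map length Q = \<mu>" using Q by (simp add: syt_def)
  note bij = syt_bij[OF Q]
  define pos where "pos = inv_into (cells \<mu>) (entry Q)"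
  have pos: "pos x \<in> cells \<mu>" "entry Q (pos x) = x" if "x \<in> {1..?r}" for x
    using that bij unfolding pos_def
    by (metis bij_betw_imp_surj_on inv_into_into, metis bij_betw_inv_into_right)
  have pos_entry: "pos (entry Q d) = d" if "d \<in> cells \<mu>" for d
    using that bij unfolding pos_def by (simp add: bij_betw_inv_into_left)
  have mono: "as ! (x - 1) \<le> as ! (y - 1)" if "x \<le> y" "y \<in> {1..?r}" for x y
    using as that by (auto simp: compatible_def intro!: sorted_nth_mono)
  have row: "fst (pos y) \<le> fst (pos x)"
    if "x \<le> y" "1 \<le> x" "y \<le> ?r" "as ! (x - 1) = as ! (y - 1)" for x y
    using that
  proof (induction y rule: dec_induct)
    case (step y)
    have "as ! (x - 1) \<le> as ! (y - 1)" "as ! (y - 1) \<le> as ! (Suc y - 1)"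
      using mono[of x y] mono[of y "Suc y"] step by auto
    then have eq: "as ! (x - 1) = as ! (y - 1)" "\<not> as ! (y - 1) < as ! y" using step.prems by auto
    then have "y \<notin> descents Q" using as by (auto simp: compatible_def)
    moreover have "pos y \<in> cells \<mu>" "entry Q (pos y) = y" "pos (Suc y) \<in> cells \<mu>"
      "entry Q (pos (Suc y)) = Suc y"
      using pos[of y] pos[of "Suc y"] step by auto
    ultimately have "fst (pos (Suc y)) \<le> fst (pos y)"
      unfolding descents_iff[OF len] by (meson not_le)
    then show ?case using step eq by simp
  qed simp
  have mem: "entry Q c \<in> {1..?r}" "entry Q c' \<in> {1..?r}" using bij_betwE[OF bij] c by auto
  have le: "as ! (entry Q c - 1) \<le> as ! (entry Q c' - 1)" using mono[of "entry Q c" "entry Q c'"] less mem by simp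
  have "snd c < snd c'" if "fst c = fst c'"
  proof (rule ccontr)
    assume nl: "\<not> ?thesis"
    have "sorted_wrt (<) (Q ! fst c)" using Q c len by (cases c) (auto simp: syt_def)
    moreover have "snd c < length (Q ! fst c)" using c len by (cases c) auto
    ultimately have "entry Q c' \<le> entry Q c"
      using nl that unfolding entry_def
      by (metis linorder_not_less order.order_iff_strict sorted_wrt_nth_less)
    then show False using less by simp
  qed
  moreover have "fst c' \<le> fst c" if "as ! (entry Q c - 1) = as ! (entry Q c' - 1)"
    using row[of "entry Q c" "entry Q c'"] that mem less pos_entry c by simp
  moreover have "fst c < length \<mu>" using c by (cases c) auto
  moreover have "length (substitute Q as) = length \<mu>" using len by (auto simp: substitute_def)
  ultimately show ?thesis
    using le unfolding cell_key_def entry_substitute[OF len c(1)] entry_substitute[OF len c(2)]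
    by (auto simp: less_prod_def' le_less)
qed

lemma mset_concat_substitute:
  assumes Q: "Q \<in> syt \<mu>" and as: "length as = sum_list \<mu>"
  shows "mset (concat (substitute Q as)) = mset as"
proof -
  have "mset (concat (substitute Q as)) = image_mset (\<lambda>x. as ! (x - 1)) (mset (concat Q))"
    by (simp add: substitute_def flip: map_concat)
  also have "\<dots> = image_mset (\<lambda>x. as ! (x - 1)) (mset_set (Suc ` {0..<length as}))"
    using Q as by (simp add: syt_def atLeastLessThanSuc_atLeastAtMost)
  also have "\<dots> = image_mset (\<lambda>x. as ! x) (mset_set {0..<length as})"
    by (subst image_mset_mset_set[symmetric]) (simp_all add: image_mset.compositionality comp_def)
  also have "\<dots> = mset as"
    by (metis map_nth mset_map mset_upt)
  finally show ?thesis .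
qed

text \<open>The cell keys order the cells as the entries of \<open>Q\<close> do. In a column the
  lower cell has the smaller second key component, so its larger key forces a strictly larger value.
  The rank of a cell is its entry in \<open>Q\<close>, since the entries of \<open>Q\<close> are the
  numbers from 1 on.\<close>

lemma substitute_ssyt:
  assumes Q: "Q \<in> syt \<mu>" and as: "as \<in> compatible (sum_list \<mu>) (descents Q)"
    and \<mu>: "sorted_wrt (\<ge>) \<mu>"
  shows "substitute Q as \<in> ssyt \<mu>" "standardization (substitute Q as) = Q"
    "sorted_list_of_multiset (mset (concat (substitute Q as))) = as"
proof -
  let ?T = "substitute Q as"
  have len: "map length Q = \<mu>" using Q by (simp add: syt_def)
  have lenT: "map length ?T = \<mu>" using len by (auto simp: substitute_def)
  then have lenT': "length ?T = length \<mu>" "\<And>i. i < length \<mu> \<Longrightarrow> length (?T ! i) = \<mu> ! i" by auto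
  note key = substitute_key_less[OF Q as]
  show "?T \<in> ssyt \<mu>"
    unfolding ssyt_iff
  proof (intro conjI allI impI)
    show "sorted (?T ! i)" if i: "i < length \<mu>" for i
      unfolding sorted_iff_nth_Suc
    proof (intro allI impI)
      fix j assume j: "Suc j < length (?T ! i)"
      have "Q ! i ! j < Q ! i ! Suc j"
        using Q i j lenT' len by (auto simp: syt_def sorted_wrt_nth_less)
      then show "?T ! i ! j \<le> ?T ! i ! Suc j"
        using key[of "(i, j)" "(i, Suc j)"] i j lenT' by (auto simp: entry_def cell_key_def less_prod_def')
    qed
    show "?T ! i ! j < ?T ! Suc i ! j" if ij: "Suc i < length \<mu>" "j < \<mu> ! Suc i" for i j
    proof -
      have "Q ! i ! j < Q ! Suc i ! j" using Q ij len by (auto simp: syt_def)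
      moreover have "\<mu> ! Suc i \<le> \<mu> ! i" using \<mu> ij by (simp add: sorted_wrt_iff_nth_less)
      ultimately show ?thesis
        using key[of "(i, j)" "(Suc i, j)"] ij lenT'(1) by (auto simp: entry_def cell_key_def less_prod_def')
    qed
  qed (use lenT' in auto)
  show "standardization ?T = Q"
  proof (rule tableau_eqI[where \<mu> = \<mu>])
    show "map length (standardization ?T) = \<mu>"
      using lenT by (simp add: map_length_standardization)
    fix c assume c: "c \<in> cells \<mu>"
    note bij = syt_bij[OF Q]
    have le: "cell_key ?T d \<le> cell_key ?T c \<longleftrightarrow> entry Q d \<le> entry Q c" if d: "d \<in> cells \<mu>" for d
      using key[OF d c] key[OF c d] bij c d
      by (metis bij_betw_imp_inj_on inj_on_eq_iff linorder_less_linear order_le_less order_less_imp_not_less)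
    have "cell_rank ?T c = card {d \<in> cells \<mu>. entry Q d \<le> entry Q c}"
      unfolding cell_rank_def lenT using le by (intro arg_cong[where f = card]) auto
    also have "\<dots> = card (entry Q ` {d \<in> cells \<mu>. entry Q d \<le> entry Q c})"
      by (rule card_image[symmetric]) (rule inj_on_subset[OF bij_betw_imp_inj_on[OF bij]], auto)
    also have "entry Q ` {d \<in> cells \<mu>. entry Q d \<le> entry Q c} = {1..entry Q c}"
    proof -
      have "entry Q ` cells \<mu> = {1..sum_list \<mu>}" using bij by (simp add: bij_betw_def)
      moreover have "entry Q c \<in> entry Q ` cells \<mu>" using c by simp
      ultimately have "{x \<in> entry Q ` cells \<mu>. x \<le> entry Q c} = {1..entry Q c}" by auto
      moreover have "entry Q ` {d \<in> cells \<mu>. entry Q d \<le> entry Q c} =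
          {x \<in> entry Q ` cells \<mu>. x \<le> entry Q c}"
        by auto
      ultimately show ?thesis by metis
    qed
    finally show "entry (standardization ?T) c = entry Q c"
      using entry_standardization[OF lenT c] by simp
  qed (rule len)
  show "sorted_list_of_multiset (mset (concat ?T)) = as"
    using as mset_concat_substitute[OF Q, of as]
    by (auto simp: compatible_def sorted_sort_id)
qed

text \<open>Among cells with equal entries the lower ones come first. So if the cell numbered
  \<open>Suc i\<close> lies below the one numbered \<open>i\<close>, the entry must have risen
  strictly; this is compatibility at the descents.\<close>

lemma standardization_ssyt:
  assumes T: "T \<in> ssyt \<mu>" and \<mu>: "sorted_wrt (\<ge>) \<mu>"
  defines "as \<equiv> sorted_list_of_multiset (mset (concat T))"
  shows "standardization T \<in> syt \<mu>" "as \<in> compatible (sum_list \<mu>) (descents (standardization T))"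
    "substitute (standardization T) as = T"
proof -
  let ?Q = "standardization T" and ?r = "sum_list \<mu>"
  have lenT: "map length T = \<mu>" using T by (simp add: ssyt_def)
  then have lenT': "length T = length \<mu>" "\<And>i. i < length \<mu> \<Longrightarrow> length (T ! i) = \<mu> ! i" by auto
  have lenQ: "map length ?Q = \<mu>"
    using lenT by (simp add: map_length_standardization)
  have bij: "bij_betw (cell_rank T) (cells \<mu>) {1..?r}"
    using rank_bij(1)[OF finite_cells inj_cell_key[of T]] by (simp add: cell_rank_def[abs_def] lenT card_cells)
  have less: "cell_rank T c < cell_rank T c' \<longleftrightarrow> cell_key T c < cell_key T c'"
    if "c \<in> cells \<mu>" "c' \<in> cells \<mu>" for c c'
    using rank_bij(2)[OF finite_cells inj_cell_key[of T]] that by (simp add: cell_rank_def lenT)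
  have Q: "?Q ! i ! j = cell_rank T (i, j)" if "i < length \<mu>" "j < \<mu> ! i" for i j
    using that by (simp add: standardization_def lenT')
  have "mset (concat ?Q) = image_mset (cell_rank T) (mset_set (cells \<mu>))"
    unfolding mset_concat_cells[OF lenQ]
    by (rule image_mset_cong) (simp add: entry_standardization[OF lenT])
  also have "\<dots> = mset_set {1..?r}"
    using bij by (simp add: bij_betw_def image_mset_mset_set)
  finally have content: "mset (concat ?Q) = mset_set {1..?r}" .
  have rows: "sorted_wrt (<) (?Q ! i)" if i: "i < length \<mu>" for i
    unfolding sorted_wrt_iff_nth_Suc_transp[OF transp_on_less]
  proof (intro allI impI)
    fix j assume "Suc j < length (?Q ! i)"
    then have j: "Suc j < \<mu> ! i" using i by (simp add: standardization_def lenT')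
    then have "T ! i ! j \<le> T ! i ! Suc j"
      using T i by (auto simp: ssyt_iff sorted_iff_nth_Suc)
    then show "?Q ! i ! j < ?Q ! i ! Suc j"
      using less[of "(i, j)" "(i, Suc j)"] Q i j by (auto simp: cell_key_def entry_def less_prod_def' le_less)
  qed
  have cols: "?Q ! i ! j < ?Q ! Suc i ! j" if "Suc i < length \<mu>" "j < \<mu> ! Suc i" for i j
  proof -
    have "\<mu> ! Suc i \<le> \<mu> ! i" using \<mu> that by (simp add: sorted_wrt_iff_nth_less)
    moreover have "T ! i ! j < T ! Suc i ! j" using T that by (simp add: ssyt_iff)
    ultimately show ?thesis
      using less[of "(i, j)" "(Suc i, j)"] Q that by (auto simp: cell_key_def entry_def less_prod_def')
  qed
  have lenQ': "length ?Q = length \<mu>" "\<And>i. i < length \<mu> \<Longrightarrow> length (?Q ! i) = \<mu> ! i" 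
    by (auto simp: standardization_def lenT')
  show syt: "?Q \<in> syt \<mu>"
    unfolding syt_def using lenQ rows cols content lenQ' 
    by (auto simp: all_set_conv_all_nth)
  define pos where "pos = inv_into (cells \<mu>) (cell_rank T)"
  have pos: "pos x \<in> cells \<mu>" "cell_rank T (pos x) = x" if "x \<in> {1..?r}" for x
    using that bij unfolding pos_def
    by (metis bij_betw_imp_surj_on inv_into_into, metis bij_betw_inv_into_right)
  have pos_rank: "pos (cell_rank T d) = d" if "d \<in> cells \<mu>" for d
    using that bij unfolding pos_def by (simp add: bij_betw_inv_into_left)
  \<comment> \<open>The entries of \<open>T\<close> in the order of the cell numbers. The list is
    sorted and has the content of \<open>T\<close>, so it coincides with \<open>as\<close>.\<close>
  define bs where "bs = map (\<lambda>x. entry T (pos (Suc x))) [0..<?r]"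
  have "sorted bs"
    unfolding sorted_iff_nth_Suc
  proof (intro allI impI)
    fix x assume "Suc x < length bs"
    then have x: "Suc x < ?r" by (simp add: bs_def)
    then have "cell_key T (pos (Suc x)) < cell_key T (pos (Suc (Suc x)))"
      using less[of "pos (Suc x)" "pos (Suc (Suc x))"] pos[of "Suc x"] pos[of "Suc (Suc x)"] by simp
    then show "bs ! x \<le> bs ! Suc x" using x by (auto simp: bs_def cell_key_def less_prod_def')
  qed
  have bs_rank: "bs ! (cell_rank T c - 1) = entry T c" if "c \<in> cells \<mu>" for c
    using bspec[OF bij_betwE[OF bij] that] pos_rank[OF that]
    by (cases "cell_rank T c") (auto simp: bs_def)
  have sub: "substitute ?Q bs = T"
  proof (rule tableau_eqI[where \<mu> = \<mu>])
    show "map length (substitute ?Q bs) = \<mu>" using lenQ by (auto simp: substitute_def)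
    fix c assume c: "c \<in> cells \<mu>"
    show "entry (substitute ?Q bs) c = entry T c"
      unfolding entry_substitute[OF lenQ c] entry_standardization[OF lenT c] by (rule bs_rank[OF c])
  qed (rule lenT)
  have "mset (concat T) = mset bs"
    using mset_concat_substitute[OF syt, of bs] unfolding sub by (simp add: bs_def)
  then have as: "as = bs" using \<open>sorted bs\<close> unfolding as_def by (simp add: sorted_sort_id)
  show "substitute ?Q as = T" using sub as by simp
  have "bs ! (i - 1) < bs ! i" if i: "i \<in> descents ?Q" for i
  proof -
    obtain c c' where c: "c \<in> cells \<mu>" "c' \<in> cells \<mu>" "fst c < fst c'"
      and "entry ?Q c = i" "entry ?Q c' = Suc i"
      using i unfolding descents_iff[OF lenQ] by blast
    then have rank: "cell_rank T c = i" "cell_rank T c' = Suc i"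
      using entry_standardization[OF lenT] by auto
    from c have "fst c' < length T" using lenT by (cases c') auto
    moreover have "cell_key T c < cell_key T c'" using less[OF c(1,2)] rank by simp
    ultimately have "entry T c < entry T c'" using c(3) by (auto simp: cell_key_def less_prod_def')
    then show ?thesis using bs_rank[OF c(1)] bs_rank[OF c(2)] rank by simp
  qed
  then show "as \<in> compatible ?r (descents ?Q)"
    using \<open>sorted bs\<close> as by (simp add: compatible_def bs_def)
qed

section \<open>Specialised Schur functions as sums over standard tableaux\<close>

lemma finite_syt: "finite (syt \<mu>)"
  by (rule finite_subset[OF _ finite_tableaux_mset[of \<mu> "mset_set {1..sum_list \<mu>}"]]) (auto simp: syt_def)

lemma card_ssyt_sum:
  assumes \<mu>: "sorted_wrt (\<ge>) \<mu>"
  shows "card {T \<in> ssyt \<mu>. sum_mset (mset (concat T)) = N} =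
    (\<Sum>Q\<in>syt \<mu>. card {as \<in> compatible (sum_list \<mu>) (descents Q). sum_list as = N})"
proof -
  let ?A = "SIGMA Q:syt \<mu>. {as \<in> compatible (sum_list \<mu>) (descents Q). sum_list as = N}"
  have "bij_betw (\<lambda>(Q, as). substitute Q as) ?A {T \<in> ssyt \<mu>. sum_mset (mset (concat T)) = N}"
  proof (rule bij_betw_byWitness[where f' = "\<lambda>T. (standardization T, sorted_list_of_multiset (mset (concat T)))"])
    show "\<forall>x\<in>?A. (\<lambda>T. (standardization T, sorted_list_of_multiset (mset (concat T)))) ((\<lambda>(Q, as). substitute Q as) x) = x"
      using substitute_ssyt[OF _ _ \<mu>] by (auto)
    show "\<forall>T\<in>{T \<in> ssyt \<mu>. sum_mset (mset (concat T)) = N}.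
       (\<lambda>(Q, as). substitute Q as) (standardization T, sorted_list_of_multiset (mset (concat T))) = T"
      using standardization_ssyt(3)[OF _ \<mu>] by simp
    show "(\<lambda>(Q, as). substitute Q as) ` ?A \<subseteq> {T \<in> ssyt \<mu>. sum_mset (mset (concat T)) = N}"
    proof (rule image_subsetI)
      fix x assume "x \<in> ?A"
      then obtain Q a where x: "x = (Q, a)" "Q \<in> syt \<mu>" "a \<in> compatible (sum_list \<mu>) (descents Q)" "sum_list a = N"
        by auto
      then have "mset (concat (substitute Q a)) = mset a"
        by (intro mset_concat_substitute) (auto simp: compatible_def)
      then have "sum_mset (mset (concat (substitute Q a))) = N"
        using x(4) by (simp only: sum_mset_sum_list)
      then show "(\<lambda>(Q, as). substitute Q as) x \<in> {T \<in> ssyt \<mu>. sum_mset (mset (concat T)) = N}"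
        using x(1) substitute_ssyt(1)[OF x(2,3) \<mu>] by simp
    qed
    show "(\<lambda>T. (standardization T, sorted_list_of_multiset (mset (concat T)))) ` {T \<in> ssyt \<mu>. sum_mset (mset (concat T)) = N} \<subseteq> ?A"
    proof (rule image_subsetI)
      fix T assume T: "T \<in> {T \<in> ssyt \<mu>. sum_mset (mset (concat T)) = N}"
      then have "sum_list (sorted_list_of_multiset (mset (concat T))) = N"
        by (metis (mono_tags, lifting) mem_Collect_eq mset_sorted_list_of_multiset sum_mset_sum_list)
      then show "(standardization T, sorted_list_of_multiset (mset (concat T))) \<in> ?A"
        using T standardization_ssyt(1,2)[OF _ \<mu>, of T] by blast
    qed
  qed
  then have "card {T \<in> ssyt \<mu>. sum_mset (mset (concat T)) = N} = card ?A"
    by (simp add: bij_betw_same_card)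
  also have "\<dots> = (\<Sum>Q\<in>syt \<mu>. card {as \<in> compatible (sum_list \<mu>) (descents Q). sum_list as = N})"
  proof (rule card_SigmaI)
    show "\<forall>Q\<in>syt \<mu>. finite {as \<in> compatible (sum_list \<mu>) (descents Q). sum_list as = N}"
    proof
      fix Q
      show "finite {as \<in> compatible (sum_list \<mu>) (descents Q). sum_list as = N}"
        by (rule finite_subset[OF _ finite_lists_length_eq[of "{..N}" "sum_list \<mu>"]])
          (auto simp: compatible_def member_le_sum_list)
    qed
  qed (rule finite_syt)
  finally show ?thesis .
qed

definition comaj_poly :: "nat list \<Rightarrow> complex poly" where
  "comaj_poly \<mu> = (\<Sum>Q\<in>syt \<mu>. monom 1 (comaj (sum_list \<mu>) Q))"

text \<open>Each standard tableau contributes \<open>weighted_fps r\<close> shifted by its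
  \<open>comaj\<close>. The series factor is the same for all shapes, so it can be pulled out of a
  Schur expansion and cancelled.\<close>

lemma stable_spec_schur:
  assumes \<mu>: "\<mu> \<in> partitions r"
  shows "stable_spec r (schur \<mu>) = fps_of_poly (comaj_poly \<mu>) * weighted_fps r"
proof (rule fps_ext)
  fix N
  note p = partitionsD[OF \<mu>]
  have size: "size (mset (concat T)) = r" if "T \<in> ssyt \<mu>" for T
    using that size_mset_concat[of T \<mu>] p(2) by (auto simp: ssyt_def)
  have "fps_nth (stable_spec r (schur \<mu>)) N =
      of_nat (\<Sum>m\<in>weighted_msets r N. card {T \<in> ssyt \<mu>. mset (concat T) = m})"
    by (simp add: stable_spec_def schur_def)
  also have "(\<Sum>m\<in>weighted_msets r N. card {T \<in> ssyt \<mu>. mset (concat T) = m}) =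
      card (\<Union>m\<in>weighted_msets r N. {T \<in> ssyt \<mu>. mset (concat T) = m})"
    by (rule card_UN_disjoint[symmetric]) (auto simp: finite_weighted_msets finite_ssyt_mset)
  also have "(\<Union>m\<in>weighted_msets r N. {T \<in> ssyt \<mu>. mset (concat T) = m}) =
      {T \<in> ssyt \<mu>. sum_mset (mset (concat T)) = N}"
    using size by (auto simp: weighted_msets_def)
  also have "card \<dots> = (\<Sum>Q\<in>syt \<mu>. if comaj r Q \<le> N then card (weighted_msets r (N - comaj r Q)) else 0)"
    unfolding card_ssyt_sum[OF p(1)] comaj_def
  proof (intro sum.cong refl)
    fix Q assume "Q \<in> syt \<mu>"
    from card_compatible[OF descents_subset[OF this], of N]
    show "card {as \<in> compatible (sum_list \<mu>) (descents Q). sum_list as = N} =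
      (if (\<Sum>i\<in>descents Q. r - i) \<le> N
       then card (weighted_msets r (N - (\<Sum>i\<in>descents Q. r - i))) else 0)"
      unfolding p(2) .
  qed
  also have "of_nat \<dots> = fps_nth ((\<Sum>Q\<in>syt \<mu>. fps_X ^ comaj r Q) * weighted_fps r) N"
    unfolding sum_distrib_right fps_sum_nth of_nat_sum
    by (intro sum.cong refl) (simp add: fps_X_power_mult_nth weighted_fps_def not_less)
  also have "(\<Sum>Q\<in>syt \<mu>. fps_X ^ comaj r Q) = fps_of_poly (comaj_poly \<mu>)"
    by (simp add: comaj_poly_def fps_of_poly_sum fps_of_poly_monom p(2))
  finally show "fps_nth (stable_spec r (schur \<mu>)) N = fps_nth (fps_of_poly (comaj_poly \<mu>) * weighted_fps r) N" .
qed

section \<open>Evaluation at roots of unity\<close>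

text \<open>The counterpart of \<open>fake_degree\<close> that the specialisation computes, taken
  over the complex numbers for evaluation at roots of unity.\<close>

definition comaj_degree :: "nat \<Rightarrow> series \<Rightarrow> complex poly" where
  "comaj_degree r f = (\<Sum>\<mu>\<in>partitions r. smult (of_rat (schur_coeff r f \<mu>)) (comaj_poly \<mu>))"

lemma fps_comaj_degree:
  assumes "symmetric_series r f"
  shows "fps_of_poly (comaj_degree r f) = stable_spec r f * (\<Prod>i=1..r. 1 - fps_X ^ i)"
proof -
  have "stable_spec r f = stable_spec r (\<lambda>m. \<Sum>\<mu>\<in>partitions r. schur_coeff r f \<mu> * schur \<mu> m)"
    by (rule arg_cong[where f = "stable_spec r"]) (rule ext, rule schur_coeff_expansion[OF assms])
  also have "\<dots> = (\<Sum>\<mu>\<in>partitions r. fps_const (of_rat (schur_coeff r f \<mu>)) *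
      (fps_of_poly (comaj_poly \<mu>) * weighted_fps r))"
    unfolding stable_spec_sum by (intro sum.cong refl) (simp add: stable_spec_schur)
  also have "\<dots> = fps_of_poly (comaj_degree r f) * weighted_fps r"
    by (simp add: comaj_degree_def fps_of_poly_sum fps_of_poly_smult sum_distrib_right mult.assoc)
  finally show ?thesis
    using weighted_fps_times_prod[of r] by (simp add: mult.assoc)
qed

text \<open>As power series the factors \<open>1 - q^k\<close> are units, which gives the identity.
  Both of its sides are polynomials, and as an identity of polynomials it may be evaluated at a root
  of unity.\<close>

lemma comaj_degree_power_sum:
  assumes "\<mu> \<in> partitions r"
  shows "comaj_degree r (power_sum \<mu>) * (\<Prod>k\<leftarrow>\<mu>. 1 - monom 1 k) = (\<Prod>i=1..r. 1 - monom 1 i)"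
proof -
  note p = partitionsD[OF assms]
  have "fps_of_poly (comaj_degree r (power_sum \<mu>) * (\<Prod>k\<leftarrow>\<mu>. 1 - monom 1 k)) =
    (stable_spec r (power_sum \<mu>) * (\<Prod>k\<leftarrow>\<mu>. 1 - fps_X ^ k)) * (\<Prod>i=1..r. 1 - fps_X ^ i)"
    using symmetric_power_sum[of \<mu>] fps_comaj_degree[of r "power_sum \<mu>"]
    by (simp add: fps_of_poly_mult fps_of_poly_prod_list comp_def fps_of_poly_diff fps_of_poly_monom' p(2) mult_ac)
  also have "\<dots> = fps_of_poly (\<Prod>i=1..r. 1 - monom 1 i)"
    using stable_spec_power_sum[of \<mu>] p(2,3)
    by (simp add: fps_of_poly_prod fps_of_poly_diff fps_of_poly_monom')
  finally show ?thesis unfolding fps_of_poly_eq_iff .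
qed

text \<open>The coefficients are chosen for each series separately, so additivity is not visible
  from the definition; it is inherited from the specialisation, which determines
  \<open>comaj_degree\<close>.\<close>

lemma comaj_degree_sum_power_sum:
  "comaj_degree r (\<lambda>m. \<Sum>\<mu>\<in>partitions r. power_sum \<mu> m) = (\<Sum>\<mu>\<in>partitions r. comaj_degree r (power_sum \<mu>))"
proof -
  have sym: "symmetric_series r (power_sum \<mu>)" if "\<mu> \<in> partitions r" for \<mu>
    using symmetric_power_sum[of \<mu>] partitionsD(2)[OF that] by simp
  have "symmetric_series r (\<lambda>m. \<Sum>\<mu>\<in>partitions r. power_sum \<mu> m)"
    using symmetric_series_sum[of "partitions r" r power_sum "\<lambda>_. 1"] sym by simp
  then have "fps_of_poly (comaj_degree r (\<lambda>m. \<Sum>\<mu>\<in>partitions r. power_sum \<mu> m)) =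
      stable_spec r (\<lambda>m. \<Sum>\<mu>\<in>partitions r. power_sum \<mu> m) * (\<Prod>i=1..r. 1 - fps_X ^ i)"
    by (rule fps_comaj_degree)
  also have "\<dots> = (\<Sum>\<mu>\<in>partitions r. stable_spec r (power_sum \<mu>) * (\<Prod>i=1..r. 1 - fps_X ^ i))"
    using stable_spec_sum[of r "\<lambda>_. 1" power_sum "partitions r"] by (simp add: sum_distrib_right)
  also have "\<dots> = fps_of_poly (\<Sum>\<mu>\<in>partitions r. comaj_degree r (power_sum \<mu>))"
    using fps_comaj_degree[OF sym] by (simp add: fps_of_poly_sum)
  finally show ?thesis unfolding fps_of_poly_eq_iff .
qed

text \<open>The product of the \<open>X - \<zeta>^i\<close> and the sum
  \<open>1 + X + ... + X^(d-1)\<close> are monic of degree \<open>d - 1\<close> and vanish at the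
  same \<open>d - 1\<close> points, so they are equal; put \<open>X = 1\<close>.\<close>

lemma prod_one_minus_primitive_root:
  fixes \<zeta> :: complex
  assumes "d > 0" and prim: "\<And>k. \<zeta> ^ k = 1 \<longleftrightarrow> d dvd k"
  shows "(\<Prod>i=1..<d. 1 - \<zeta> ^ i) = of_nat d"
proof -
  let ?p = "\<Prod>i=1..<d. [:- (\<zeta> ^ i), 1:]" and ?q = "\<Sum>t<d. monom (1 :: complex) t"
  have nz: "\<zeta> \<noteq> 0" using prim[of d] \<open>d > 0\<close> by (auto simp: power_0_left)
  have inj: "inj_on (\<lambda>i. \<zeta> ^ i) {1..<d}"
  proof (rule linorder_inj_onI)
    fix i j assume ij: "i < j" "i \<in> {1..<d}" "j \<in> {1..<d}"
    have "\<zeta> ^ (j - i) \<noteq> 1" using prim[of "j - i"] ij by (auto dest: dvd_imp_le)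
    moreover have "\<zeta> ^ j = \<zeta> ^ i * \<zeta> ^ (j - i)" using ij by (simp flip: power_add)
    ultimately show "\<zeta> ^ i \<noteq> \<zeta> ^ j" using nz by auto
  qed auto
  have "?p = ?q"
  proof (rule poly_eqI_degree_lead_coeff[of _ "d - 1" _ "(\<lambda>i. \<zeta> ^ i) ` {1..<d}"])
    have deg: "degree ?p = d - 1" by (subst degree_prod_sum_eq) auto
    then show "degree ?p \<le> d - 1" by simp
    have "lead_coeff ?p = 1" by (simp add: lead_coeff_prod)
    moreover have "coeff ?q (d - 1) = 1" using \<open>d > 0\<close> by (simp add: coeff_sum)
    ultimately show "coeff ?p (d - 1) = coeff ?q (d - 1)" unfolding deg by (simp only:)
    show "degree ?q \<le> d - 1" by (intro degree_sum_le) (auto intro: order.trans[OF degree_monom_le])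
    show "card ((\<lambda>i. \<zeta> ^ i) ` {1..<d}) \<ge> d - 1" unfolding card_image[OF inj] by simp
    fix z assume "z \<in> (\<lambda>i. \<zeta> ^ i) ` {1..<d}"
    then obtain i where i: "i \<in> {1..<d}" "z = \<zeta> ^ i" by blast
    have z: "z \<noteq> 1" using prim[of i] i by (auto dest: dvd_imp_le)
    have "(z - 1) * (\<Sum>t<d. z ^ t) = z ^ d - 1" by (rule power_diff_1_eq[symmetric])
    also have "z ^ d = 1" using prim[of "i * d"] i by (simp flip: power_mult)
    finally have "poly ?q z = 0" using z by (simp add: poly_sum poly_monom)
    moreover have "poly ?p z = 0" using i by (auto simp: poly_prod prod_zero_iff)
    ultimately show "poly ?p z = poly ?q z" by simp
  qed
  from arg_cong[OF this, of "\<lambda>p. poly p 1"] show ?thesis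
    by (simp add: poly_prod poly_sum poly_monom)
qed

text \<open>\<open>1 - q\<^sup>k\<close> with its possible zero at a primitive \<open>d\<close>-th root of unity divided out.\<close>

definition reduced_factor :: "nat \<Rightarrow> nat \<Rightarrow> complex poly" where
  "reduced_factor d k = (if d dvd k then \<Sum>t<k div d. monom 1 d ^ t else 1 - monom 1 k)"

lemma reduced_factor: "1 - monom 1 k = (if d dvd k then 1 - monom 1 d else 1) * reduced_factor d k"
proof (cases "d dvd k")
  case True
  then have "monom 1 k = (monom 1 d :: complex poly) ^ (k div d)" by (simp add: monom_power)
  then show ?thesis using True by (simp add: one_diff_power_eq reduced_factor_def)
qed (simp add: reduced_factor_def)

text \<open>In the block of indices from \<open>d * n + 1\<close> to \<open>d * n + d\<close>, the
  non-multiples of \<open>d\<close> together contribute \<open>d\<close>, and the multiple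
  contributes its quotient \<open>Suc n\<close>.\<close>

lemma prod_reduced_factor:
  fixes \<zeta> :: complex
  assumes "d > 0" and prim: "\<And>k. \<zeta> ^ k = 1 \<longleftrightarrow> d dvd k"
  shows "(\<Prod>i=1..d * n. poly (reduced_factor d i) \<zeta>) = fact n * of_nat d ^ n"
proof (induction n)
  case (Suc n)
  have eval: "poly (reduced_factor d k) \<zeta> = (if d dvd k then of_nat (k div d) else 1 - \<zeta> ^ k)" for k
    using prim[of d] by (simp add: reduced_factor_def poly_sum poly_monom poly_power)
  have "(\<Prod>i=1..d * Suc n. poly (reduced_factor d i) \<zeta>) =
    (\<Prod>i=1..d * n. poly (reduced_factor d i) \<zeta>) * (\<Prod>i=1..d. poly (reduced_factor d (d * n + i)) \<zeta>)"
    using prod.ub_add_nat[of 1 "d * n" "\<lambda>i. poly (reduced_factor d i) \<zeta>" d]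
      prod.shift_bounds_cl_nat_ivl[of "\<lambda>i. poly (reduced_factor d i) \<zeta>" 1 "d * n" d]
    by (simp add: add.commute)
  also have "(\<Prod>i=1..d. poly (reduced_factor d (d * n + i)) \<zeta>) =
      (\<Prod>i=1..<d. poly (reduced_factor d (d * n + i)) \<zeta>) * poly (reduced_factor d (d * n + d)) \<zeta>"
    using assms(1) by (cases d) (simp_all add: prod.cl_ivl_Suc atLeastLessThanSuc_atLeastAtMost)
  also have "(\<Prod>i=1..<d. poly (reduced_factor d (d * n + i)) \<zeta>) = (\<Prod>i=1..<d. 1 - \<zeta> ^ i)"
  proof (intro prod.cong refl)
    fix i assume i: "i \<in> {1..<d}"
    then have "\<not> d dvd i" by (auto dest: dvd_imp_le)
    then have "\<not> d dvd d * n + i" by (simp add: dvd_add_right_iff)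
    moreover have "\<zeta> ^ (d * n + i) = \<zeta> ^ i" using prim[of "d * n"] by (simp add: power_add)
    ultimately show "poly (reduced_factor d (d * n + i)) \<zeta> = 1 - \<zeta> ^ i" by (simp add: eval)
  qed
  also have "\<dots> = of_nat d" by (rule prod_one_minus_primitive_root[OF assms])
  also have "poly (reduced_factor d (d * n + d)) \<zeta> = of_nat (Suc n)"
    using assms(1) by (simp add: eval)
  finally show ?case using Suc.IH by (simp add: algebra_simps)
qed simp

text \<open>A part divisible by \<open>d\<close> is at least \<open>d\<close>; equality leaves no
  room for larger parts or for parts not divisible by \<open>d\<close>. The length bounds the order
  of the pole of the specialised power sum.\<close>

lemma sum_list_ge_divisible_parts:
  assumes "\<forall>k\<in>set \<mu>. 0 < k"
  shows "d * length (filter ((dvd) d) \<mu>) \<le> sum_list \<mu>"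
    and "d * length (filter ((dvd) d) \<mu>) = sum_list \<mu> \<Longrightarrow> \<mu> = replicate (length (filter ((dvd) d) \<mu>)) d"
proof -
  have *: "d * length (filter ((dvd) d) \<mu>) \<le> sum_list \<mu> \<and>
    (d * length (filter ((dvd) d) \<mu>) = sum_list \<mu> \<longrightarrow> \<mu> = replicate (length (filter ((dvd) d) \<mu>)) d)"
    using assms
  proof (induction \<mu>)
    case (Cons k \<mu>)
    then show ?case using dvd_imp_le[of d k] by auto
  qed simp
  then show "d * length (filter ((dvd) d) \<mu>) \<le> sum_list \<mu>"
    "d * length (filter ((dvd) d) \<mu>) = sum_list \<mu> \<Longrightarrow> \<mu> = replicate (length (filter ((dvd) d) \<mu>)) d"
    by auto
qed

text \<open>At \<open>\<zeta>\<close> the numerator has \<open>n\<close> vanishing factors and the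
  denominator has \<open>m\<close>, the number of parts divisible by \<open>d\<close>. After
  cancellation a zero survives unless \<open>m = n\<close>; in that case all parts equal
  \<open>d\<close> and the remaining denominator has the value 1.\<close>

lemma comaj_degree_power_sum_root:
  fixes \<zeta> :: complex
  assumes \<mu>: "\<mu> \<in> partitions (d * n)" and "d > 0" and prim: "\<And>k. \<zeta> ^ k = 1 \<longleftrightarrow> d dvd k"
  shows "poly (comaj_degree (d * n) (power_sum \<mu>)) \<zeta> =
    (if \<mu> = replicate n d then fact n * of_nat d ^ n else 0)"
proof -
  note p = partitionsD[OF \<mu>]
  let ?G = "comaj_degree (d * n) (power_sum \<mu>)" and ?x = "1 - monom 1 d :: complex poly"
  define m where "m = length (filter ((dvd) d) \<mu>)"
  define U where "U = (\<Prod>k\<leftarrow>\<mu>. reduced_factor d k)"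
  define V where "V = (\<Prod>i=1..d * n. reduced_factor d i)"
  have U: "(\<Prod>k\<leftarrow>\<mu>. 1 - monom 1 k) = ?x ^ m * U"
    unfolding m_def U_def
  proof (induction \<mu>)
    case (Cons k \<mu>)
    show ?case unfolding list.map prod_list.Cons reduced_factor[of k d] Cons.IH by (simp add: mult_ac)
  qed simp
  have "{i \<in> {1..d * n}. d dvd i} = (*) d ` {1..n}"
    using \<open>d > 0\<close> by (auto elim!: dvdE)
  then have "card {i \<in> {1..d * n}. d dvd i} = n"
    using \<open>d > 0\<close> by (simp add: card_image inj_on_def)
  moreover have "(\<Prod>i=1..d * n. if d dvd i then ?x else 1) = ?x ^ card {i \<in> {1..d * n}. d dvd i}"
    by (simp add: prod.inter_filter[symmetric])
  moreover have "(\<Prod>i=1..d * n. 1 - monom 1 i :: complex poly) =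
      (\<Prod>i=1..d * n. (if d dvd i then ?x else 1) * reduced_factor d i)"
    by (intro prod.cong refl reduced_factor)
  ultimately have V: "(\<Prod>i=1..d * n. 1 - monom 1 i) = ?x ^ n * V"
    unfolding V_def by (simp only: prod.distrib)
  have "?x \<noteq> 0" using \<open>d > 0\<close> by (auto simp: poly_eq_iff dest: spec[of _ 0])
  have "m \<le> n" using sum_list_ge_divisible_parts(1)[of \<mu> d] p(2,3) \<open>d > 0\<close> by (simp add: m_def)
  have xn: "?x ^ n = ?x ^ m * ?x ^ (n - m)" using \<open>m \<le> n\<close> by (simp flip: power_add)
  have "?x ^ m * (?G * U) = ?G * (?x ^ m * U)" by (rule mult.left_commute)
  also have "\<dots> = ?x ^ n * V" using comaj_degree_power_sum[OF \<mu>] unfolding U V .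
  also have "\<dots> = ?x ^ m * (?x ^ (n - m) * V)" unfolding xn by (rule mult.assoc)
  finally have "?x ^ m * (?G * U) = ?x ^ m * (?x ^ (n - m) * V)" .
  then have "?G * U = ?x ^ (n - m) * V" using \<open>?x \<noteq> 0\<close> by simp
  from arg_cong[OF this, of "\<lambda>p. poly p \<zeta>"]
  have GU: "poly ?G \<zeta> * poly U \<zeta> = poly ?x \<zeta> ^ (n - m) * poly V \<zeta>" by simp
  have x: "poly ?x \<zeta> = 0" using prim[of d] by (simp add: poly_monom)
  have eval: "poly (reduced_factor d k) \<zeta> = (if d dvd k then of_nat (k div d) else 1 - \<zeta> ^ k)" for k
    using prim[of d] by (simp add: reduced_factor_def poly_sum poly_monom poly_power)
  have U': "poly U \<zeta> = (\<Prod>k\<leftarrow>\<mu>. poly (reduced_factor d k) \<zeta>)"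
    unfolding U_def by (induction \<mu>) simp_all
  have "poly (reduced_factor d k) \<zeta> \<noteq> 0" if "k \<in> set \<mu>" for k
    using p(3)[OF that] prim[of k] \<open>d > 0\<close> by (auto simp: eval dvd_div_eq_0_iff)
  then have Unz: "poly U \<zeta> \<noteq> 0" unfolding U' by (auto simp: prod_list_zero_iff)
  show ?thesis
  proof (cases "m = n")
    case True
    then have \<mu>eq: "\<mu> = replicate n d"
      using sum_list_ge_divisible_parts(2)[of \<mu> d] p(2,3) by (simp add: m_def)
    then have "poly U \<zeta> = 1" unfolding U' using \<open>d > 0\<close> by (simp add: eval)
    then show ?thesis
      using GU True \<mu>eq prod_reduced_factor[OF \<open>d > 0\<close> prim, of n] by (simp add: V_def poly_prod)
  next
    case False
    then have "\<mu> \<noteq> replicate n d" by (auto simp: m_def)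
    moreover have "poly ?x \<zeta> ^ (n - m) = 0" using x \<open>m \<le> n\<close> False by simp
    ultimately have "poly ?G \<zeta> * poly U \<zeta> = 0" using GU by (simp only: mult_zero_left)
    then show ?thesis using Unz \<open>\<mu> \<noteq> replicate n d\<close> by simp
  qed
qed

lemma comaj_degree_root:
  fixes \<zeta> :: complex
  assumes "d > 0" and prim: "\<And>k. \<zeta> ^ k = 1 \<longleftrightarrow> d dvd k"
  shows "poly (comaj_degree (d * n) (\<lambda>m. \<Sum>\<mu>\<in>partitions (d * n). power_sum \<mu> m)) \<zeta> = fact n * of_nat d ^ n"
proof -
  have "replicate n d \<in> partitions (d * n)"
    using assms(1) by (auto simp: partitions_def sum_list_replicate sorted_wrt_iff_nth_less)
  then show ?thesis
    unfolding comaj_degree_sum_power_sum poly_sum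
    using finite_partitions
    by (subst sum.cong[OF refl comaj_degree_power_sum_root[OF _ assms]]) auto
qed

section \<open>From \<open>comaj\<close> back to \<open>maj\<close>, with integer
  coefficients\<close>

lemma maj_add_comaj:
  assumes "Q \<in> syt \<mu>"
  shows "comaj (sum_list \<mu>) Q + maj Q = sum_list \<mu> * card (descents Q)"
proof -
  have "comaj (sum_list \<mu>) Q + maj Q = (\<Sum>i\<in>descents Q. (sum_list \<mu> - i) + i)"
    by (simp add: comaj_def maj_def descents_def[symmetric] sum.distrib)
  also have "\<dots> = (\<Sum>i\<in>descents Q. sum_list \<mu>)"
    using descents_subset[OF assms] by (intro sum.cong refl) auto
  finally show ?thesis by (simp add: mult.commute)
qed

text \<open>Passing from \<open>maj\<close> to \<open>comaj\<close> amounts to complex conjugation at \<open>r\<close>-th roots of unity.\<close>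

lemma maj_poly_root:
  fixes \<zeta> :: complex
  assumes "\<zeta> ^ sum_list \<mu> = 1" "norm \<zeta> = 1"
  shows "(\<Sum>Q\<in>syt \<mu>. \<zeta> ^ maj Q) = cnj (poly (comaj_poly \<mu>) \<zeta>)"
proof -
  have "\<zeta> ^ maj Q = cnj (\<zeta> ^ comaj (sum_list \<mu>) Q)" if "Q \<in> syt \<mu>" for Q
  proof -
    let ?c = "comaj (sum_list \<mu>) Q"
    have "\<zeta> ^ (?c + maj Q) = 1" unfolding maj_add_comaj[OF that] by (simp add: power_mult assms(1))
    then have "\<zeta> ^ ?c * \<zeta> ^ maj Q = 1" by (simp add: power_add)
    moreover have "\<zeta> ^ ?c * cnj (\<zeta> ^ ?c) = 1"
      using complex_norm_square[of "\<zeta> ^ ?c"] assms(2) by (simp add: norm_power)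
    ultimately show ?thesis by (metis mult_cancel_left mult_zero_left zero_neq_one)
  qed
  then show ?thesis by (simp add: comaj_poly_def poly_sum poly_monom)
qed

lemma fake_degree_integral:
  assumes "symmetric_series r f" "\<And>m. f m \<in> \<int>"
  obtains P :: "int poly" where "map_poly of_int P = fake_degree r f"
    "\<And>\<zeta> :: complex. \<zeta> ^ r = 1 \<Longrightarrow> norm \<zeta> = 1 \<Longrightarrow>
       poly (map_poly of_int P) \<zeta> = cnj (poly (comaj_degree r f) \<zeta>)"
proof -
  have "\<forall>\<mu>\<in>partitions r. \<exists>k. schur_coeff r f \<mu> = of_int k"
    using schur_coeff_integral[OF assms] by (auto elim!: Ints_cases)
  then obtain c where c: "\<And>\<mu>. \<mu> \<in> partitions r \<Longrightarrow> schur_coeff r f \<mu> = of_int (c \<mu>)"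
    by metis
  define P :: "int poly" where "P = (\<Sum>\<mu>\<in>partitions r. smult (c \<mu>) (\<Sum>T\<in>syt \<mu>. monom 1 (maj T)))"
  \<comment> \<open>Kept polymorphic: it is used over the rationals to match
    \<open>fake_degree\<close> and over the complex numbers for evaluation.\<close>
  have P: "map_poly of_int P = (\<Sum>\<mu>\<in>partitions r. smult (of_int (c \<mu>)) (\<Sum>T\<in>syt \<mu>. monom (1 :: 'a :: {comm_ring_1, ring_char_0}) (maj T)))"
    by (rule poly_eqI) (simp add: P_def coeff_map_poly coeff_sum if_distrib[of of_int] cong: if_cong)
  show ?thesis
  proof (rule that)
    show "map_poly of_int P = fake_degree r f"
      unfolding P fake_degree_def by (intro sum.cong refl) (simp add: c)
    show "poly (map_poly of_int P) \<zeta> = cnj (poly (comaj_degree r f) \<zeta>)"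
      if "\<zeta> ^ r = 1" "norm \<zeta> = 1" for \<zeta> :: complex
      unfolding P comaj_degree_def
      using maj_poly_root[of \<zeta>] that partitionsD(2)
      by (simp add: poly_sum poly_monom c)
  qed
qed

text \<open>The condition is \<open>r dvd j * k\<close>; dividing by the gcd leaves the factor
  \<open>j div gcd j r\<close>, which is coprime to \<open>r div gcd j r\<close> and drops
  out.\<close>

lemma root_of_unity_order:
  fixes r :: nat
  assumes "r > 0"
  defines "\<omega> \<equiv> exp (2 * of_real pi * \<i> / of_nat r)"
  shows "(\<omega> ^ j) ^ k = 1 \<longleftrightarrow> r div gcd j r dvd k"
proof -
  have \<omega>: "\<omega> ^ m = cis (2 * pi * real m / real r)" for m
    unfolding \<omega>_def by (simp add: cis_conv_exp flip: exp_of_nat_mult) (simp add: mult_ac)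
  have 1: "\<omega> ^ m = 1 \<longleftrightarrow> r dvd m" for m
  proof -
    have "\<omega> ^ r = 1" unfolding \<omega> using assms(1) by simp
    then have "\<omega> ^ m = \<omega> ^ (m mod r)"
      by (metis mod_mult_div_eq mult_1 power_add power_mult power_one mult.commute)
    also have "\<dots> = 1 \<longleftrightarrow> m mod r = 0"
      using inj_onD[OF bij_betw_imp_inj_on[OF bij_betw_roots_unity[OF assms(1)]], of "m mod r" 0] assms(1)
      unfolding \<omega> by auto
    finally show ?thesis by (simp add: dvd_eq_mod_eq_0)
  qed
  let ?g = "gcd j r"
  have g: "?g > 0" using assms(1) by simp
  have "(\<omega> ^ j) ^ k = 1 \<longleftrightarrow> r dvd j * k" by (simp add: 1 flip: power_mult)
  also have "\<dots> \<longleftrightarrow> ?g * (r div ?g) dvd ?g * (j div ?g * k)" by (simp flip: mult.assoc)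
  also have "\<dots> \<longleftrightarrow> r div ?g dvd j div ?g * k" using g assms(1) by (subst nat_mult_dvd_cancel_disj) auto
  also have "\<dots> \<longleftrightarrow> r div ?g dvd k"
    using g div_gcd_coprime[of j r] assms(1) by (subst coprime_dvd_mult_right_iff) (auto simp: coprime_commute)
  finally show ?thesis .
qed

section \<open>Conjugacy classes and centralisers of permutations\<close>

lemma conj_act_eq_iff:
  assumes "bij \<sigma>"
  shows "conj_act \<sigma> \<tau> = \<tau>' \<longleftrightarrow> \<sigma> \<circ> \<tau> = \<tau>' \<circ> \<sigma>"
proof -
  have "\<sigma> \<circ> \<tau> \<circ> inv \<sigma> \<circ> \<sigma> = \<sigma> \<circ> \<tau>" "\<tau>' \<circ> \<sigma> \<circ> inv \<sigma> = \<tau>'"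
    using inv_o_cancel[OF bij_is_inj[OF assms]] surj_iff[THEN iffD1, OF bij_is_surj[OF assms]]
    by (simp_all only: comp_assoc comp_id)
  then show ?thesis unfolding conj_act_def by metis
qed

lemma conj_act_comp:
  assumes "bij \<sigma>" "bij \<rho>"
  shows "conj_act (\<sigma> \<circ> \<rho>) \<tau> = conj_act \<sigma> (conj_act \<rho> \<tau>)"
  using assms by (simp add: conj_act_def o_inv_distrib comp_assoc)

lemma conj_act_id [simp]: "conj_act id \<tau> = \<tau>"
  by (simp add: conj_act_def)

lemma perms_bij: "\<sigma> \<in> perms r \<Longrightarrow> bij \<sigma>"
  by (simp add: perms_def permutes_bij)

lemma perms_permutation: "\<sigma> \<in> perms r \<Longrightarrow> permutation \<sigma>"
  by (auto simp: perms_def intro: permutes_imp_permutation)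

lemma perms_comp: "\<sigma> \<in> perms r \<Longrightarrow> \<tau> \<in> perms r \<Longrightarrow> \<sigma> \<circ> \<tau> \<in> perms r"
  by (simp add: perms_def permutes_compose)

lemma perms_inv: "\<sigma> \<in> perms r \<Longrightarrow> inv \<sigma> \<in> perms r"
  by (simp add: perms_def permutes_inv)

lemma perms_conj_act: "\<sigma> \<in> perms r \<Longrightarrow> \<tau> \<in> perms r \<Longrightarrow> conj_act \<sigma> \<tau> \<in> perms r"
  by (simp add: conj_act_def perms_comp perms_inv)

lemma finite_perms: "finite (perms r)"
  by (simp add: perms_def finite_permutations)

lemma card_perms: "card (perms r) = fact r"
  by (simp add: perms_def card_permutations)

section \<open>Powers of the long cycle and the rotation\<close>

lemma long_cycle_funpow:
  "(long_cycle r ^^ n) i = (if i \<in> {1..r} then (i - 1 + n) mod r + 1 else i)"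
proof (induction n)
  case (Suc n)
  show ?case
  proof (cases "i \<in> {1..r}")
    case True
    then have lt: "(i - 1 + n) mod r < r" by (intro mod_less_divisor) auto
    have "(long_cycle r ^^ Suc n) i = long_cycle r ((i - 1 + n) mod r + 1)"
      using Suc True by simp
    also have "\<dots> = Suc ((i - 1 + n) mod r) mod r + 1"
      using lt by (simp add: long_cycle_def)
    also have "\<dots> = (i - 1 + Suc n) mod r + 1" by (simp only: mod_Suc_eq add_Suc_right)
    finally show ?thesis using True by simp
  next
    case False
    then have "(long_cycle r ^^ Suc n) i = long_cycle r i" using Suc by auto
    also have "\<dots> = i" using False by (auto simp: long_cycle_def)
    finally show ?thesis using False by auto
  qed
qed (auto simp: Suc_le_eq)

lemma long_cycle_funpow_r: "long_cycle r ^^ r = id"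
proof (rule ext)
  fix i
  show "(long_cycle r ^^ r) i = id i"
    by (cases i) (auto simp: long_cycle_funpow)
qed

lemma long_cycle_perms: "long_cycle r \<in> perms r"
proof -
  have sub: "long_cycle r i \<in> {1..r}" if "i \<in> {1..r}" for i
    using that by (auto simp: long_cycle_def Suc_le_eq)
  have "inj_on (long_cycle r) {1..r}"
  proof (rule inj_on_inverseI)
    fix i assume "i \<in> {1..r}"
    then have "Suc (r - 1) = r" by simp
    moreover have "(long_cycle r ^^ (r - 1)) (long_cycle r i) = (long_cycle r ^^ Suc (r - 1)) i"
      by (simp only: funpow_Suc_right comp_apply)
    ultimately have "(long_cycle r ^^ (r - 1)) (long_cycle r i) = (long_cycle r ^^ r) i" by (simp only:)
    then show "(long_cycle r ^^ (r - 1)) (long_cycle r i) = i" by (simp add: long_cycle_funpow_r)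
  qed
  then have "bij_betw (long_cycle r) {1..r} {1..r}"
    unfolding bij_betw_def using sub by (intro conjI endo_inj_surj) auto
  then show ?thesis
    unfolding perms_def by (auto intro!: bij_imp_permutes simp: long_cycle_def)
qed

lemma funpow_perms: "\<sigma> \<in> perms r \<Longrightarrow> \<sigma> ^^ n \<in> perms r"
proof (induction n)
  case 0
  show ?case by (simp add: perms_def permutes_id flip: id_def)
next
  case (Suc n)
  then show ?case unfolding funpow.simps(2) by (blast intro: perms_comp)
qed

lemma rotation_funpow: "(rotation r ^^ n) x = conj_act (long_cycle r ^^ n) x"
proof (induction n)
  case 0
  show ?case by (simp flip: id_def)
next
  case (Suc n)
  have "bij (long_cycle r)" "bij (long_cycle r ^^ n)"
    using perms_bij[OF long_cycle_perms] perms_bij[OF funpow_perms[OF long_cycle_perms]] by blast+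
  then show ?case
    unfolding funpow.simps(2) comp_apply[of "rotation r"] Suc
    by (simp only: conj_act_comp rotation_def)
qed

lemma rotation_bij: "bij_betw (rotation r) (perms r) (perms r)"
proof (rule bij_betw_byWitness[where f' = "conj_act (inv (long_cycle r))"])
  have b: "bij (long_cycle r)" "bij (inv (long_cycle r))"
    using perms_bij long_cycle_perms perms_inv by blast+
  show "\<forall>x\<in>perms r. conj_act (inv (long_cycle r)) (rotation r x) = x"
    using b by (simp add: rotation_def bij_is_inj flip: conj_act_comp)
  show "\<forall>x\<in>perms r. rotation r (conj_act (inv (long_cycle r)) x) = x"
    using b by (simp add: rotation_def bij_is_surj surj_iff[THEN iffD1] flip: conj_act_comp)
qed (auto simp: rotation_def intro!: perms_conj_act perms_inv long_cycle_perms)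

section \<open>Orbit sizes and conjugacy of permutations\<close>

lemma funpow_eq_iff_mod_card_orbit:
  assumes "permutation f"
  shows "(f ^^ i) x = (f ^^ j) x \<longleftrightarrow> i mod card (orbit f x) = j mod card (orbit f x)"
    and "card (orbit f x) > 0"
proof -
  let ?n = "least_power f x"
  note lp = least_power_of_permutation[OF assms, of x]
  have *: "(f ^^ i) x = (f ^^ j) x \<longleftrightarrow> i mod ?n = j mod ?n" if "i \<le> j" for i j
  proof -
    have "inj (f ^^ i)" using assms by (intro inj_fn) (simp add: bij_is_inj permutation_bijective)
    then have "(f ^^ i) x = (f ^^ i) ((f ^^ (j - i)) x) \<longleftrightarrow> x = (f ^^ (j - i)) x"
      by (rule inj_eq)
    moreover have "(f ^^ i) ((f ^^ (j - i)) x) = (f ^^ j) x"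
      using that by (metis comp_apply funpow_add le_add_diff_inverse)
    ultimately show ?thesis
      using least_power_dvd[OF assms, of x "j - i"] mod_eq_dvd_iff_nat[OF that, of ?n] by metis
  qed
  have eq: "(f ^^ i) x = (f ^^ j) x \<longleftrightarrow> i mod ?n = j mod ?n" for i j
    using *[of i j] *[of j i] by (metis nat_le_linear)
  have "orbit f x = (\<lambda>m. (f ^^ m) x) ` {..<?n}"
    using orbit_altdef_bounded[OF lp] by auto
  moreover have "inj_on (\<lambda>m. (f ^^ m) x) {..<?n}"
    by (auto simp: inj_on_def eq)
  ultimately have card: "card (orbit f x) = ?n" by (simp add: card_image)
  show "(f ^^ i) x = (f ^^ j) x \<longleftrightarrow> i mod card (orbit f x) = j mod card (orbit f x)"
    unfolding card by (rule eq)
  show "card (orbit f x) > 0" unfolding card by (rule lp)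
qed

text \<open>List both sets and permute one list until the values agree position by position. This
  will match the cycles of two permutations by length.\<close>

lemma image_mset_eq_imp_bij:
  assumes "finite A" "finite B" "image_mset f (mset_set A) = image_mset g (mset_set B)"
  obtains \<beta> where "bij_betw \<beta> A B" "\<And>x. x \<in> A \<Longrightarrow> g (\<beta> x) = f x"
proof -
  obtain xs where xs: "distinct xs" "set xs = A" using finite_distinct_list[OF assms(1)] by blast
  obtain ys where ys: "distinct ys" "set ys = B" using finite_distinct_list[OF assms(2)] by blast
  have "mset (map f xs) = mset (map g ys)"
    using assms(3) xs ys by (metis mset_map mset_set_set)
  then obtain p where p: "p permutes {..<length (map g ys)}" "permute_list p (map g ys) = map f xs"
    by (rule mset_eq_permutation)
  define zs where "zs = permute_list p ys"
  have zs: "distinct zs" "set zs = B" "map g zs = map f xs"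
    using p ys by (simp_all add: zs_def permute_list_map)
  then have len: "length zs = length xs" by (metis length_map)
  have A: "bij_betw ((!) xs) {..<length xs} A" and B: "bij_betw ((!) zs) {..<length xs} B"
    using xs zs len by (auto intro!: bij_betw_nth)
  show ?thesis
  proof (rule that)
    show "bij_betw ((!) zs \<circ> inv_into {..<length xs} ((!) xs)) A B"
      using bij_betw_trans[OF bij_betw_inv_into[OF A] B] .
    fix x assume "x \<in> A"
    then obtain i where i: "i < length xs" "x = xs ! i" using xs(2) by (metis in_set_conv_nth)
    then have "inv_into {..<length xs} ((!) xs) x = i"
      using bij_betw_inv_into_left[OF A, of i] by simp
    moreover have "g (zs ! i) = f (xs ! i)" using zs(3) i len by (metis nth_map)
    ultimately show "g (((!) zs \<circ> inv_into {..<length xs} ((!) xs)) x) = f x" using i by simp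
  qed
qed

definition orbit_sizes :: "'a set \<Rightarrow> ('a \<Rightarrow> 'a) \<Rightarrow> nat multiset" where
  "orbit_sizes S f = image_mset card (mset_set (orbit f ` S))"

text \<open>Match the cycles by length, choose a base point in each, and send the
  \<open>n\<close>-th iterate of a base point to the \<open>n\<close>-th iterate of the matched
  one.\<close>

lemma conjugate_if_same_orbit_sizes:
  assumes \<sigma>: "\<sigma> permutes S" and \<tau>: "\<tau> permutes S" and fin: "finite S"
    and eq: "orbit_sizes S \<sigma> = orbit_sizes S \<tau>"
  obtains \<pi> where "\<pi> permutes S" "\<pi> \<circ> \<sigma> = \<tau> \<circ> \<pi>"
proof -
  have p\<sigma>: "permutation \<sigma>" and p\<tau>: "permutation \<tau>"
    using \<sigma> \<tau> fin by (auto intro: permutes_imp_permutation)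
  obtain \<beta> where \<beta>: "bij_betw \<beta> (orbit \<sigma> ` S) (orbit \<tau> ` S)" "\<And>X. X \<in> orbit \<sigma> ` S \<Longrightarrow> card (\<beta> X) = card X"
    using image_mset_eq_imp_bij[OF _ _ eq[unfolded orbit_sizes_def]] fin by blast
  have orb\<sigma>: "orbit \<sigma> y = X" if "X \<in> orbit \<sigma> ` S" "y \<in> X" for X y
    using that orbit_cyclic_eq3[OF cyclic_on_orbit'[OF p\<sigma>]] by blast
  have orb\<tau>: "orbit \<tau> y = X" if "X \<in> orbit \<tau> ` S" "y \<in> X" for X y
    using that orbit_cyclic_eq3[OF cyclic_on_orbit'[OF p\<tau>]] by blast
  have self\<sigma>: "x \<in> orbit \<sigma> x" for x by (rule permutation_self_in_orbit[OF p\<sigma>])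
  have self\<tau>: "x \<in> orbit \<tau> x" for x by (rule permutation_self_in_orbit[OF p\<tau>])
  define a where "a X = (SOME y. y \<in> X)" for X :: "'a set"
  have a\<sigma>: "a X \<in> X" if "X \<in> orbit \<sigma> ` S" for X
    unfolding a_def some_in_eq using that self\<sigma> by blast
  have a\<tau>: "a X \<in> X" if "X \<in> orbit \<tau> ` S" for X
    unfolding a_def some_in_eq using that self\<tau> by blast
  define dist where "dist x = (SOME n. (\<sigma> ^^ n) (a (orbit \<sigma> x)) = x)" for x
  define \<phi> where "\<phi> x = (\<tau> ^^ dist x) (a (\<beta> (orbit \<sigma> x)))" for x
  have dist: "(\<sigma> ^^ dist x) (a (orbit \<sigma> x)) = x" if x: "x \<in> S" for x
  proof -
    have "orbit \<sigma> x \<in> orbit \<sigma> ` S" using x by blast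
    from orb\<sigma>[OF this a\<sigma>[OF this]] have "x \<in> orbit \<sigma> (a (orbit \<sigma> x))" using self\<sigma> by simp
    then have "\<exists>n. (\<sigma> ^^ n) (a (orbit \<sigma> x)) = x"
      unfolding orbit_altdef_permutation[OF p\<sigma>, of "a (orbit \<sigma> x)"] mem_Collect_eq by metis
    then show ?thesis unfolding dist_def by (rule someI_ex)
  qed
  have \<beta>mem: "\<beta> X \<in> orbit \<tau> ` S" if "X \<in> orbit \<sigma> ` S" for X
    using bij_betwE[OF \<beta>(1)] that by blast
  have card\<beta>: "card (orbit \<tau> (a (\<beta> X))) = card (orbit \<sigma> (a X))" if "X \<in> orbit \<sigma> ` S" for X
    using that orb\<sigma>[OF that a\<sigma>[OF that]] orb\<tau>[OF \<beta>mem[OF that] a\<tau>[OF \<beta>mem[OF that]]] \<beta>(2) by simp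
  \<comment> \<open>Any exponent leading from the base point to \<open>x\<close> may replace the
    chosen \<open>dist x\<close>: two such exponents are congruent modulo the common size of the
    matched orbits.\<close>
  have \<phi>: "\<phi> x = (\<tau> ^^ n) (a (\<beta> (orbit \<sigma> x)))"
    if x: "x \<in> S" and n: "(\<sigma> ^^ n) (a (orbit \<sigma> x)) = x" for x n
  proof -
    have "(\<sigma> ^^ dist x) (a (orbit \<sigma> x)) = (\<sigma> ^^ n) (a (orbit \<sigma> x))" using dist[OF x] n by simp
    then have "dist x mod card (orbit \<sigma> (a (orbit \<sigma> x))) = n mod card (orbit \<sigma> (a (orbit \<sigma> x)))"
      unfolding funpow_eq_iff_mod_card_orbit(1)[OF p\<sigma>] .
    then show ?thesis
      unfolding \<phi>_def funpow_eq_iff_mod_card_orbit(1)[OF p\<tau>] using card\<beta>[of "orbit \<sigma> x"] x by simp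
  qed
  have comm: "\<phi> (\<sigma> x) = \<tau> (\<phi> x)" if x: "x \<in> S" for x
  proof -
    have "orbit \<sigma> (\<sigma> x) = orbit \<sigma> x"
      using orb\<sigma>[of "orbit \<sigma> x" "\<sigma> x"] x by (blast intro: orbit.base)
    moreover have "\<sigma> x \<in> S" using x \<sigma> by (simp add: permutes_in_image)
    ultimately have "\<phi> (\<sigma> x) = (\<tau> ^^ Suc (dist x)) (a (\<beta> (orbit \<sigma> x)))"
      using \<phi>[of "\<sigma> x" "Suc (dist x)"] dist[OF x] by simp
    then show ?thesis by (simp add: \<phi>_def)
  qed
  have orb\<phi>: "\<phi> x \<in> \<beta> (orbit \<sigma> x)" if x: "x \<in> S" for x
  proof -
    have X: "\<beta> (orbit \<sigma> x) \<in> orbit \<tau> ` S" using \<beta>mem x by blast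
    show ?thesis
      unfolding \<phi>_def using orb\<tau>[OF X a\<tau>[OF X]] orbit_altdef_permutation[OF p\<tau>] by blast
  qed
  have "\<phi> ` S \<subseteq> S"
  proof (rule image_subsetI)
    fix x assume x: "x \<in> S"
    then obtain y where y: "y \<in> S" "\<beta> (orbit \<sigma> x) = orbit \<tau> y" using \<beta>mem by blast
    then show "\<phi> x \<in> S" using orb\<phi>[OF x] permutes_orbit_subset[OF \<tau> y(1)] by auto
  qed
  moreover have "inj_on \<phi> S"
  proof (rule inj_onI)
    fix x y assume xy: "x \<in> S" "y \<in> S" "\<phi> x = \<phi> y"
    then have "\<beta> (orbit \<sigma> x) = \<beta> (orbit \<sigma> y)"
      using orb\<tau>[OF \<beta>mem orb\<phi>] by (metis imageI)
    then have o: "orbit \<sigma> x = orbit \<sigma> y"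
      using xy bij_betw_imp_inj_on[OF \<beta>(1)] by (auto dest: inj_onD)
    have "dist x mod card (orbit \<sigma> (a (orbit \<sigma> x))) = dist y mod card (orbit \<sigma> (a (orbit \<sigma> x)))"
      using xy(3) card\<beta>[of "orbit \<sigma> x"] xy(1)
      unfolding \<phi>_def o[symmetric] funpow_eq_iff_mod_card_orbit(1)[OF p\<tau>] by simp
    then have "(\<sigma> ^^ dist x) (a (orbit \<sigma> x)) = (\<sigma> ^^ dist y) (a (orbit \<sigma> y))"
      unfolding o[symmetric] funpow_eq_iff_mod_card_orbit(1)[OF p\<sigma>] .
    then show "x = y" using dist xy by simp
  qed
  ultimately have bij: "bij_betw \<phi> S S" using fin by (simp add: bij_betw_def endo_inj_surj)
  define \<pi> where "\<pi> x = (if x \<in> S then \<phi> x else x)" for x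
  show ?thesis
  proof (rule that)
    have "bij_betw \<pi> S S" using bij by (subst bij_betw_cong[of S \<pi> \<phi>]) (simp_all add: \<pi>_def)
    then show "\<pi> permutes S" by (rule bij_imp_permutes) (simp add: \<pi>_def)
    show "\<pi> \<circ> \<sigma> = \<tau> \<circ> \<pi>"
      using comm \<sigma> \<tau> by (auto simp: fun_eq_iff \<pi>_def permutes_in_image permutes_not_in)
  qed
qed

lemma orbit_conj:
  assumes "bij \<pi>" "\<pi> \<circ> \<sigma> = \<tau> \<circ> \<pi>"
  shows "orbit \<tau> (\<pi> x) = \<pi> ` orbit \<sigma> x"
proof -
  have "\<tau> (\<pi> x) = \<pi> (\<sigma> x)" for x using assms(2) by (metis comp_apply)
  then have "(\<tau> ^^ n) (\<pi> x) = \<pi> ((\<sigma> ^^ n) x)" for n by (induction n) simp_all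
  then show ?thesis unfolding orbit_altdef by auto
qed

lemma orbit_sizes_conj:
  assumes "\<pi> permutes S" "\<pi> \<circ> \<sigma> = \<tau> \<circ> \<pi>"
  shows "orbit_sizes S \<tau> = orbit_sizes S \<sigma>"
proof -
  have b: "bij \<pi>" and img: "\<pi> ` S = S" using assms(1) by (auto simp: permutes_bij permutes_image)
  have "orbit \<tau> ` S = orbit \<tau> ` \<pi> ` S" by (simp add: img)
  also have "\<dots> = (`) \<pi> ` (orbit \<sigma> ` S)"
    unfolding image_image using orbit_conj[OF b assms(2)] by simp
  finally have "orbit \<tau> ` S = (`) \<pi> ` (orbit \<sigma> ` S)" .
  moreover
  have "inj_on ((`) \<pi>) (orbit \<sigma> ` S)"
    by (rule inj_onI) (simp only: inj_image_eq_iff[OF bij_is_inj[OF b]])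
  then have "mset_set ((`) \<pi> ` (orbit \<sigma> ` S)) = image_mset ((`) \<pi>) (mset_set (orbit \<sigma> ` S))"
    by (rule image_mset_mset_set[symmetric])
  ultimately have "orbit_sizes S \<tau> = image_mset (\<lambda>X. card (\<pi> ` X)) (mset_set (orbit \<sigma> ` S))"
    by (simp only: orbit_sizes_def image_mset.compositionality comp_def)
  also have "(\<lambda>X. card (\<pi> ` X)) = card"
    by (intro ext card_image inj_on_subset[OF bij_is_inj[OF b]] subset_UNIV)
  finally show ?thesis by (simp add: orbit_sizes_def)
qed

lemma cycle_type_eq_iff: "cycle_type r \<sigma> = cycle_type r \<tau> \<longleftrightarrow> orbit_sizes {1..r} \<sigma> = orbit_sizes {1..r} \<tau>"
  using mset_sorted_list_of_multiset[of "orbit_sizes {1..r} \<sigma>"]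
    mset_sorted_list_of_multiset[of "orbit_sizes {1..r} \<tau>"]
  unfolding cycle_type_def orbit_sizes_def rev_is_rev_conv by metis

lemma cycle_type_partition:
  assumes "\<sigma> \<in> perms r"
  shows "cycle_type r \<sigma> \<in> partitions r"
proof -
  have \<sigma>: "\<sigma> permutes {1..r}" "permutation \<sigma>" using assms perms_permutation by (auto simp: perms_def)
  have un: "\<Union>(orbit \<sigma> ` {1..r}) = {1..r}"
    using permutes_orbit_subset[OF \<sigma>(1)] permutation_self_in_orbit[OF \<sigma>(2)] by blast
  have "sum_mset (orbit_sizes {1..r} \<sigma>) = (\<Sum>X\<in>orbit \<sigma> ` {1..r}. card X)"
    by (simp add: orbit_sizes_def sum_unfold_sum_mset)
  also have "\<dots> = card (\<Union>(orbit \<sigma> ` {1..r}))"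
  proof (rule card_Union_disjoint[symmetric])
    show "pairwise disjnt (orbit \<sigma> ` {1..r})"
      unfolding pairwise_def disjnt_def
      using orbit_cyclic_eq3[OF cyclic_on_orbit'[OF \<sigma>(2)]] by blast
    show "finite X" if "X \<in> orbit \<sigma> ` {1..r}" for X
      using that finite_orbit[OF permutation_self_in_orbit[OF \<sigma>(2)]] by auto
  qed
  also have "\<dots> = r" unfolding un by simp
  finally have sum: "sum_list (cycle_type r \<sigma>) = r"
    unfolding cycle_type_def orbit_sizes_def
    by (metis mset_rev mset_sorted_list_of_multiset sum_mset_sum_list)
  have "k > 0" if "k \<in> set (cycle_type r \<sigma>)" for k
    using that funpow_eq_iff_mod_card_orbit(2)[OF \<sigma>(2)] by (auto simp: cycle_type_def)
  moreover have "sorted_wrt (\<ge>) (cycle_type r \<sigma>)"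
    by (simp add: cycle_type_def sorted_wrt_rev)
  ultimately show ?thesis using sum by (simp add: partitions_def)
qed

text \<open>A further part \<open>k\<close> is realised by a long cycle of length \<open>k\<close>,
  shifted to the \<open>k\<close> points that follow those already used.\<close>

lemma permutation_with_orbit_sizes:
  assumes "\<forall>k\<in>set \<mu>. 0 < k"
  shows "\<exists>\<sigma>. \<sigma> permutes {1..sum_list \<mu>} \<and> orbit_sizes {1..sum_list \<mu>} \<sigma> = mset \<mu>"
  using assms
proof (induction \<mu>)
  case Nil
  show ?case by (rule exI[of _ id]) (simp add: orbit_sizes_def id_def)
next
  case (Cons k \<mu>)
  then obtain \<sigma> where \<sigma>: "\<sigma> permutes {1..sum_list \<mu>}" "orbit_sizes {1..sum_list \<mu>} \<sigma> = mset \<mu>"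
    by auto
  have "k > 0" using Cons.prems by simp
  define s where "s = sum_list \<mu>"
  define N where "N = {s + 1..s + k}"
  define \<gamma> where "\<gamma> x = (if x \<in> N then s + long_cycle k (x - s) else x)" for x
  define \<tau> where "\<tau> = \<gamma> \<circ> \<sigma>"
  have lc: "long_cycle k permutes {1..k}" using long_cycle_perms by (simp add: perms_def)
  have N_iff: "x \<in> N \<longleftrightarrow> x - s \<in> {1..k} \<and> s \<le> x" for x by (auto simp: N_def)
  have \<gamma>N: "\<gamma> x \<in> N" if "x \<in> N" for x
    using that permutes_in_image[OF lc, of "x - s"] by (simp add: \<gamma>_def N_iff)
  have "inj_on \<gamma> N"
  proof (rule inj_onI)
    fix x y assume xy: "x \<in> N" "y \<in> N" "\<gamma> x = \<gamma> y"
    then have "x - s = y - s" using injD[OF permutes_inj[OF lc]] by (simp add: \<gamma>_def)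
    then show "x = y" using xy(1,2) by (metis N_iff le_add_diff_inverse)
  qed
  then have "bij_betw \<gamma> N N"
    using \<gamma>N unfolding bij_betw_def by (intro conjI endo_inj_surj) (auto simp: N_def)
  then have "\<gamma> permutes N" by (rule bij_imp_permutes) (simp add: \<gamma>_def)
  then have \<tau>: "\<tau> permutes {1..k + s}"
    unfolding \<tau>_def using \<sigma>(1)
    by (intro permutes_compose) (auto intro: permutes_subset simp: N_def s_def)
  have \<sigma>S: "(\<sigma> ^^ n) x \<in> {1..s}" if "x \<in> {1..s}" for x n
    using that permutes_in_image[OF \<sigma>(1)] by (induction n) (simp_all add: s_def)
  have pow_S: "(\<tau> ^^ n) x = (\<sigma> ^^ n) x" if "x \<in> {1..s}" for x n
  proof (induction n)
    case (Suc n)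
    have "(\<sigma> ^^ Suc n) x \<notin> N" using \<sigma>S[OF that, of "Suc n"] unfolding N_def by simp
    then show ?case using Suc by (simp add: \<tau>_def \<gamma>_def)
  qed simp
  have pow_N: "(\<tau> ^^ n) (s + i) = s + (long_cycle k ^^ n) i" if i: "i \<in> {1..k}" for i n
  proof (induction n)
    case (Suc n)
    let ?y = "(long_cycle k ^^ n) i"
    have y: "?y \<in> {1..k}"
      using i permutes_in_image[OF permutes_funpow[OF lc]] by simp
    then have "\<sigma> (s + ?y) = s + ?y" using \<sigma>(1) by (intro permutes_not_in[OF \<sigma>(1)]) (simp add: s_def)
    moreover have "s + ?y \<in> N" using y by (simp add: N_iff)
    ultimately show ?case using Suc by (simp add: \<tau>_def \<gamma>_def)
  qed simp
  have orb_S: "orbit \<tau> x = orbit \<sigma> x" if "x \<in> {1..s}" for x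
    unfolding orbit_altdef using pow_S[OF that] by simp
  have orb_N: "orbit \<tau> x = N" if x: "x \<in> N" for x
  proof -
    define i where "i = x - s"
    have i: "i \<in> {1..k}" "x = s + i" using x by (auto simp: N_iff i_def)
    have A: "s + ((i - 1 + n) mod k + 1) \<in> N" for n
      using \<open>k > 0\<close> by (simp add: N_def Suc_leI)
    have B: "\<exists>n>0. y = s + ((i - 1 + n) mod k + 1)" if y: "y \<in> N" for y
    proof (intro exI conjI)
      define b where "b = y - s"
      have b: "b \<in> {1..k}" "y = s + b" using y by (auto simp: N_iff b_def)
      \<comment> \<open>The exponent \<open>k + b - i\<close> leads from \<open>i\<close> to
        \<open>b\<close> around the cycle. The extra period \<open>k\<close> keeps it positive, as
        the description of orbits by positive powers demands.\<close>
      have "i - 1 + (k + b - i) = b - 1 + k" using i b by auto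
      then have "(i - 1 + (k + b - i)) mod k = b - 1"
        using b by (simp only: mod_add_self2) (auto intro: mod_less)
      then show "y = s + ((i - 1 + (k + b - i)) mod k + 1)" using b by simp
      show "0 < k + b - i" using i b by auto
    qed
    have C: "orbit \<tau> x = {s + ((i - 1 + n) mod k + 1) | n. 0 < n}"
      unfolding orbit_altdef i(2) pow_N[OF i(1)] long_cycle_funpow using i(1) by simp
    show ?thesis
      unfolding C
    proof (intro equalityI subsetI)
      fix y assume "y \<in> {s + ((i - 1 + n) mod k + 1) | n. 0 < n}"
      then show "y \<in> N" using A by auto
    next
      fix y assume "y \<in> N"
      then show "y \<in> {s + ((i - 1 + n) mod k + 1) | n. 0 < n}" using B unfolding mem_Collect_eq by metis
    qed
  qed
  have un: "{1..k + s} = {1..s} \<union> N" by (auto simp: N_def)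
  have "N \<noteq> {}" using \<open>k > 0\<close> by (simp add: N_def)
  then have "orbit \<tau> ` N = {N}" using orb_N by auto
  moreover have "orbit \<tau> ` {1..s} = orbit \<sigma> ` {1..s}" using orb_S by (intro image_cong refl)
  ultimately have img: "orbit \<tau> ` {1..k + s} = insert N (orbit \<sigma> ` {1..s})"
    unfolding un image_Un by (simp add: Un_commute)
  have "N \<notin> orbit \<sigma> ` {1..s}"
  proof
    assume "N \<in> orbit \<sigma> ` {1..s}"
    then obtain x where "x \<in> {1..s}" "N = orbit \<sigma> x" by blast
    then have "N \<subseteq> {1..s}" using permutes_orbit_subset[OF \<sigma>(1), of x] by (simp add: s_def)
    moreover have "s + 1 \<in> N" using \<open>k > 0\<close> by (simp add: N_def)
    ultimately show False by auto
  qed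
  then have "orbit_sizes {1..k + s} \<tau> = add_mset k (orbit_sizes {1..s} \<sigma>)"
    unfolding orbit_sizes_def img by (simp add: N_def)
  then show ?case using \<tau> \<sigma>(2) by (auto simp: s_def)
qed

lemma cycle_type_surj:
  assumes "\<mu> \<in> partitions r"
  obtains \<sigma> where "\<sigma> \<in> perms r" "cycle_type r \<sigma> = \<mu>"
proof -
  note p = partitionsD[OF assms]
  obtain \<sigma> where \<sigma>: "\<sigma> permutes {1..r}" "orbit_sizes {1..r} \<sigma> = mset \<mu>"
    using permutation_with_orbit_sizes[of \<mu>] p(2,3) by auto
  have "sorted (rev \<mu>)" using p(1) by (simp add: sorted_wrt_rev)
  then have "sort \<mu> = rev \<mu>" by (intro properties_for_sort) simp_all
  then have "cycle_type r \<sigma> = \<mu>"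
    using \<sigma>(2) unfolding cycle_type_def orbit_sizes_def by simp
  then show ?thesis using that \<sigma>(1) by (simp add: perms_def)
qed

section \<open>Orders of centralisers and the Frobenius character\<close>

lemma conj_act_fixed_iff:
  assumes "\<sigma> \<in> perms r" "\<tau> \<in> perms r"
  shows "conj_act \<sigma> \<tau> = \<tau> \<longleftrightarrow> conj_act \<tau> \<sigma> = \<sigma>"
  using assms by (auto simp: conj_act_eq_iff perms_bij)

lemma cycle_type_eq_imp_conj:
  assumes "\<sigma> \<in> perms r" "\<tau> \<in> perms r" "cycle_type r \<sigma> = cycle_type r \<tau>"
  obtains \<pi> where "\<pi> \<in> perms r" "conj_act \<pi> \<sigma> = \<tau>"
proof -
  have \<sigma>\<tau>: "\<sigma> permutes {1..r}" "\<tau> permutes {1..r}" "orbit_sizes {1..r} \<sigma> = orbit_sizes {1..r} \<tau>"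
    using assms by (simp_all add: perms_def cycle_type_eq_iff)
  obtain \<pi> where "\<pi> permutes {1..r}" "\<pi> \<circ> \<sigma> = \<tau> \<circ> \<pi>"
    by (rule conjugate_if_same_orbit_sizes[OF \<sigma>\<tau>(1,2) finite_atLeastAtMost \<sigma>\<tau>(3)])
  then show ?thesis using that by (simp add: conj_act_eq_iff permutes_bij perms_def)
qed

lemma cycle_type_conj:
  assumes "\<pi> \<in> perms r"
  shows "cycle_type r (conj_act \<pi> \<sigma>) = cycle_type r \<sigma>"
proof -
  have "\<pi> \<circ> \<sigma> = conj_act \<pi> \<sigma> \<circ> \<pi>" using conj_act_eq_iff[OF perms_bij[OF assms]] by blast
  then show ?thesis
    using orbit_sizes_conj[of \<pi> "{1..r}" \<sigma>] assms by (simp add: cycle_type_eq_iff perms_def)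
qed

text \<open>Orbit-stabiliser for the conjugation action, summed over one conjugacy class.\<close>

lemma sum_card_centralizer:
  assumes "\<mu> \<in> partitions r"
  shows "(\<Sum>\<sigma>\<in>{\<sigma> \<in> perms r. cycle_type r \<sigma> = \<mu>}. card {\<tau> \<in> perms r. conj_act \<sigma> \<tau> = \<tau>}) = fact r"
proof -
  obtain \<sigma>0 where \<sigma>0: "\<sigma>0 \<in> perms r" "cycle_type r \<sigma>0 = \<mu>" using cycle_type_surj[OF assms] .
  let ?K = "{\<sigma> \<in> perms r. cycle_type r \<sigma> = \<mu>}"
  have fibre: "card {\<pi> \<in> perms r. conj_act \<pi> \<sigma>0 = \<sigma>} = card {\<tau> \<in> perms r. conj_act \<sigma> \<tau> = \<tau>}"
    if \<sigma>: "\<sigma> \<in> ?K" for \<sigma>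
  proof -
    obtain \<rho> where \<rho>: "\<rho> \<in> perms r" "conj_act \<rho> \<sigma>0 = \<sigma>"
      using cycle_type_eq_imp_conj[of \<sigma>0 r \<sigma>] \<sigma> \<sigma>0 by auto
    have b: "bij \<rho>" by (rule perms_bij[OF \<rho>(1)])
    have inv: "\<rho> \<circ> inv \<rho> = id" "inv \<rho> \<circ> \<rho> = id"
      using b by (simp_all add: surj_iff[THEN iffD1] bij_is_surj bij_is_inj)
    have \<sigma>0': "conj_act (inv \<rho>) \<sigma> = \<sigma>0"
      unfolding \<rho>(2)[symmetric] conj_act_comp[OF bij_imp_bij_inv[OF b] b, symmetric] inv(2) by simp
    \<comment> \<open>The permutations carrying \<open>\<sigma>0\<close> to \<open>\<sigma>\<close>
      form a coset of the centraliser of \<open>\<sigma>\<close>, with \<open>\<rho>\<close> as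
      representative.\<close>
    have "bij_betw (\<lambda>\<tau>. \<tau> \<circ> \<rho>) {\<tau> \<in> perms r. conj_act \<sigma> \<tau> = \<tau>} {\<pi> \<in> perms r. conj_act \<pi> \<sigma>0 = \<sigma>}"
    proof (rule bij_betw_byWitness[where f' = "\<lambda>\<pi>. \<pi> \<circ> inv \<rho>"])
      show "(\<lambda>\<tau>. \<tau> \<circ> \<rho>) ` {\<tau> \<in> perms r. conj_act \<sigma> \<tau> = \<tau>} \<subseteq> {\<pi> \<in> perms r. conj_act \<pi> \<sigma>0 = \<sigma>}"
        using \<rho> \<sigma> by (auto simp: perms_comp perms_bij conj_act_comp conj_act_fixed_iff)
      show "(\<lambda>\<pi>. \<pi> \<circ> inv \<rho>) ` {\<pi> \<in> perms r. conj_act \<pi> \<sigma>0 = \<sigma>} \<subseteq> {\<tau> \<in> perms r. conj_act \<sigma> \<tau> = \<tau>}"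
      proof (rule image_subsetI)
        fix \<pi> assume "\<pi> \<in> {\<pi> \<in> perms r. conj_act \<pi> \<sigma>0 = \<sigma>}"
        then have \<pi>: "\<pi> \<in> perms r" "conj_act \<pi> \<sigma>0 = \<sigma>" by auto
        then have "conj_act (\<pi> \<circ> inv \<rho>) \<sigma> = \<sigma>"
          using b \<sigma>0' by (simp add: conj_act_comp perms_bij bij_imp_bij_inv)
        then show "\<pi> \<circ> inv \<rho> \<in> {\<tau> \<in> perms r. conj_act \<sigma> \<tau> = \<tau>}"
          using \<pi> \<rho> \<sigma> conj_act_fixed_iff[of \<sigma> r "\<pi> \<circ> inv \<rho>"] by (simp add: perms_comp perms_inv)
      qed
    qed (simp_all add: comp_assoc inv)
    then show ?thesis by (simp add: bij_betw_same_card)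
  qed
  have "fact r = card (perms r)" by (simp add: card_perms)
  also have "\<dots> = (\<Sum>\<pi>\<in>perms r. 1)" by simp
  \<comment> \<open>All permutations, sorted by the conjugate of \<open>\<sigma>0\<close> that they
    produce.\<close>
  also have "\<dots> = (\<Sum>\<sigma>\<in>?K. \<Sum>\<pi>\<in>{\<pi> \<in> perms r. conj_act \<pi> \<sigma>0 = \<sigma>}. 1)"
    by (rule sum.group[symmetric])
      (use \<sigma>0 finite_perms in \<open>auto simp: perms_conj_act cycle_type_conj\<close>)
  also have "\<dots> = (\<Sum>\<sigma>\<in>?K. card {\<tau> \<in> perms r. conj_act \<sigma> \<tau> = \<tau>})"
    using fibre by (intro sum.cong) simp_all
  finally show ?thesis by simp
qed

lemma ch_S_eq: "ch_S r = (\<lambda>m. \<Sum>\<mu>\<in>partitions r. power_sum \<mu> m)"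
proof (rule ext)
  fix m
  let ?c = "\<lambda>\<sigma>. card {\<tau> \<in> perms r. conj_act \<sigma> \<tau> = \<tau>}"
  have trace: "trace_on (perms r) (perm_rep conj_act \<sigma>) = of_nat (?c \<sigma>)" for \<sigma>
  proof -
    have "trace_on (perms r) (perm_rep conj_act \<sigma>) = (\<Sum>\<tau>\<in>perms r. if conj_act \<sigma> \<tau> = \<tau> then 1 else 0)"
      unfolding trace_on_def perm_rep_def by (intro sum.cong) auto
    also have "\<dots> = (\<Sum>\<tau>\<in>{\<tau> \<in> perms r. conj_act \<sigma> \<tau> = \<tau>}. 1)"
      by (rule sum.inter_filter[symmetric, OF finite_perms])
    finally show ?thesis by simp
  qed
  have "(\<Sum>\<sigma>\<in>perms r. of_nat (?c \<sigma>) * power_sum (cycle_type r \<sigma>) m) =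
      (\<Sum>\<mu>\<in>partitions r. \<Sum>\<sigma>\<in>{\<sigma> \<in> perms r. cycle_type r \<sigma> = \<mu>}. of_nat (?c \<sigma>) * power_sum (cycle_type r \<sigma>) m)"
    by (rule sum.group[symmetric])
      (use finite_perms finite_partitions cycle_type_partition in auto)
  also have "\<dots> = (\<Sum>\<mu>\<in>partitions r. of_nat (\<Sum>\<sigma>\<in>{\<sigma> \<in> perms r. cycle_type r \<sigma> = \<mu>}. ?c \<sigma>) * power_sum \<mu> m)"
    by (intro sum.cong refl) (simp add: sum_distrib_right)
  also have "\<dots> = fact r * (\<Sum>\<mu>\<in>partitions r. power_sum \<mu> m)"
    unfolding sum_distrib_left
    by (intro sum.cong refl) (simp only: sum_card_centralizer of_nat_fact)
  finally show "ch_S r m = (\<Sum>\<mu>\<in>partitions r. power_sum \<mu> m)"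
    by (simp add: ch_S_def frobenius_ch_def trace)
qed

section \<open>The centraliser of a power of the long cycle\<close>

lemma funpow_commute:
  assumes "f \<circ> x = x \<circ> f"
  shows "(f ^^ n) \<circ> x = x \<circ> (f ^^ n)"
proof (induction n)
  case (Suc n)
  show ?case unfolding funpow.simps(2) comp_assoc Suc unfolding comp_assoc[symmetric] assms by (rule refl)
qed simp

text \<open>The two powers of the long cycle are powers of each other: \<open>gcd j r\<close>
  divides \<open>j\<close>, and by Bezout it is a multiple of \<open>j\<close> modulo
  \<open>r\<close>.\<close>

lemma commute_long_cycle_power_iff:
  assumes "r > 0"
  shows "(long_cycle r ^^ j) \<circ> x = x \<circ> (long_cycle r ^^ j) \<longleftrightarrow>
    (long_cycle r ^^ gcd j r) \<circ> x = x \<circ> (long_cycle r ^^ gcd j r)"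
proof
  let ?c = "long_cycle r"
  assume *: "(?c ^^ j) \<circ> x = x \<circ> (?c ^^ j)"
  show "(?c ^^ gcd j r) \<circ> x = x \<circ> (?c ^^ gcd j r)"
  proof (cases "j = 0")
    case False
    then obtain t y where t: "j * t = r * y + gcd j r" using bezout_nat by blast
    have "?c ^^ (r * y) = id"
      using funpow_mult[where f = ?c and n = r and m = y] funpow_mult[where f = ?c and n = y and m = r]
      by (simp add: long_cycle_funpow_r mult.commute)
    then have "(?c ^^ j) ^^ t = ?c ^^ gcd j r"
      unfolding funpow_mult mult.commute[of t j] t funpow_add by simp
    then show ?thesis using funpow_commute[OF *, of t] by simp
  qed (simp add: long_cycle_funpow_r)
next
  let ?c = "long_cycle r"
  assume *: "(?c ^^ gcd j r) \<circ> x = x \<circ> (?c ^^ gcd j r)"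
  have "(?c ^^ gcd j r) ^^ (j div gcd j r) = ?c ^^ j" by (simp add: funpow_mult)
  then show "(?c ^^ j) \<circ> x = x \<circ> (?c ^^ j)" using funpow_commute[OF *, of "j div gcd j r"] by simp
qed

text \<open>The \<open>g\<close>-th power of the long cycle consists of \<open>g\<close> cycles of
  length \<open>d\<close>, namely the residue classes modulo \<open>g\<close>. A permutation
  commuting with it permutes these cycles and rotates each of them, so the centraliser is a wreath
  product of the cyclic group of order \<open>d\<close> with the symmetric group on \<open>g\<close>
  letters.\<close>

lemma card_centralizer_power:
  assumes "r = g * d" "r > 0"
  shows "card {x \<in> perms r. (long_cycle r ^^ g) \<circ> x = x \<circ> (long_cycle r ^^ g)} = fact g * d ^ g"
proof -
  let ?c = "long_cycle r ^^ g"
  have "g > 0" "d > 0" using assms by auto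
  \<comment> \<open>\<open>A i\<close> names the cycle containing \<open>i\<close>, by its least
    element in \<open>{1..g}\<close>; \<open>M i\<close> is the position of \<open>i\<close> in that
    cycle, counted from 0.\<close>
  define A where "A i = (i - 1) mod g + 1" for i
  define M where "M i = (i - 1) div g" for i
  have AM: "A i + g * M i = i" if "i > 0" for i
    using that by (simp add: A_def M_def)
  have A_mem: "A i \<in> {1..g}" for i using \<open>g > 0\<close> by (simp add: A_def Suc_leI)
  have M_less: "M i < d" if "i \<in> {1..r}" for i
    using that assms \<open>g > 0\<close> by (auto simp: M_def less_mult_imp_div_less mult.commute)
  have dec: "A (a + g * m) = a" "M (a + g * m) = m" if a: "a \<in> {1..g}" for a m
  proof -
    obtain b where "a = Suc b" "b < g" using a by (cases a) auto
    then show "A (a + g * m) = a" "M (a + g * m) = m"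
      by (simp_all add: A_def M_def)
  qed
  have enc_mem: "a + g * m \<in> {1..r}" if "a \<in> {1..g}" "m < d" for a m
  proof -
    have "a + g * m \<le> g + g * (d - 1)" using that by (intro add_mono mult_le_mono) auto
    also have "\<dots> = r" using \<open>d > 0\<close> by (simp add: assms(1) algebra_simps flip: mult_Suc_right)
    finally show ?thesis using that by simp
  qed
  have c_pow: "(long_cycle r ^^ (g * n)) (a + g * m) = a + g * ((m + n) mod d)"
    if "a \<in> {1..g}" "m < d" for a m n
  proof -
    have "(long_cycle r ^^ (g * n)) (a + g * m) = (a + g * m - 1 + g * n) mod r + 1"
      using enc_mem[OF that] by (simp add: long_cycle_funpow)
    also have "a + g * m - 1 + g * n = (a - 1) + g * (m + n)" using that by (auto simp: algebra_simps)
    also have "((a - 1) + g * (m + n)) mod r = g * ((m + n) mod d) + (a - 1)"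
    proof -
      have "a - 1 < g" using that by auto
      then have "((a - 1) + g * (m + n)) div g = m + n" "((a - 1) + g * (m + n)) mod g = a - 1"
        using \<open>g > 0\<close> by auto
      then show ?thesis unfolding assms(1) mod_mult2_eq by simp
    qed
    finally show ?thesis using that by simp
  qed
  \<comment> \<open>The permutation \<open>\<pi>\<close> acts on the names of the cycles, and
    \<open>e a\<close> is the rotation applied on the way from cycle \<open>a\<close> to cycle
    \<open>\<pi> a\<close>.\<close>
  define \<Psi> where "\<Psi> = (\<lambda>(\<pi>, e) i. if i \<in> {1..r} then \<pi> (A i) + g * ((e (A i) + M i) mod d) else i)"
  let ?C = "{x \<in> perms r. ?c \<circ> x = x \<circ> ?c}"
  let ?P = "perms g \<times> ({1..g} \<rightarrow>\<^sub>E {..<d})"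
  have \<Psi>: "\<Psi> (\<pi>, e) (a + g * m) = \<pi> a + g * ((e a + m) mod d)" if "a \<in> {1..g}" "m < d" for \<pi> e a m
    using enc_mem[OF that] dec[OF that(1)] by (simp add: \<Psi>_def)
  have \<Psi>_mem: "\<Psi> (\<pi>, e) \<in> ?C" if \<pi>: "\<pi> \<in> perms g" for \<pi> e
  proof -
    have \<pi>p: "\<pi> permutes {1..g}" using \<pi> by (simp add: perms_def)
    have \<pi>m: "\<pi> a \<in> {1..g}" if "a \<in> {1..g}" for a using that permutes_in_image[OF \<pi>p] by simp
    have mem: "\<Psi> (\<pi>, e) i \<in> {1..r}" if "i \<in> {1..r}" for i
      using that enc_mem[OF \<pi>m[OF A_mem[of i]], of "(e (A i) + M i) mod d"] \<open>d > 0\<close>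
      by (simp add: \<Psi>_def)
    have "inj_on (\<Psi> (\<pi>, e)) {1..r}"
    proof (rule inj_onI)
      fix i j assume ij: "i \<in> {1..r}" "j \<in> {1..r}" "\<Psi> (\<pi>, e) i = \<Psi> (\<pi>, e) j"
      then have eq: "\<pi> (A i) + g * ((e (A i) + M i) mod d) = \<pi> (A j) + g * ((e (A j) + M j) mod d)"
        by (simp add: \<Psi>_def)
      have "\<pi> (A i) = \<pi> (A j)" "(e (A i) + M i) mod d = (e (A j) + M j) mod d"
        using dec[OF \<pi>m[OF A_mem[of i]]] dec[OF \<pi>m[OF A_mem[of j]]] eq by metis+
      moreover from this have A: "A i = A j" using injD[OF permutes_inj[OF \<pi>p]] by blast
      ultimately have "(M i + e (A i)) mod d = (M j + e (A i)) mod d" by (simp add: add.commute)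
      then obtain p q where "M i + e (A i) + d * p = M j + e (A i) + d * q"
        unfolding nat_mod_eq_iff by blast
      then have "M i + d * p = M j + d * q" by simp
      then have "M i mod d = M j mod d" by (metis mod_mult_self2)
      then have "M i = M j" using M_less ij by simp
      then have "A i + g * M i = A j + g * M j" using A by simp
      then show "i = j" using AM[of i] AM[of j] ij by simp
    qed
    then have "bij_betw (\<Psi> (\<pi>, e)) {1..r} {1..r}"
      unfolding bij_betw_def using mem by (intro conjI endo_inj_surj) auto
    then have "\<Psi> (\<pi>, e) \<in> perms r"
      unfolding perms_def by (auto intro!: bij_imp_permutes simp: \<Psi>_def)
    moreover have "(?c \<circ> \<Psi> (\<pi>, e)) i = (\<Psi> (\<pi>, e) \<circ> ?c) i" for i
    proof (cases "i \<in> {1..r}")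
      case True
      note m = M_less[OF True]
      have i: "A i + g * M i = i" using AM[of i] True by simp
      have lt: "(e (A i) + M i) mod d < d" "(M i + 1) mod d < d" using \<open>d > 0\<close> by simp_all
      have "?c (\<Psi> (\<pi>, e) (A i + g * M i)) = \<pi> (A i) + g * (((e (A i) + M i) mod d + 1) mod d)"
        unfolding \<Psi>[OF A_mem m] using c_pow[OF \<pi>m[OF A_mem] lt(1), of 1] by simp
      also have "((e (A i) + M i) mod d + 1) mod d = (e (A i) + (M i + 1) mod d) mod d"
        by (simp add: mod_simps)
      also have "\<pi> (A i) + g * \<dots> = \<Psi> (\<pi>, e) (?c (A i + g * M i))"
        using c_pow[OF A_mem m, of 1] \<Psi>[OF A_mem lt(2)] by simp
      finally show ?thesis using i by simp
    next
      case False
      then show ?thesis by (auto simp: \<Psi>_def long_cycle_funpow)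
    qed
    ultimately show ?thesis by auto
  qed
  have inj: "inj_on \<Psi> ?P"
  proof (rule inj_onI, clarify)
    fix \<pi> e \<pi>' e'
    assume \<pi>: "\<pi> \<in> perms g" "\<pi>' \<in> perms g" and e: "e \<in> {1..g} \<rightarrow>\<^sub>E {..<d}" "e' \<in> {1..g} \<rightarrow>\<^sub>E {..<d}"
      and eq: "\<Psi> (\<pi>, e) = \<Psi> (\<pi>', e')"
    have p: "\<pi> permutes {1..g}" "\<pi>' permutes {1..g}" using \<pi> by (simp_all add: perms_def)
    have *: "\<pi> a = \<pi>' a \<and> e a = e' a" if a: "a \<in> {1..g}" for a
    proof -
      have "e a < d" "e' a < d" using e a by auto
      then have "\<pi> a + g * e a = \<pi>' a + g * e' a"
        using fun_cong[OF eq, of "a + g * 0"] \<Psi>[OF a \<open>d > 0\<close>] by simp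
      moreover have "\<pi> a \<in> {1..g}" "\<pi>' a \<in> {1..g}"
        using a permutes_in_image[OF p(1)] permutes_in_image[OF p(2)] by simp_all
      ultimately show ?thesis using dec by metis
    qed
    have "\<pi> = \<pi>'"
    proof (rule ext)
      fix a show "\<pi> a = \<pi>' a"
        using * permutes_not_in[OF p(1), of a] permutes_not_in[OF p(2), of a] by metis
    qed
    moreover have "e = e'" by (rule PiE_ext[OF e]) (use * in blast)
    ultimately show "\<pi> = \<pi>' \<and> e = e'" by blast
  qed
  have image: "\<Psi> ` ?P = ?C"
  proof (intro equalityI subsetI)
    fix x assume "x \<in> \<Psi> ` ?P"
    then show "x \<in> ?C" using \<Psi>_mem by auto
  next
    fix x assume "x \<in> ?C"
    then have x: "x permutes {1..r}" and comm: "?c \<circ> x = x \<circ> ?c" by (auto simp: perms_def)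
    \<comment> \<open>Both components are read off from the images of the least elements of the
      cycles, which have position 0.\<close>
    define \<pi> where "\<pi> a = (if a \<in> {1..g} then A (x a) else a)" for a
    define e where "e = restrict (\<lambda>a. M (x a)) {1..g}"
    have sub: "a \<in> {1..r}" if "a \<in> {1..g}" for a using enc_mem[OF that \<open>d > 0\<close>] by simp
    have xm: "x i \<in> {1..r}" if "i \<in> {1..r}" for i using that permutes_in_image[OF x] by simp
    \<comment> \<open>Commutation determines \<open>x\<close> on a whole cycle by its value at the
      least element.\<close>
    have shift: "x (a + g * m) = A (x a) + g * ((M (x a) + m) mod d)"
      if a: "a \<in> {1..g}" and m: "m < d" for a m
    proof -
      have "(long_cycle r ^^ (g * m)) \<circ> x = x \<circ> (long_cycle r ^^ (g * m))"
        using funpow_commute[OF comm, of m] by (simp add: funpow_mult mult.commute)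
      moreover have "(long_cycle r ^^ (g * m)) a = a + g * m"
        using c_pow[OF a \<open>d > 0\<close>, of m] m by simp
      ultimately have "x (a + g * m) = (long_cycle r ^^ (g * m)) (x a)" by (metis comp_apply)
      also have "x a = A (x a) + g * M (x a)" using AM[of "x a"] xm[OF sub[OF a]] by simp
      also have "(long_cycle r ^^ (g * m)) \<dots> = A (x a) + g * ((M (x a) + m) mod d)"
        by (rule c_pow[OF A_mem M_less[OF xm[OF sub[OF a]]]])
      finally show ?thesis .
    qed
    have "inj_on \<pi> {1..g}"
    proof (rule inj_onI)
      fix a b assume ab: "a \<in> {1..g}" "b \<in> {1..g}" "\<pi> a = \<pi> b"
      \<comment> \<open>The number of steps from \<open>x b\<close> to \<open>x a\<close> when both
        lie in one cycle; \<open>d\<close> is added before subtracting to stay in the natural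
        numbers. Then \<open>b + g * m\<close> and \<open>a\<close> have the same image under
        \<open>x\<close>, so they are equal and lie in the same cycle.\<close>
      define m where "m = (M (x a) + (d - M (x b))) mod d"
      have lt: "M (x a) < d" "M (x b) < d" "m < d"
        using M_less xm sub ab \<open>d > 0\<close> by (auto simp: m_def)
      have "(M (x b) + m) mod d = (M (x b) + (M (x a) + (d - M (x b)))) mod d"
        unfolding m_def by (rule mod_add_right_eq)
      also have "M (x b) + (M (x a) + (d - M (x b))) = M (x a) + d" using lt by simp
      finally have "(M (x b) + m) mod d = M (x a)" using lt by simp
      then have "x (b + g * m) = A (x b) + g * M (x a)" using shift[OF ab(2) lt(3)] by simp
      also have "\<dots> = x a" using ab AM[of "x a"] xm[OF sub[OF ab(1)]] by (simp add: \<pi>_def)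
      finally have "b + g * m = a" using injD[OF permutes_inj[OF x]] by blast
      then show "a = b" using dec(1)[OF ab(2), of m] dec(1)[OF ab(1), of 0] by simp
    qed
    then have "bij_betw \<pi> {1..g} {1..g}"
      unfolding bij_betw_def using A_mem by (intro conjI endo_inj_surj) (auto simp: \<pi>_def)
    then have "\<pi> \<in> perms g" unfolding perms_def by (auto intro!: bij_imp_permutes simp: \<pi>_def)
    moreover have "e \<in> {1..g} \<rightarrow>\<^sub>E {..<d}" using M_less xm sub by (auto simp: e_def)
    moreover have "x = \<Psi> (\<pi>, e)"
    proof (rule ext)
      fix i
      show "x i = \<Psi> (\<pi>, e) i"
      proof (cases "i \<in> {1..r}")
        case True
        have "x (A i + g * M i) = \<Psi> (\<pi>, e) (A i + g * M i)"
          unfolding \<Psi>[OF A_mem M_less[OF True]] shift[OF A_mem M_less[OF True]]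
          using A_mem[of i] by (simp add: \<pi>_def e_def)
        then show ?thesis using AM[of i] True by simp
      next
        case False
        then show ?thesis using permutes_not_in[OF x] by (auto simp: \<Psi>_def)
      qed
    qed
    ultimately show "x \<in> \<Psi> ` ?P" by blast
  qed
  have "card ?C = card ?P" unfolding image[symmetric] by (rule card_image[OF inj])
  also have "\<dots> = fact g * d ^ g" by (simp add: card_cartesian_product card_perms card_PiE)
  finally show ?thesis .
qed

section \<open>Fixed points of the rotation and cyclic sieving\<close>

lemma card_rotation_fixed_points:
  assumes "r > 0"
  shows "card {x \<in> perms r. (rotation r ^^ j) x = x} = fact (gcd j r) * (r div gcd j r) ^ gcd j r"
proof -
  have b: "bij (long_cycle r ^^ j)" by (rule perms_bij[OF funpow_perms[OF long_cycle_perms]])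
  have "{x \<in> perms r. (rotation r ^^ j) x = x} =
      {x \<in> perms r. (long_cycle r ^^ gcd j r) \<circ> x = x \<circ> (long_cycle r ^^ gcd j r)}"
    by (simp only: rotation_funpow conj_act_eq_iff[OF b] commute_long_cycle_power_iff[OF assms, of j])
  then show ?thesis using card_centralizer_power[of r "gcd j r" "r div gcd j r"] assms by simp
qed

lemma cyclic_sieving_permutations:
  fixes P :: "int poly"
  assumes "r > 0"
    and P: "\<And>\<zeta> :: complex. \<zeta> ^ r = 1 \<Longrightarrow> norm \<zeta> = 1 \<Longrightarrow>
      poly (map_poly of_int P) \<zeta> = cnj (poly (comaj_degree r (ch_S r)) \<zeta>)"
  shows "cyclic_sieving r (perms r) (rotation r) P"
  unfolding cyclic_sieving_def
proof (intro conjI ballI allI impI)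
  show "finite (perms r)" by (rule finite_perms)
  show "bij_betw (rotation r) (perms r) (perms r)" by (rule rotation_bij)
  show "(rotation r ^^ r) x = x" for x by (simp add: rotation_funpow long_cycle_funpow_r)
  fix j
  define \<omega> :: complex where "\<omega> = exp (2 * of_real pi * \<i> / of_nat r)"
  define g where "g = gcd j r"
  define d where "d = r div g"
  have r: "r = d * g" and "d > 0"
    using assms(1) by (auto simp: d_def g_def div_greater_zero_iff gcd_le2_nat)
  have prim: "(\<omega> ^ j) ^ k = 1 \<longleftrightarrow> d dvd k" for k
    unfolding \<omega>_def d_def g_def by (rule root_of_unity_order[OF assms(1)])
  have "norm \<omega> = 1" by (simp add: \<omega>_def norm_exp_eq_Re)
  then have "norm (\<omega> ^ j) = 1" by (simp add: norm_power)
  moreover have "(\<omega> ^ j) ^ r = 1" unfolding prim by (simp add: r)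
  ultimately have "poly (map_poly of_int P) (\<omega> ^ j) = cnj (poly (comaj_degree r (ch_S r)) (\<omega> ^ j))"
    by (intro P)
  also have "poly (comaj_degree r (ch_S r)) (\<omega> ^ j) = fact g * of_nat d ^ g"
    unfolding ch_S_eq using comaj_degree_root[OF \<open>d > 0\<close> prim, of g] unfolding r .
  \<comment> \<open>The value is a natural number, so conjugation leaves it unchanged.\<close>
  also have "cnj (fact g * of_nat d ^ g) = of_nat (card {x \<in> perms r. (rotation r ^^ j) x = x})"
    unfolding card_rotation_fixed_points[OF assms(1)] by (simp add: d_def g_def)
  finally show "poly (map_poly of_int P) (exp (2 * of_real pi * \<i> / of_nat r) ^ j) =
      of_nat (card {x \<in> perms r. (rotation r ^^ j) x = x})"
    unfolding \<omega>_def .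
qed

theorem theorem9p6p1:
  fixes r :: nat
  assumes "r \<ge> 1"
  shows "fake_degree r (ch_S r) = fake_degree r (\<lambda>m. \<Sum>\<mu>\<in>partitions r. power_sum \<mu> m) \<and>
    (\<exists>P :: int poly. map_poly of_int P = fake_degree r (ch_S r) \<and>
       cyclic_sieving r (perms r) (rotation r) P)"
proof (intro conjI)
  show "fake_degree r (ch_S r) = fake_degree r (\<lambda>m. \<Sum>\<mu>\<in>partitions r. power_sum \<mu> m)"
    by (simp only: ch_S_eq)
  have "symmetric_series r (ch_S r)"
    unfolding ch_S_eq
    using symmetric_series_sum[of "partitions r" r power_sum "\<lambda>_. 1"] symmetric_power_sum
      partitionsD(2) by fastforce
  moreover have "ch_S r m \<in> \<int>" for m
    unfolding ch_S_eq by (intro Ints_sum power_sum_integral)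
  ultimately obtain P :: "int poly" where P: "map_poly of_int P = fake_degree r (ch_S r)"
    "\<And>\<zeta> :: complex. \<zeta> ^ r = 1 \<Longrightarrow> norm \<zeta> = 1 \<Longrightarrow>
       poly (map_poly of_int P) \<zeta> = cnj (poly (comaj_degree r (ch_S r)) \<zeta>)"
    using fake_degree_integral[of r "ch_S r"] by metis
  then show "\<exists>P :: int poly. map_poly of_int P = fake_degree r (ch_S r) \<and>
       cyclic_sieving r (perms r) (rotation r) P"
    using cyclic_sieving_permutations[of r P] assms by auto
qed

end
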